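(* Write $L=\|f'\|_{C[-\beta,\beta]}$. Suppose the exact solution satisfies $u_e\in C^3([0,T];C^4(\overline\Omega))$ and $\|u_e(0)\|_\infty\le\beta$, and let $\kappa\ge L$. Then there is a constant $C>0$, independent of the discretization parameters $\tau$, $h$ (and of $n$), such that whenever $$0<\tau\le\min\Big\{\frac{2}{\kappa+L},\ \frac{2h^2}{\kappa h^2+2\varepsilon^2},\ \frac{\kappa^2}{(L+4\kappa)^2}\Big\},$$ the solution $(u^n)$ of the SS2 method with initial value $u^0=u_e(0)$ (restricted to the grid) satisfies $$\|u_e(t_n)-u^n\|_\kappa\le C\Big(\frac{\varepsilon^4\tau^2}{h^3}+\frac{\varepsilon^2\tau^2}{h}+\tau^2+\varepsilon^2h^2\Big),\qquad 0\le n\le\Big\lfloor\frac{T}{\tau}\Big\rfloor.$$ Consequently, for every constant $c>0$ independent of the discretization parameters there is a constant $C>0$ independent of the discretization parameters such that, if in addition the spatial step satisfies $h\ge c\,\varepsilon^{4/3}$, then $$\|u_e(t_n)-u^n\|_\kappa\le C(\tau^2+\varepsilon^2h^2),\qquad 0\le n\le\Big\lfloor\frac{T}{\tau}\Big\rfloor.$$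
   Context: Problem: $u_e(x,y,t)$ is the exact solution of the Allen-Cahn equation $u_t=\varepsilon^2\Delta u+f(u)$ on $\Omega=(0,2\pi)^2$, $t\in(0,T]$, with periodic boundary conditions ($2\pi$-periodic in $x$ and $y$; the regularity is understood for the periodic function), $T>0$, $\varepsilon>0$. In expressions with grid functions, $u_e(t_n)$ denotes the grid function $(u_e(x_i,y_j,t_n))_{ij}$, $x_i=ih$, $y_j=jh$. Assumptions on $f$: $\beta>0$ is a constant, $f$ is a real-valued function on an interval containing $[-\beta,\beta]$, continuously differentiable on $[-\beta,\beta]$; $f$ is odd and $f(\beta)=0$. Here $\|f'\|_{C[-\beta,\beta]}=\max_{\xi\in[-\beta,\beta]}|f'(\xi)|$. Grid: $M$ is a positive integer, $h=2\pi/M$. $\mathbb{M}_h$ is the space of real grid functions $v=(v_{ij})_{0\le i,j\le M-1}$ (indices extended periodically mod $M$), identified with $M\times M$ real matrices, with $\langle v,w\rangle=h^2\sum_{i,j=0}^{M-1}v_{ij}w_{ij}$, $\|v\|=\sqrt{\langle v,v\rangle}$. The discrete gradient is $\nabla_hv_{ij}=\big(\frac{v_{i+1,j}-v_{ij}}{h},\frac{v_{i,j+1}-v_{ij}}{h}\big)^{\mathrm T}$, and for pairs $\bm v=(v^1,v^2)$ of grid functions $\|\bm v\|^2=\|v^1\|^2+\|v^2\|^2$. Define $\|v\|_\kappa^2=\frac{\varepsilon^2}{2}\|\nabla_hv\|^2+\kappa\|v\|^2$. $\|\cdot\|_\infty$ is the supremum norm. $\tau>0$ is the time step and $t_n=n\tau$.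 Operators: $D_a$ is the $M\times M$ matrix (indices $0,\dots,M-1$) equal to $h^{-2}$ times the matrix with $-1$ on the diagonal, $1$ at positions $(i,i+1)$ for $0\le i\le M-2$, $1$ at position $(0,M-1)$, and zeros elsewhere (contributions at coinciding positions are added when $M\le 2$). $D_b=D_a^{\mathrm T}$. For $v\in\mathbb{M}_h$ set $\varDelta_a v=D_av+vD_a^{\mathrm T}$ and $\varDelta_b v=D_bv+vD_b^{\mathrm T}$. SS2 method with stabilization parameter $\kappa>0$ ($f$ acts entrywise): given $u^n$, the intermediate value $w^n$ and then $u^{n+1}$ are determined by $$\frac{w^n-u^n}{\tau/2}=\varepsilon^2(\varDelta_au^n+\varDelta_bw^n)+f(u^n)-\kappa(w^n-u^n),$$ $$\frac{u^{n+1}-w^n}{\tau/2}=\varepsilon^2(\varDelta_au^{n+1}+\varDelta_bw^n)+f(u^{n+1})+\kappa(u^{n+1}-w^n),$$ where in the second (implicit) half step, which is the ESS1-adjoint method with step $\tau/2$, the solution $u^{n+1}$ generated is the unique one with all entries in $[-\beta,\beta]$. *)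

theory Defs
  imports "HOL-Analysis.Analysis" "Jordan_Normal_Form.Matrix"
begin

section \<open>Periodic functions on the plane and their regularity\<close>

text \<open>A function on the torus is represented by its $2\pi$-periodic extension to the plane.\<close>

definition periodic2 :: "(real \<times> real \<Rightarrow> real) \<Rightarrow> bool" where
  "periodic2 g \<longleftrightarrow> (\<forall>x y. g (x + 2 * pi, y) = g (x, y) \<and> g (x, y + 2 * pi) = g (x, y))"

definition dx :: "(real \<times> real \<Rightarrow> real) \<Rightarrow> real \<times> real \<Rightarrow> real" where
  "dx g = (\<lambda>(x, y). deriv (\<lambda>s. g (s, y)) x)"

definition dy :: "(real \<times> real \<Rightarrow> real) \<Rightarrow> real \<times> real \<Rightarrow> real" where
  "dy g = (\<lambda>(x, y). deriv (\<lambda>s. g (x, s)) y)"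

definition laplacian :: "(real \<times> real \<Rightarrow> real) \<Rightarrow> real \<times> real \<Rightarrow> real" where
  "laplacian g p = dx (dx g) p + dy (dy g) p"

text \<open>All partial derivatives up to order $k$, in every order of differentiation, exist and are
  continuous on the plane.\<close>

primrec C_diff :: "nat \<Rightarrow> (real \<times> real \<Rightarrow> real) \<Rightarrow> bool" where
  "C_diff 0 g \<longleftrightarrow> continuous_on UNIV g"
| "C_diff (Suc k) g \<longleftrightarrow> continuous_on UNIV g \<and>
     (\<forall>x y. (\<lambda>s. g (s, y)) differentiable (at x) \<and> (\<lambda>s. g (x, s)) differentiable (at y)) \<and>
     C_diff k (dx g) \<and> C_diff k (dy g)"

definition sup_norm :: "(real \<times> real \<Rightarrow> real) \<Rightarrow> real" where
  "sup_norm g = (SUP p\<in>{0..2 * pi} \<times> {0..2 * pi}. \<bar>g p\<bar>)"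

definition C_norm :: "nat \<Rightarrow> (real \<times> real \<Rightarrow> real) \<Rightarrow> real" where
  "C_norm k g = (MAX (a, b)\<in>{(a, b). a + b \<le> k}. sup_norm ((dx ^^ a) ((dy ^^ b) g)))"

text \<open>$u \in C^m([0,T]; C^k)$, where $C^k$ is the Banach space of periodic $C^k$ functions with norm
  \<^const>\<open>C_norm\<close> and \<open>v j\<close> is the $j$-th time derivative of \<open>u\<close> as a map into this space:
  difference quotients converge in that norm, one-sidedly at the end points.\<close>

definition C_time_space :: "nat \<Rightarrow> nat \<Rightarrow> real \<Rightarrow> (real \<Rightarrow> real \<times> real \<Rightarrow> real) \<Rightarrow> bool" where
  "C_time_space m k T u \<longleftrightarrow> (\<exists>v :: nat \<Rightarrow> real \<Rightarrow> real \<times> real \<Rightarrow> real.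
     (\<forall>t\<in>{0..T}. v 0 t = u t) \<and>
     (\<forall>j\<le>m. \<forall>t\<in>{0..T}. C_diff k (v j t) \<and> periodic2 (v j t)) \<and>
     (\<forall>j<m. \<forall>t\<in>{0..T}.
        ((\<lambda>s. C_norm k (\<lambda>p. (v j s p - v j t p) / (s - t) - v (Suc j) t p)) \<longlongrightarrow> 0)
          (at t within {0..T})) \<and>
     (\<forall>t\<in>{0..T}. ((\<lambda>s. C_norm k (\<lambda>p. v m s p - v m t p)) \<longlongrightarrow> 0) (at t within {0..T})))"

text \<open>The Allen--Cahn problem on $(0,2\pi)^2 \times (0,T]$ with periodic boundary conditions. The
  nonlinearity is only meaningful on its domain \<open>I\<close>, so a solution takes its values there.\<close>

definition allen_cahn_solution ::
  "real \<Rightarrow> real set \<Rightarrow> (real \<Rightarrow> real) \<Rightarrow> real \<Rightarrow> (real \<Rightarrow> real \<times> real \<Rightarrow> real) \<Rightarrow> bool" where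
  "allen_cahn_solution \<epsilon> I f T u \<longleftrightarrow>
     (\<forall>t\<in>{0..T}. periodic2 (u t)) \<and>
     (\<forall>t\<in>{0<..T}. \<forall>p\<in>{0<..<2 * pi} \<times> {0<..<2 * pi}.
        u t p \<in> I \<and>
        ((\<lambda>s. u s p) has_real_derivative \<epsilon>\<^sup>2 * laplacian (u t) p + f (u t p))
          (at t within {0..T}))"

section \<open>Grid functions\<close>

text \<open>A grid function is an $M \times M$ matrix with indices starting at $0$; the row index belongs
  to the first spatial variable.\<close>

definition mesh :: "nat \<Rightarrow> real" where
  "mesh M = 2 * pi / real M"

definition grid_fun :: "nat \<Rightarrow> (real \<times> real \<Rightarrow> real) \<Rightarrow> real mat" where
  "grid_fun M g = Matrix.mat M M (\<lambda>(i, j). g (real i * mesh M, real j * mesh M))"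

definition grid_inner :: "nat \<Rightarrow> real mat \<Rightarrow> real mat \<Rightarrow> real" where
  "grid_inner M v w = (mesh M)\<^sup>2 * (\<Sum>i<M. \<Sum>j<M. v $$ (i, j) * w $$ (i, j))"

definition grid_norm :: "nat \<Rightarrow> real mat \<Rightarrow> real" where
  "grid_norm M v = sqrt (grid_inner M v v)"

definition grad_x :: "nat \<Rightarrow> real mat \<Rightarrow> real mat" where
  "grad_x M v = Matrix.mat M M (\<lambda>(i, j). (v $$ ((i + 1) mod M, j) - v $$ (i, j)) / mesh M)"

definition grad_y :: "nat \<Rightarrow> real mat \<Rightarrow> real mat" where
  "grad_y M v = Matrix.mat M M (\<lambda>(i, j). (v $$ (i, (j + 1) mod M) - v $$ (i, j)) / mesh M)"

definition kappa_norm :: "nat \<Rightarrow> real \<Rightarrow> real \<Rightarrow> real mat \<Rightarrow> real" where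
  "kappa_norm M \<epsilon> \<kappa> v =
     sqrt (\<epsilon>\<^sup>2 / 2 * ((grid_norm M (grad_x M v))\<^sup>2 + (grid_norm M (grad_y M v))\<^sup>2)
           + \<kappa> * (grid_norm M v)\<^sup>2)"

section \<open>The SS2 method\<close>

text \<open>The three contributions are added, which matters when positions coincide ($M \le 2$).\<close>

definition D_a :: "nat \<Rightarrow> real mat" where
  "D_a M = (1 / (mesh M)\<^sup>2) \<cdot>\<^sub>m Matrix.mat M M (\<lambda>(i, j).
     (if i = j then - 1 else 0) + (if j = i + 1 then 1 else 0)
     + (if i = 0 \<and> j = M - 1 then 1 else 0))"

definition D_b :: "nat \<Rightarrow> real mat" where
  "D_b M = transpose_mat (D_a M)"

definition Delta_a :: "nat \<Rightarrow> real mat \<Rightarrow> real mat" where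
  "Delta_a M v = D_a M * v + v * transpose_mat (D_a M)"

definition Delta_b :: "nat \<Rightarrow> real mat \<Rightarrow> real mat" where
  "Delta_b M v = D_b M * v + v * transpose_mat (D_b M)"

text \<open>One step from \<open>u\<close> to \<open>u'\<close> with intermediate value \<open>w\<close>. The second equation is nonlinear and
  implicit in \<open>u'\<close>; the method selects its solution with entries in $[-\beta,\beta]$.\<close>

definition SS2_step :: "nat \<Rightarrow> real \<Rightarrow> real \<Rightarrow> real \<Rightarrow> (real \<Rightarrow> real) \<Rightarrow> real \<Rightarrow>
    real mat \<Rightarrow> real mat \<Rightarrow> real mat \<Rightarrow> bool" where
  "SS2_step M \<epsilon> \<kappa> \<beta> f \<tau> u w u' \<longleftrightarrow>
     w \<in> carrier_mat M M \<and> u' \<in> carrier_mat M M \<and>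
     (1 / (\<tau> / 2)) \<cdot>\<^sub>m (w - u)
       = \<epsilon>\<^sup>2 \<cdot>\<^sub>m (Delta_a M u + Delta_b M w) + map_mat f u - \<kappa> \<cdot>\<^sub>m (w - u) \<and>
     (1 / (\<tau> / 2)) \<cdot>\<^sub>m (u' - w)
       = \<epsilon>\<^sup>2 \<cdot>\<^sub>m (Delta_a M u' + Delta_b M w) + map_mat f u' + \<kappa> \<cdot>\<^sub>m (u' - w) \<and>
     (\<forall>i<M. \<forall>j<M. u' $$ (i, j) \<in> {-\<beta>..\<beta>})"

definition SS2_solution :: "nat \<Rightarrow> real \<Rightarrow> real \<Rightarrow> real \<Rightarrow> (real \<Rightarrow> real) \<Rightarrow> real \<Rightarrow>
    real mat \<Rightarrow> (nat \<Rightarrow> real mat) \<Rightarrow> bool" where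
  "SS2_solution M \<epsilon> \<kappa> \<beta> f \<tau> u0 u \<longleftrightarrow>
     u 0 = u0 \<and> (\<forall>n. \<exists>w. SS2_step M \<epsilon> \<kappa> \<beta> f \<tau> (u n) w (u (Suc n)))"

definition step_bound :: "real \<Rightarrow> real \<Rightarrow> real \<Rightarrow> nat \<Rightarrow> real" where
  "step_bound \<epsilon> \<kappa> L M = Min {2 / (\<kappa> + L),
     2 * (mesh M)\<^sup>2 / (\<kappa> * (mesh M)\<^sup>2 + 2 * \<epsilon>\<^sup>2), \<kappa>\<^sup>2 / (L + 4 * \<kappa>)\<^sup>2}"

end

theory Submission
  imports Defs
begin

text \<open>The scheme is a symmetric composition: the explicit-implicit half step is followed by its adjoint.
  Write \<open>a = \<epsilon>\<^sup>2 \<Delta>\<^sub>a\<close>, \<open>b = \<epsilon>\<^sup>2 \<Delta>\<^sub>b\<close>, \<open>h\<close> for the mesh width and \<open>\<langle>v, w\<rangle>\<close> for the sum of \<open>v w\<close> over the grid. Since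
  \<open>b\<close> is the transpose of \<open>a\<close>, testing the two half steps of the error equation with their own increments
  turns the stiff terms into the exact increment of \<open>\<langle>a e, e\<rangle>\<close>, and \<open>\<kappa> \<langle>e, e\<rangle> - \<langle>a e, e\<rangle>\<close> is the square of the
  \<open>\<kappa>\<close>-norm up to the factor \<open>h\<^sup>2\<close> (\<open>energy_step\<close>, \<open>energy_eq_grid_dot\<close>, \<open>kappa_norm_energy\<close>). Stability then follows from Gronwall's
  inequality, because the nonlinearity is Lipschitz on \<open>[-\<beta>, \<beta>]\<close>. The numerical values lie there by the choice of the
  root in the implicit half step and the exact values by the maximum principle (\<open>allen_cahn_upper_bound\<close>).

  For consistency an intermediate comparison function is needed. Let \<open>X = (\<tau>/2) (b - \<kappa>)\<close> and let \<open>U\<close> and \<open>V\<close> be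
  the restrictions of the solution and of its time derivative. With \<open>W = U + (\<tau>/2) (1 + X) V\<close> both half steps leave
  the same leading residual \<open>- X\<^sup>2 V\<close>; the remaining residuals are a trapezoidal error \<open>O(\<tau>\<^sup>2)\<close>, the spatial error
  \<open>O(\<epsilon>\<^sup>2 h\<^sup>2)\<close> of \<open>a + b\<close> and \<open>X (V' - V)\<close> (\<open>comparison_residuals\<close>), with \<open>V'\<close> taken one step later.

  The leading residual is the delicate point. The matrix \<open>D\<^sub>a\<close> is triangular, so it is not a cyclic difference:
  its first and last rows map smooth functions to values of size \<open>1 / h\<^sup>2\<close>, and a second application of \<open>b\<close>
  makes the grid norm of \<open>X\<^sup>2 V\<close> too large for the claimed rate. It is therefore not estimated in that
  norm. Because it is common to both half steps it is tested with the increment of the error over the whole step,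
  and summation by parts in time replaces it by pairings \<open>\<langle>X\<^sup>2 V, e\<rangle>\<close> and \<open>\<langle>X\<^sup>2 (V' - V), e\<rangle>\<close>
  (\<open>discrete_Gronwall_pairing\<close>). There one factor \<open>X\<close> is moved to \<open>e\<close>; a discrete trace inequality bounds the
  boundary rows, and each factor costs \<open>h\<^sup>-\<^sup>3\<^sup>/\<^sup>2\<close> (\<open>discrete_trace\<close>, \<open>half_step_op_squared_pairing\<close>). The product is
  the term \<open>\<tau>\<^sup>2 / h\<^sup>3\<close>.

  The constant may depend on \<open>\<epsilon>\<close>. Hence time steps that are not small are harmless: \<open>\<tau> \<le> h\<^sup>2 / \<epsilon>\<^sup>2\<close> then bounds \<open>h\<close>
  from below, and the error is at most \<open>2 \<beta>\<close> at each point. For the same reason the second claim follows from the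
  first: \<open>h \<ge> c \<epsilon>\<^bsup>4/3\<^esup>\<close> bounds both quotients by multiples of \<open>\<tau>\<^sup>2\<close>.\<close>

section \<open>The triangular difference matrices on a periodic sequence\<close>

text \<open>One column of \<open>h\<^sup>2 D\<^sub>a v\<close>. The wrap-around entry of \<open>D\<^sub>a\<close> stands in the upper right corner, so this is
  not the cyclic forward difference: the first and the last row do not annihilate constants.\<close>

definition diff_a :: "nat \<Rightarrow> (nat \<Rightarrow> real) \<Rightarrow> nat \<Rightarrow> real" where
  "diff_a M v i = (if i + 1 < M then v (i + 1) else 0) + (if i = 0 then v (M - 1) else 0) - v i"

text \<open>The transposed matrix, with the wrap-around entry in the lower left corner.\<close>

definition diff_b :: "nat \<Rightarrow> (nat \<Rightarrow> real) \<Rightarrow> nat \<Rightarrow> real" where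
  "diff_b M v i = (if i = 0 then 0 else v (i - 1)) + (if i = M - 1 then v 0 else 0) - v i"

definition cyclic_diff :: "nat \<Rightarrow> (nat \<Rightarrow> real) \<Rightarrow> nat \<Rightarrow> real" where
  "cyclic_diff M v i = v ((i + 1) mod M) - v i"

lemma sum_cyclic_shift: "(\<Sum>i<M. g ((i + 1) mod M)) = (\<Sum>i<M. g i)" for g :: "nat \<Rightarrow> real"
proof (cases M)
  case (Suc m)
  have "(\<Sum>i<M. g ((i + 1) mod M)) = (\<Sum>i<m. g (Suc i)) + g 0"
    by (simp add: Suc)
  also have "\<dots> = (\<Sum>i<M. g i)"
    by (simp add: Suc sum.lessThan_Suc_shift del: sum.lessThan_Suc)
  finally show ?thesis .
qed simp

text \<open>The deviation from the cyclic difference lives in two rows. It carries opposite signs in the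
  transposed matrix, which is why the sum of both matrices is the ordinary periodic second difference
  although neither is consistent on its own.\<close>

lemma diff_a_eq_cyclic_diff:
  assumes "i < M"
  shows "diff_a M v i = cyclic_diff M v i + (if i = 0 then v (M - 1) else 0) - (if i = M - 1 then v 0 else 0)"
proof (cases "i + 1 < M")
  case False
  then have "M = i + 1" using assms by auto
  then show ?thesis by (simp add: diff_a_def cyclic_diff_def)
qed (use assms in \<open>auto simp: diff_a_def cyclic_diff_def\<close>)

lemma diff_a_adjoint:
  "(\<Sum>i<M. diff_a M v i * w i) = (\<Sum>i<M. v i * diff_b M w i)"
proof (cases M)
  case (Suc m)
  have "(\<Sum>i<M. diff_a M v i * w i) = (\<Sum>i<M. (if i + 1 < M then v (i + 1) * w i else 0)
      + (if i = 0 then v m * w 0 else 0) - v i * w i)"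
    by (intro sum.cong) (auto simp: diff_a_def Suc algebra_simps)
  also have "\<dots> = (\<Sum>i<m. v (i + 1) * w i) + v m * w 0 - (\<Sum>i<M. v i * w i)"
    by (simp add: sum.distrib sum_subtractf Suc sum.If_cases)
  finally have L: "(\<Sum>i<M. diff_a M v i * w i) = (\<Sum>i<m. v (i + 1) * w i) + v m * w 0 - (\<Sum>i<M. v i * w i)" .
  have "(\<Sum>i<M. v i * diff_b M w i) = (\<Sum>i<M. (if i = 0 then 0 else v i * w (i - 1))
      + (if i = m then v m * w 0 else 0) - v i * w i)"
    by (intro sum.cong) (auto simp: diff_b_def Suc algebra_simps)
  also have "\<dots> = (\<Sum>i<M. if i = 0 then 0 else v i * w (i - 1)) + v m * w 0 - (\<Sum>i<M. v i * w i)"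
    by (simp add: sum.distrib sum_subtractf Suc)
  also have "(\<Sum>i<M. if i = 0 then 0 else v i * w (i - 1)) = (\<Sum>i<m. v (i + 1) * w i)"
    by (simp add: Suc sum.lessThan_Suc_shift del: sum.lessThan_Suc)
  finally show ?thesis using L by simp
qed simp

text \<open>The two boundary terms of the quadratic form cancel, so only the cyclic differences survive.\<close>

lemma diff_a_energy: "(\<Sum>i<M. diff_a M v i * v i) = - (1 / 2) * (\<Sum>i<M. (cyclic_diff M v i)\<^sup>2)"
proof (cases "M = 0")
  case False
  have "(\<Sum>i<M. diff_a M v i * v i) = (\<Sum>i<M. cyclic_diff M v i * v i
     + (if i = 0 then v (M - 1) * v 0 else 0) - (if i = M - 1 then v 0 * v (M - 1) else 0))"
    by (intro sum.cong) (auto simp: diff_a_eq_cyclic_diff algebra_simps)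
  also have "\<dots> = (\<Sum>i<M. cyclic_diff M v i * v i)"
    using False by (simp add: sum.distrib sum_subtractf)
  also have "\<dots> = (\<Sum>i<M. (1 / 2) * ((v ((i + 1) mod M))\<^sup>2 - (v i)\<^sup>2) - (1 / 2) * (cyclic_diff M v i)\<^sup>2)"
    by (intro sum.cong) (auto simp: cyclic_diff_def power2_eq_square field_simps)
  also have "\<dots> = (1 / 2) * ((\<Sum>i<M. (v ((i + 1) mod M))\<^sup>2) - (\<Sum>i<M. (v i)\<^sup>2))
      - (1 / 2) * (\<Sum>i<M. (cyclic_diff M v i)\<^sup>2)"
    by (simp only: sum_subtractf sum_distrib_left right_diff_distrib)
  also have "(\<Sum>i<M. (v ((i + 1) mod M))\<^sup>2) = (\<Sum>i<M. (v i)\<^sup>2)"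
    by (rule sum_cyclic_shift)
  finally show ?thesis by simp
qed simp

lemma diff_a_add_diff_b:
  assumes "i < M"
  shows "diff_a M v i + diff_b M v i
    = v ((i + 1) mod M) + (if i = 0 then v (M - 1) else v (i - 1)) - 2 * v i"
  using assms by (auto simp: diff_a_eq_cyclic_diff diff_b_def cyclic_diff_def)

text \<open>A boundary value of a sequence is an average plus the variation of \<open>v\<^sup>2\<close>. This discrete trace inequality
  is what tames the inconsistent rows: tested against a function of bounded discrete \<open>H\<^sup>1\<close> norm they cost only
  half a power of \<open>h\<close> more than the consistent ones.\<close>

lemma discrete_trace:
  assumes k: "k < M" and h: "h > 0"
  shows "(v k)\<^sup>2 \<le> (1 / real M + 2 * h) * (\<Sum>i<M. (v i)\<^sup>2) + 1 / (2 * h) * (\<Sum>i<M. (cyclic_diff M v i)\<^sup>2)"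
proof -
  define B where "B i = 1 / (2 * h) * (cyclic_diff M v i)\<^sup>2 + h * ((v ((i + 1) mod M))\<^sup>2 + (v i)\<^sup>2)" for i
  have B0: "B i \<ge> 0" for i using h by (simp add: B_def)
  have step: "\<bar>(v (Suc i))\<^sup>2 - (v i)\<^sup>2\<bar> \<le> B i" if "Suc i < M" for i
  proof -
    define x y where "x = v (Suc i)" and "y = v i"
    have "0 \<le> (1 / (2 * h)) * (\<bar>x - y\<bar> - h * \<bar>x + y\<bar>)\<^sup>2" using h by simp
    then have "\<bar>x - y\<bar> * \<bar>x + y\<bar> \<le> 1 / (2 * h) * (x - y)\<^sup>2 + h / 2 * (x + y)\<^sup>2"
      using h by (simp add: power2_eq_square field_simps)
    also have "(x + y)\<^sup>2 \<le> 2 * (x\<^sup>2 + y\<^sup>2)"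
      using sum_squares_bound[of x y] by (simp add: power2_sum)
    then have "h / 2 * (x + y)\<^sup>2 \<le> h / 2 * (2 * (x\<^sup>2 + y\<^sup>2))" using h by (intro mult_left_mono) auto
    finally have "\<bar>x\<^sup>2 - y\<^sup>2\<bar> \<le> 1 / (2 * h) * (x - y)\<^sup>2 + h * (x\<^sup>2 + y\<^sup>2)"
      by (simp add: abs_mult[symmetric] power2_eq_square algebra_simps)
    then show ?thesis using that by (simp add: B_def cyclic_diff_def x_def y_def)
  qed
  have dist: "\<bar>(v n)\<^sup>2 - (v m)\<^sup>2\<bar> \<le> sum B {..<M}" if "m \<le> n" "n < M" for m n
  proof -
    have "(v n)\<^sup>2 - (v m)\<^sup>2 = (\<Sum>i = m..<n. (v (Suc i))\<^sup>2 - (v i)\<^sup>2)"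
      using sum_Suc_diff'[OF that(1), of "\<lambda>i. (v i)\<^sup>2"] by simp
    also have "\<bar>\<dots>\<bar> \<le> (\<Sum>i = m..<n. B i)"
      using that step by (intro order_trans[OF sum_abs] sum_mono) auto
    also have "\<dots> \<le> sum B {..<M}" using that B0 by (intro sum_mono2) auto
    finally show ?thesis .
  qed
  have "(v k)\<^sup>2 \<le> (v m)\<^sup>2 + sum B {..<M}" if "m < M" for m
    using dist[of m k] dist[of k m] that k by (cases "m \<le> k") auto
  then have "(\<Sum>m<M. (v k)\<^sup>2) \<le> (\<Sum>m<M. (v m)\<^sup>2 + sum B {..<M})"
    by (intro sum_mono) auto
  then have "M * (v k)\<^sup>2 \<le> (\<Sum>m<M. (v m)\<^sup>2) + M * sum B {..<M}"
    by (simp add: sum.distrib)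
  then have "(v k)\<^sup>2 \<le> 1 / M * (\<Sum>m<M. (v m)\<^sup>2) + sum B {..<M}"
    using k by (simp add: field_simps)
  also have "sum B {..<M} = 1 / (2 * h) * (\<Sum>i<M. (cyclic_diff M v i)\<^sup>2)
      + h * ((\<Sum>i<M. (v ((i + 1) mod M))\<^sup>2) + (\<Sum>i<M. (v i)\<^sup>2))"
    unfolding B_def sum.distrib sum_distrib_left[symmetric] ..
  also have "(\<Sum>i<M. (v ((i + 1) mod M))\<^sup>2) = (\<Sum>i<M. (v i)\<^sup>2)"
    by (rule sum_cyclic_shift)
  finally show ?thesis by (simp add: algebra_simps)
qed

lemma square_sum3: "(x + y + z)\<^sup>2 \<le> 3 * (x\<^sup>2 + y\<^sup>2 + z\<^sup>2)" for x y z :: real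
proof -
  have "0 \<le> (x - y)\<^sup>2 + (y - z)\<^sup>2 + (x - z)\<^sup>2" by simp
  then show ?thesis by (simp add: power2_eq_square algebra_simps)
qed

lemma square_sum2: "(x + y)\<^sup>2 \<le> 2 * (x\<^sup>2 + y\<^sup>2)" for x y :: real
  using sum_squares_bound[of x y] by (simp add: power2_sum)

lemma square_diff2: "(x - y)\<^sup>2 \<le> 2 * (x\<^sup>2 + y\<^sup>2)" for x y :: real
  using square_sum2[of x "-y"] by simp

text \<open>The cyclic part is controlled by the gradient; the two boundary values are controlled by the trace
  inequality.\<close>

lemma sum_diff_a_square:
  assumes "M > 0" and h: "h > 0" "1 / real M \<le> h"
  shows "(\<Sum>i<M. (diff_a M v i)\<^sup>2) \<le> (3 + 3 / h) * (\<Sum>i<M. (cyclic_diff M v i)\<^sup>2) + 18 * h * (\<Sum>i<M. (v i)\<^sup>2)"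
proof -
  have "(diff_a M v i)\<^sup>2 \<le> 3 * (cyclic_diff M v i)\<^sup>2 + (if i = 0 then 3 * (v (M - 1))\<^sup>2 else 0)
      + (if i = M - 1 then 3 * (v 0)\<^sup>2 else 0)" if "i < M" for i
    using that square_sum3[of "cyclic_diff M v i" "if i = 0 then v (M - 1) else 0" "- (if i = M - 1 then v 0 else 0)"]
    by (auto simp: diff_a_eq_cyclic_diff)
  then have "(\<Sum>i<M. (diff_a M v i)\<^sup>2) \<le> (\<Sum>i<M. 3 * (cyclic_diff M v i)\<^sup>2 + (if i = 0 then 3 * (v (M - 1))\<^sup>2 else 0)
      + (if i = M - 1 then 3 * (v 0)\<^sup>2 else 0))"
    by (intro sum_mono) auto
  also have "\<dots> = 3 * (\<Sum>i<M. (cyclic_diff M v i)\<^sup>2) + 3 * (v (M - 1))\<^sup>2 + 3 * (v 0)\<^sup>2"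
    using assms by (simp add: sum.distrib sum_distrib_left)
  also have "\<dots> \<le> 3 * (\<Sum>i<M. (cyclic_diff M v i)\<^sup>2)
     + 6 * (3 * h * (\<Sum>i<M. (v i)\<^sup>2) + 1 / (2 * h) * (\<Sum>i<M. (cyclic_diff M v i)\<^sup>2))"
  proof -
    have "(v k)\<^sup>2 \<le> 3 * h * (\<Sum>i<M. (v i)\<^sup>2) + 1 / (2 * h) * (\<Sum>i<M. (cyclic_diff M v i)\<^sup>2)" if "k < M" for k
    proof -
      have "(1 / real M + 2 * h) * (\<Sum>i<M. (v i)\<^sup>2) \<le> 3 * h * (\<Sum>i<M. (v i)\<^sup>2)"
        using h by (intro mult_right_mono sum_nonneg) auto
      then show ?thesis using discrete_trace[OF that h(1), of v] by linarith
    qed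
    from this[of 0] this[of "M - 1"] assms(1) show ?thesis by simp
  qed
  finally show ?thesis by (simp add: algebra_simps)
qed

lemma sum_diff_b_square: "(\<Sum>i<M. (diff_b M v i)\<^sup>2) \<le> 9 * (\<Sum>i<M. (v i)\<^sup>2)"
proof (cases M)
  case (Suc m)
  have "(diff_b M v i)\<^sup>2 \<le> 3 * (if i = 0 then 0 else (v (i - 1))\<^sup>2) + 3 * (if i = m then (v 0)\<^sup>2 else 0)
     + 3 * (v i)\<^sup>2" for i
    using square_sum3[of "if i = 0 then 0 else v (i - 1)" "if i = m then v 0 else 0" "- v i"]
    by (auto simp: diff_b_def Suc)
  then have "(\<Sum>i<M. (diff_b M v i)\<^sup>2) \<le> (\<Sum>i<M. 3 * (if i = 0 then 0 else (v (i - 1))\<^sup>2)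
       + 3 * (if i = m then (v 0)\<^sup>2 else 0) + 3 * (v i)\<^sup>2)"
    by (rule sum_mono)
  also have "\<dots> = 3 * (\<Sum>i<M. if i = 0 then 0 else (v (i - 1))\<^sup>2)
       + 3 * (\<Sum>i<M. if i = m then (v 0)\<^sup>2 else 0) + 3 * (\<Sum>i<M. (v i)\<^sup>2)"
    by (simp only: sum.distrib sum_distrib_left)
  also have "(\<Sum>i<M. if i = 0 then 0 else (v (i - 1))\<^sup>2) = (\<Sum>i<m. (v i)\<^sup>2)"
    by (simp add: Suc sum.lessThan_Suc_shift del: sum.lessThan_Suc)
  also have "(\<Sum>i<M. if i = m then (v 0)\<^sup>2 else 0) = (v 0)\<^sup>2"
    by (simp add: Suc)
  also have "(\<Sum>i<m. (v i)\<^sup>2) \<le> (\<Sum>i<M. (v i)\<^sup>2)" by (simp add: Suc)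
  also have "(v 0)\<^sup>2 \<le> (\<Sum>i<M. (v i)\<^sup>2)"
    by (rule member_le_sum) (auto simp: Suc)
  finally show ?thesis by simp
qed simp

text \<open>On a smooth sequence, interior rows are \<open>O(h)\<close>; each of the two boundary rows is only \<open>O(1)\<close>.\<close>

lemma sum_diff_b_square_Lipschitz:
  assumes M: "M > 0" and bd: "\<And>i. i < M \<Longrightarrow> \<bar>v i\<bar> \<le> K"
    and lip: "\<And>i. i + 1 < M \<Longrightarrow> \<bar>v (i + 1) - v i\<bar> \<le> K * h"
  shows "(\<Sum>i<M. (diff_b M v i)\<^sup>2) \<le> real M * (K * h)\<^sup>2 + 18 * K\<^sup>2"
proof -
  have K: "K \<ge> 0" using bd[OF M] by linarith
  have "(diff_b M v i)\<^sup>2 \<le> (K * h)\<^sup>2 + (if i = 0 then 9 * K\<^sup>2 else 0) + (if i = M - 1 then 9 * K\<^sup>2 else 0)"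
    if i: "i < M" for i
  proof (cases "i = 0 \<or> i = M - 1")
    case True
    have "\<bar>diff_b M v i\<bar> \<le> 3 * K"
      using True bd[OF i] bd[OF M] bd[of "i - 1"] i K by (auto simp: diff_b_def)
    then have "(diff_b M v i)\<^sup>2 \<le> (3 * K)\<^sup>2" by (rule abs_le_square_iff[THEN iffD1, OF order_trans]) simp
    then show ?thesis using True by (auto simp: power_mult_distrib intro: add_increasing add_increasing2 order_trans[of _ "9 * K\<^sup>2"])
  next
    case False
    then have "\<bar>diff_b M v i\<bar> \<le> K * h" using lip[of "i - 1"] i by (auto simp: diff_b_def)
    then have "(diff_b M v i)\<^sup>2 \<le> (K * h)\<^sup>2" by (rule abs_le_square_iff[THEN iffD1, OF order_trans]) simp
    then show ?thesis using False by simp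
  qed
  then have "(\<Sum>i<M. (diff_b M v i)\<^sup>2) \<le> (\<Sum>i<M. (K * h)\<^sup>2 + (if i = 0 then 9 * K\<^sup>2 else 0)
      + (if i = M - 1 then 9 * K\<^sup>2 else 0))"
    by (intro sum_mono) auto
  also have "\<dots> = real M * (K * h)\<^sup>2 + 18 * K\<^sup>2"
    using M by (simp add: sum.distrib)
  finally show ?thesis .
qed

lemma square_scaled_sum2: "(c * (x + y))\<^sup>2 \<le> 2 * c\<^sup>2 * (x\<^sup>2 + y\<^sup>2)" for c x y :: real
  using square_sum2[of "c * x" "c * y"] by (simp add: power_mult_distrib ring_distribs)

section \<open>Grid functions and the split Laplacian\<close>

definition grid :: "nat \<Rightarrow> (nat \<times> nat) set" where
  "grid M = {..<M} \<times> {..<M}"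

definition grid_sq :: "nat \<Rightarrow> (nat \<times> nat \<Rightarrow> real) \<Rightarrow> real" where
  "grid_sq M v = (\<Sum>p\<in>grid M. (v p)\<^sup>2)"

text \<open>The operator \<open>\<epsilon>\<^sup>2 \<Delta>\<^sub>a\<close> with \<open>c = \<epsilon>\<^sup>2 / h\<^sup>2\<close>, acting on functions of index pairs.\<close>

definition lap_a :: "real \<Rightarrow> nat \<Rightarrow> (nat \<times> nat \<Rightarrow> real) \<Rightarrow> nat \<times> nat \<Rightarrow> real" where
  "lap_a c M v = (\<lambda>(i, j). c * (diff_a M (\<lambda>k. v (k, j)) i + diff_a M (\<lambda>k. v (i, k)) j))"

definition lap_b :: "real \<Rightarrow> nat \<Rightarrow> (nat \<times> nat \<Rightarrow> real) \<Rightarrow> nat \<times> nat \<Rightarrow> real" where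
  "lap_b c M v = (\<lambda>(i, j). c * (diff_b M (\<lambda>k. v (k, j)) i + diff_b M (\<lambda>k. v (i, k)) j))"

definition grid_grad_sq :: "nat \<Rightarrow> (nat \<times> nat \<Rightarrow> real) \<Rightarrow> real" where
  "grid_grad_sq M v = (\<Sum>j<M. \<Sum>i<M. (cyclic_diff M (\<lambda>k. v (k, j)) i)\<^sup>2)
    + (\<Sum>i<M. \<Sum>j<M. (cyclic_diff M (\<lambda>k. v (i, k)) j)\<^sup>2)"

lemma finite_grid [simp]: "finite (grid M)"
  by (simp add: grid_def)

lemma grid_sq_nonneg [simp]: "grid_sq M v \<ge> 0"
  by (simp add: grid_sq_def sum_nonneg)

lemma sum_grid: "(\<Sum>p\<in>grid M. g p) = (\<Sum>i<M. \<Sum>j<M. g (i, j))"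
  by (simp add: grid_def sum.cartesian_product)

lemma sum_grid_swap: "(\<Sum>p\<in>grid M. g p) = (\<Sum>j<M. \<Sum>i<M. g (i, j))"
  unfolding sum_grid by (rule sum.swap)

text \<open>Sums over the grid of terms that act along one coordinate are regrouped into sums over lines, so that
  the one-dimensional results apply.\<close>

lemma sum_grid_lines:
  "(\<Sum>(i, j)\<in>grid M. c * (F i j + G i j)) = c * ((\<Sum>j<M. \<Sum>i<M. F i j) + (\<Sum>i<M. \<Sum>j<M. G i j))"
  for c :: real
proof -
  have "(\<Sum>(i, j)\<in>grid M. c * (F i j + G i j)) = c * ((\<Sum>i<M. \<Sum>j<M. F i j) + (\<Sum>i<M. \<Sum>j<M. G i j))"
    by (simp add: sum_grid sum.distrib sum_distrib_left ring_distribs)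
  also have "(\<Sum>i<M. \<Sum>j<M. F i j) = (\<Sum>j<M. \<Sum>i<M. F i j)"
    by (rule sum.swap)
  finally show ?thesis .
qed

lemma grid_sq_le_of_bound:
  assumes "\<And>p. p \<in> grid M \<Longrightarrow> \<bar>v p\<bar> \<le> K"
  shows "grid_sq M v \<le> (real M)\<^sup>2 * K\<^sup>2"
proof -
  have "(v p)\<^sup>2 \<le> K\<^sup>2" if "p \<in> grid M" for p
    using assms[OF that] by (metis abs_ge_zero power2_abs power_mono)
  then have "grid_sq M v \<le> (\<Sum>p\<in>grid M. K\<^sup>2)" unfolding grid_sq_def by (intro sum_mono)
  then show ?thesis by (simp add: grid_def power2_eq_square)
qed

lemma grid_sq_add: "grid_sq M (\<lambda>p. v p + w p) \<le> 2 * (grid_sq M v + grid_sq M w)"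
  unfolding grid_sq_def sum.distrib[symmetric] sum_distrib_left by (intro sum_mono square_sum2)

lemma grid_sq_diff: "grid_sq M (\<lambda>p. v p - w p) \<le> 2 * (grid_sq M v + grid_sq M w)"
  unfolding grid_sq_def sum.distrib[symmetric] sum_distrib_left by (intro sum_mono square_diff2)

lemma grid_sq_scale: "grid_sq M (\<lambda>p. s * v p) = s\<^sup>2 * grid_sq M v"
  unfolding grid_sq_def by (simp add: sum_distrib_left power_mult_distrib)

lemma lap_adjoint:
  "(\<Sum>p\<in>grid M. lap_a c M v p * w p) = (\<Sum>p\<in>grid M. v p * lap_b c M w p)"
proof -
  have "(\<Sum>p\<in>grid M. lap_a c M v p * w p)
     = c * ((\<Sum>j<M. \<Sum>i<M. diff_a M (\<lambda>k. v (k, j)) i * w (i, j))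
          + (\<Sum>i<M. \<Sum>j<M. diff_a M (\<lambda>k. v (i, k)) j * w (i, j)))"
    unfolding sum_grid_lines[symmetric] by (intro sum.cong) (auto simp: lap_a_def algebra_simps)
  also have "\<dots> = c * ((\<Sum>j<M. \<Sum>i<M. v (i, j) * diff_b M (\<lambda>k. w (k, j)) i)
          + (\<Sum>i<M. \<Sum>j<M. v (i, j) * diff_b M (\<lambda>k. w (i, k)) j))"
    using diff_a_adjoint[of M "\<lambda>k. v (k, _)" "\<lambda>k. w (k, _)"]
      diff_a_adjoint[of M "\<lambda>k. v (_, k)" "\<lambda>k. w (_, k)"] by simp
  also have "\<dots> = (\<Sum>p\<in>grid M. v p * lap_b c M w p)"
    unfolding sum_grid_lines[symmetric] by (intro sum.cong) (auto simp: lap_b_def algebra_simps)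
  finally show ?thesis .
qed

lemma lap_a_energy: "(\<Sum>p\<in>grid M. lap_a c M v p * v p) = - (c / 2) * grid_grad_sq M v"
proof -
  have "(\<Sum>p\<in>grid M. lap_a c M v p * v p)
     = c * ((\<Sum>j<M. \<Sum>i<M. diff_a M (\<lambda>k. v (k, j)) i * v (i, j))
          + (\<Sum>i<M. \<Sum>j<M. diff_a M (\<lambda>k. v (i, k)) j * v (i, j)))"
    unfolding sum_grid_lines[symmetric] by (intro sum.cong) (auto simp: lap_a_def algebra_simps)
  also have "\<dots> = - (c / 2) * grid_grad_sq M v"
    using diff_a_energy[of M "\<lambda>k. v (k, _)"] diff_a_energy[of M "\<lambda>k. v (_, k)"]
    by (simp add: grid_grad_sq_def sum_distrib_left algebra_simps)
  finally show ?thesis .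
qed

text \<open>The factor \<open>3 / h\<close>, instead of a constant, is the price of the boundary rows.\<close>

lemma lap_a_square:
  assumes M: "M > 0" and h: "h > 0" "1 / real M \<le> h"
  shows "grid_sq M (lap_a c M v) \<le> 2 * c\<^sup>2 * ((3 + 3 / h) * grid_grad_sq M v + 36 * h * grid_sq M v)"
proof -
  have "grid_sq M (lap_a c M v) \<le> (\<Sum>(i, j)\<in>grid M. 2 * c\<^sup>2 * ((diff_a M (\<lambda>k. v (k, j)) i)\<^sup>2 + (diff_a M (\<lambda>k. v (i, k)) j)\<^sup>2))"
    unfolding grid_sq_def lap_a_def
    by (intro sum_mono) (auto intro: square_scaled_sum2)
  also have "\<dots> = 2 * c\<^sup>2 * ((\<Sum>j<M. \<Sum>i<M. (diff_a M (\<lambda>k. v (k, j)) i)\<^sup>2)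
     + (\<Sum>i<M. \<Sum>j<M. (diff_a M (\<lambda>k. v (i, k)) j)\<^sup>2))"
    by (rule sum_grid_lines)
  also have "\<dots> \<le> 2 * c\<^sup>2 * ((\<Sum>j<M. (3 + 3 / h) * (\<Sum>i<M. (cyclic_diff M (\<lambda>k. v (k, j)) i)\<^sup>2) + 18 * h * (\<Sum>i<M. (v (i, j))\<^sup>2))
     + (\<Sum>i<M. (3 + 3 / h) * (\<Sum>j<M. (cyclic_diff M (\<lambda>k. v (i, k)) j)\<^sup>2) + 18 * h * (\<Sum>j<M. (v (i, j))\<^sup>2)))"
    using sum_diff_a_square[OF M h] by (intro mult_left_mono add_mono sum_mono) auto
  also have "\<dots> = 2 * c\<^sup>2 * ((3 + 3 / h) * grid_grad_sq M v
     + 18 * h * ((\<Sum>j<M. \<Sum>i<M. (v (i, j))\<^sup>2) + (\<Sum>i<M. \<Sum>j<M. (v (i, j))\<^sup>2)))"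
    unfolding grid_grad_sq_def sum.distrib sum_distrib_left[symmetric] by (simp add: algebra_simps)
  also have "(\<Sum>j<M. \<Sum>i<M. (v (i, j))\<^sup>2) = grid_sq M v"
    unfolding grid_sq_def by (simp add: sum_grid_swap)
  also have "(\<Sum>i<M. \<Sum>j<M. (v (i, j))\<^sup>2) = grid_sq M v"
    unfolding grid_sq_def by (simp add: sum_grid)
  finally show ?thesis by (simp add: algebra_simps)
qed

text \<open>Any bound along the grid lines transfers to the plane; it is used both for rough and for smooth
  arguments.\<close>

lemma lap_b_square_lines:
  assumes "\<And>j. j < M \<Longrightarrow> (\<Sum>i<M. (diff_b M (\<lambda>k. v (k, j)) i)\<^sup>2) \<le> R j"
    and "\<And>i. i < M \<Longrightarrow> (\<Sum>j<M. (diff_b M (\<lambda>k. v (i, k)) j)\<^sup>2) \<le> R' i"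
  shows "grid_sq M (lap_b c M v) \<le> 2 * c\<^sup>2 * ((\<Sum>j<M. R j) + (\<Sum>i<M. R' i))"
proof -
  have "grid_sq M (lap_b c M v) \<le> (\<Sum>(i, j)\<in>grid M. 2 * c\<^sup>2 * ((diff_b M (\<lambda>k. v (k, j)) i)\<^sup>2 + (diff_b M (\<lambda>k. v (i, k)) j)\<^sup>2))"
    unfolding grid_sq_def lap_b_def
    by (intro sum_mono) (auto intro: square_scaled_sum2)
  also have "\<dots> = 2 * c\<^sup>2 * ((\<Sum>j<M. \<Sum>i<M. (diff_b M (\<lambda>k. v (k, j)) i)\<^sup>2)
     + (\<Sum>i<M. \<Sum>j<M. (diff_b M (\<lambda>k. v (i, k)) j)\<^sup>2))"
    by (rule sum_grid_lines)
  also have "\<dots> \<le> 2 * c\<^sup>2 * ((\<Sum>j<M. R j) + (\<Sum>i<M. R' i))"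
    using assms by (intro mult_left_mono add_mono sum_mono) auto
  finally show ?thesis .
qed

lemma lap_b_square: "grid_sq M (lap_b c M v) \<le> 36 * c\<^sup>2 * grid_sq M v"
proof -
  have "grid_sq M (lap_b c M v) \<le> 2 * c\<^sup>2 * ((\<Sum>j<M. 9 * (\<Sum>i<M. (v (i, j))\<^sup>2)) + (\<Sum>i<M. 9 * (\<Sum>j<M. (v (i, j))\<^sup>2)))"
    by (intro lap_b_square_lines sum_diff_b_square)
  also have "(\<Sum>j<M. 9 * (\<Sum>i<M. (v (i, j))\<^sup>2)) = 9 * grid_sq M v"
    unfolding grid_sq_def by (simp add: sum_grid_swap sum_distrib_left)
  also have "(\<Sum>i<M. 9 * (\<Sum>j<M. (v (i, j))\<^sup>2)) = 9 * grid_sq M v"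
    unfolding grid_sq_def by (simp add: sum_grid sum_distrib_left)
  finally show ?thesis by simp
qed

lemma lap_b_square_Lipschitz:
  assumes M: "M > 0" and bd: "\<And>p. p \<in> grid M \<Longrightarrow> \<bar>v p\<bar> \<le> K"
    and lipx: "\<And>i j. \<lbrakk>i + 1 < M; j < M\<rbrakk> \<Longrightarrow> \<bar>v (i + 1, j) - v (i, j)\<bar> \<le> K * h"
    and lipy: "\<And>i j. \<lbrakk>i < M; j + 1 < M\<rbrakk> \<Longrightarrow> \<bar>v (i, j + 1) - v (i, j)\<bar> \<le> K * h"
  shows "grid_sq M (lap_b c M v) \<le> 4 * c\<^sup>2 * real M * (real M * (K * h)\<^sup>2 + 18 * K\<^sup>2)"
proof -
  have "grid_sq M (lap_b c M v) \<le> 2 * c\<^sup>2 * ((\<Sum>j<M. real M * (K * h)\<^sup>2 + 18 * K\<^sup>2) + (\<Sum>i<M. real M * (K * h)\<^sup>2 + 18 * K\<^sup>2))"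
    using assms by (intro lap_b_square_lines sum_diff_b_square_Lipschitz) (auto simp: grid_def)
  then show ?thesis by (simp add: algebra_simps)
qed

lemma lap_a_diff: "lap_a c M (\<lambda>p. v p - w p) p = lap_a c M v p - lap_a c M w p"
  by (cases p) (simp add: lap_a_def diff_a_def algebra_simps)

lemma lap_b_diff: "lap_b c M (\<lambda>p. v p - w p) p = lap_b c M v p - lap_b c M w p"
  by (cases p) (simp add: lap_b_def diff_b_def algebra_simps)

lemma lap_b_add: "lap_b c M (\<lambda>p. v p + w p) p = lap_b c M v p + lap_b c M w p"
  by (cases p) (simp add: lap_b_def diff_b_def algebra_simps)

lemma lap_b_scale: "lap_b c M (\<lambda>p. s * v p) p = s * lap_b c M v p"
  by (cases p) (simp add: lap_b_def diff_b_def algebra_simps)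

section \<open>Energy estimate for one step and summation in time\<close>

text \<open>The square of the \<open>\<kappa>\<close>-norm without the area weight \<open>h\<^sup>2\<close>.\<close>

definition energy :: "real \<Rightarrow> real \<Rightarrow> nat \<Rightarrow> (nat \<times> nat \<Rightarrow> real) \<Rightarrow> real" where
  "energy c \<kappa> M v = c / 2 * grid_grad_sq M v + \<kappa> * grid_sq M v"

definition grid_dot :: "nat \<Rightarrow> (nat \<times> nat \<Rightarrow> real) \<Rightarrow> (nat \<times> nat \<Rightarrow> real) \<Rightarrow> real" where
  "grid_dot M v w = (\<Sum>p\<in>grid M. v p * w p)"

lemma grid_grad_sq_nonneg [simp]: "grid_grad_sq M v \<ge> 0"
  by (auto simp: grid_grad_sq_def intro!: add_nonneg_nonneg sum_nonneg)

lemma grid_dot_Cauchy_Schwarz: "(grid_dot M v w)\<^sup>2 \<le> grid_sq M v * grid_sq M w"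
  unfolding grid_dot_def grid_sq_def by (rule Cauchy_Schwarz_ineq_sum)

lemma energy_eq_grid_dot: "energy c \<kappa> M v = \<kappa> * grid_sq M v - grid_dot M (lap_a c M v) v"
  by (simp add: energy_def grid_dot_def lap_a_energy)

text \<open>The two half steps are tested with their own increments \<open>x = g - e\<close> and \<open>y = e' - g\<close>. Since \<open>b\<close> is the
  transpose of \<open>a\<close>, the stiff terms combine to \<open>\<langle>a e', e'\<rangle> - \<langle>a e, e\<rangle>\<close> and the intermediate value \<open>g\<close> disappears
  from them. The lower order terms are absorbed by the dissipation \<open>(2/t) (\<parallel>x\<parallel>\<^sup>2 + \<parallel>y\<parallel>\<^sup>2)\<close>, and what remains of
  them carries a factor \<open>t\<close>. A perturbation \<open>P\<close>
  that is common to both half steps is kept apart because it is tested with \<open>x + y = e' - e\<close>, a difference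
  in time.\<close>

lemma energy_step:
  assumes t: "0 < t" "t * \<kappa> \<le> 1" and k: "\<kappa> > 0"
    and e1: "\<And>p. p \<in> grid M \<Longrightarrow> 2 / t * (g p - e p) = lap_a c M e p + lap_b c M g p + F p - \<kappa> * (g p - e p) + P p + r p"
    and e2: "\<And>p. p \<in> grid M \<Longrightarrow> 2 / t * (e' p - g p) = lap_a c M e' p + lap_b c M g p + F' p + \<kappa> * (e' p - g p) + P p + r' p"
    and F: "\<And>p. p \<in> grid M \<Longrightarrow> \<bar>F p\<bar> \<le> \<kappa> * \<bar>e p\<bar>"
    and F': "\<And>p. p \<in> grid M \<Longrightarrow> \<bar>F' p\<bar> \<le> \<kappa> * \<bar>e' p\<bar>"
  shows "\<kappa> * grid_sq M e' - grid_dot M (lap_a c M e') e' - (\<kappa> * grid_sq M e - grid_dot M (lap_a c M e) e)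
    \<le> t * (3 * \<kappa>\<^sup>2 * (grid_sq M e + grid_sq M e') + grid_sq M r + grid_sq M r') + grid_dot M P (\<lambda>p. e' p - e p)"
proof -
  let ?a = "lap_a c M" and ?b = "lap_b c M"
  have sw: "grid_dot M (?a v) w = grid_dot M v (?b w)" for v w unfolding grid_dot_def by (rule lap_adjoint)
  have pt: "\<kappa> * (e' p)\<^sup>2 - ?a e' p * e' p - (\<kappa> * (e p)\<^sup>2 - ?a e p * e p)
     - ((?a e p * g p - e p * ?b g p) - (?a e' p * g p - e' p * ?b g p))
    \<le> t * (3 * \<kappa>\<^sup>2 * ((e p)\<^sup>2 + (e' p)\<^sup>2) + (r p)\<^sup>2 + (r' p)\<^sup>2) + P p * (e' p - e p)"
    if p: "p \<in> grid M" for p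
  proof -
    define x y where "x = g p - e p" and "y = e' p - g p"
    define A B where "A = F p + \<kappa> * (e p + e' p) + r p" and "B = F' p + \<kappa> * (e p + e' p) + r' p"
    have 1: "(2 / t + \<kappa>) * x\<^sup>2 = (?a e p + ?b g p) * x + (F p + P p + r p) * x"
    proof -
      have "(2 / t + \<kappa>) * x = ?a e p + ?b g p + (F p + P p + r p)"
        using e1[OF p] by (simp add: x_def[symmetric] algebra_simps)
      then have "(2 / t + \<kappa>) * x * x = (?a e p + ?b g p + (F p + P p + r p)) * x" by simp
      then show ?thesis by (simp add: power2_eq_square algebra_simps)
    qed
    have 2: "(2 / t - \<kappa>) * y\<^sup>2 = (?a e' p + ?b g p) * y + (F' p + P p + r' p) * y"
    proof -
      have "(2 / t - \<kappa>) * y = ?a e' p + ?b g p + (F' p + P p + r' p)"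
        using e2[OF p] by (simp add: y_def[symmetric] algebra_simps)
      then have "(2 / t - \<kappa>) * y * y = (?a e' p + ?b g p + (F' p + P p + r' p)) * y" by simp
      then show ?thesis by (simp add: power2_eq_square algebra_simps)
    qed
    \<comment> \<open>half of the dissipation \<open>2 / t\<close> may be lost to \<open>\<kappa>\<close>, the other half absorbs the lower order terms\<close>
    have young: "z * w \<le> 1 / t * w\<^sup>2 + t / 4 * z\<^sup>2" for z w
    proof -
      have "0 \<le> 1 / t * (w - t / 2 * z)\<^sup>2" using t by simp
      then show ?thesis using t by (simp add: power2_eq_square field_simps)
    qed
    have k2: "1 / t \<le> 2 / t - \<kappa>" using t by (simp add: field_simps)
    have A: "A * x \<le> (2 / t + \<kappa>) * x\<^sup>2 + t / 4 * A\<^sup>2"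
    proof -
      have "1 / t * x\<^sup>2 \<le> (2 / t + \<kappa>) * x\<^sup>2" using k2 k t by (intro mult_right_mono) auto
      then show ?thesis using young[of A x] by linarith
    qed
    have B: "B * y \<le> (2 / t - \<kappa>) * y\<^sup>2 + t / 4 * B\<^sup>2"
    proof -
      have "1 / t * y\<^sup>2 \<le> (2 / t - \<kappa>) * y\<^sup>2" using k2 by (intro mult_right_mono) auto
      then show ?thesis using young[of B y] by linarith
    qed
    have grid_sq4: "(z1 + \<kappa> * (z2 + z3) + z4)\<^sup>2 \<le> 4 * (z1\<^sup>2 + \<kappa>\<^sup>2 * z2\<^sup>2 + \<kappa>\<^sup>2 * z3\<^sup>2 + z4\<^sup>2)" for z1 z2 z3 z4
    proof -
      have "0 \<le> (z1 - \<kappa> * z2)\<^sup>2 + (z1 - \<kappa> * z3)\<^sup>2 + (z1 - z4)\<^sup>2 + (\<kappa> * z2 - \<kappa> * z3)\<^sup>2 + (\<kappa> * z2 - z4)\<^sup>2 + (\<kappa> * z3 - z4)\<^sup>2"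
        by simp
      then show ?thesis by (simp add: power2_eq_square algebra_simps)
    qed
    have Fs: "(F p)\<^sup>2 \<le> \<kappa>\<^sup>2 * (e p)\<^sup>2" "(F' p)\<^sup>2 \<le> \<kappa>\<^sup>2 * (e' p)\<^sup>2"
      using power_mono[OF F[OF p], of 2] power_mono[OF F'[OF p], of 2]
      by (auto simp: power_mult_distrib)
    have "A\<^sup>2 + B\<^sup>2 \<le> 4 * (3 * \<kappa>\<^sup>2 * ((e p)\<^sup>2 + (e' p)\<^sup>2) + (r p)\<^sup>2 + (r' p)\<^sup>2)"
      using grid_sq4[of "F p" "e p" "e' p" "r p"] grid_sq4[of "F' p" "e p" "e' p" "r' p"] Fs
      unfolding A_def B_def by (simp add: algebra_simps)
    then have AB: "t / 4 * A\<^sup>2 + t / 4 * B\<^sup>2 \<le> t * (3 * \<kappa>\<^sup>2 * ((e p)\<^sup>2 + (e' p)\<^sup>2) + (r p)\<^sup>2 + (r' p)\<^sup>2)"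
      using t mult_left_mono[of "A\<^sup>2 + B\<^sup>2" "4 * (3 * \<kappa>\<^sup>2 * ((e p)\<^sup>2 + (e' p)\<^sup>2) + (r p)\<^sup>2 + (r' p)\<^sup>2)" "t / 4"]
      by (simp add: algebra_simps)
    have "\<kappa> * (e' p)\<^sup>2 - \<kappa> * (e p)\<^sup>2 = \<kappa> * (e p + e' p) * (x + y)"
      by (simp add: x_def y_def power2_eq_square algebra_simps)
    moreover have "(?a e p + ?b g p) * x + (?a e' p + ?b g p) * y
      = ?a e' p * e' p - ?a e p * e p + (?a e p * g p - e p * ?b g p) - (?a e' p * g p - e' p * ?b g p)"
      by (simp add: x_def y_def algebra_simps)
    moreover have "P p * (e' p - e p) = P p * x + P p * y"
      by (simp add: x_def y_def algebra_simps)
    moreover have "A * x + B * y = \<kappa> * (e p + e' p) * (x + y) + (F p + r p) * x + (F' p + r' p) * y"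
      by (simp add: A_def B_def algebra_simps)
    ultimately show ?thesis using 1 2 A B AB by (simp add: algebra_simps)
  qed
  have "(\<Sum>p\<in>grid M. \<kappa> * (e' p)\<^sup>2 - ?a e' p * e' p - (\<kappa> * (e p)\<^sup>2 - ?a e p * e p)
     - ((?a e p * g p - e p * ?b g p) - (?a e' p * g p - e' p * ?b g p)))
    \<le> (\<Sum>p\<in>grid M. t * (3 * \<kappa>\<^sup>2 * ((e p)\<^sup>2 + (e' p)\<^sup>2) + (r p)\<^sup>2 + (r' p)\<^sup>2) + P p * (e' p - e p))"
    by (intro sum_mono pt)
  moreover have "(\<Sum>p\<in>grid M. ?a e p * g p - e p * ?b g p) = 0" "(\<Sum>p\<in>grid M. ?a e' p * g p - e' p * ?b g p) = 0"
    using sw[of e g] sw[of e' g] by (auto simp: grid_dot_def sum_subtractf)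
  ultimately show ?thesis
    unfolding grid_dot_def grid_sq_def
    by (simp only: sum.distrib sum_subtractf sum_distrib_left[symmetric] sum_distrib_right[symmetric])
qed

text \<open>Here \<open>s n\<close> stands for the pairing of the common perturbation with the error at time \<open>n\<close> and \<open>x n\<close> for
  its pairing with the error at time \<open>n + 1\<close>. Summation by parts in time: \<open>N n - s n\<close> satisfies a Gronwall
  inequality, since \<open>s (n + 1) - x n\<close> only contains the change of the perturbation during one step, and it
  dominates \<open>N n / 2\<close> up to the constant \<open>C D\<close>.\<close>

lemma discrete_Gronwall_pairing:
  fixes N s x :: "nat \<Rightarrow> real"
  assumes C: "C \<ge> 0" and D: "D \<ge> 0" and t: "t \<ge> 0" "(2 * C + 1) * t \<le> 1 / 2"
    and N: "\<And>n. n \<le> m \<Longrightarrow> N n \<ge> 0" and N0: "N 0 = 0"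
    and step: "\<And>n. n < m \<Longrightarrow> N (Suc n) - N n \<le> C * t * (N n + N (Suc n) + D) + x n - s n"
    and s: "\<And>n. n \<le> m \<Longrightarrow> (s n)\<^sup>2 \<le> C * D * N n"
    and x: "\<And>n. n < m \<Longrightarrow> (s (Suc n) - x n)\<^sup>2 \<le> t\<^sup>2 * (C * D * N (Suc n))"
  shows "N m \<le> 2 * (exp (4 * (2 * C + 1) * (real m * t)) * (C + 1) * D)"
proof -
  define A where "A = 2 * C + 1"
  \<comment> \<open>the shift by \<open>C D\<close> makes \<open>K n\<close> at least \<open>N n / 2\<close>\<close>
  define K where "K n = N n - s n + C * D" for n
  have am: "y \<le> (C * D + z) / 2" if "y\<^sup>2 \<le> C * D * z" "z \<ge> 0" for y z
  proof -
    have "4 * (C * D * z) \<le> (C * D + z)\<^sup>2"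
      using sum_squares_ge_zero[of "C * D - z" 0] by (simp add: power2_eq_square algebra_simps)
    then have "(2 * y)\<^sup>2 \<le> (C * D + z)\<^sup>2" using that by simp
    moreover have "C * D + z \<ge> 0" using C D that by simp
    ultimately have "2 * y \<le> C * D + z" by (rule power2_le_imp_le)
    then show ?thesis by simp
  qed
  have NK: "N n \<le> 2 * K n" if "n \<le> m" for n
    using am[OF s N, OF that that] mult_nonneg_nonneg[OF C D] by (simp add: K_def)
  have stepK: "K (Suc n) + D \<le> (1 + 4 * (A * t)) * (K n + D)" if n: "n < m" for n
  proof -
    have y: "x n - s (Suc n) \<le> t * ((C * D + N (Suc n)) / 2)"
    proof (cases "t = 0")
      case True then show ?thesis using x[OF n] by simp
    next
      case False
      then have "((x n - s (Suc n)) / t)\<^sup>2 \<le> C * D * N (Suc n)"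
        using x[OF n] t by (simp add: power_divide power2_commute[of "x n"] field_simps)
      from am[OF this] N[of "Suc n"] n have "(x n - s (Suc n)) / t \<le> (C * D + N (Suc n)) / 2" by simp
      then show ?thesis using False t by (simp add: field_simps)
    qed
    have "K (Suc n) - K n \<le> C * t * (N n + N (Suc n) + D) + t * ((C * D + N (Suc n)) / 2)"
      using step[OF n] y by (simp add: K_def)
    also have "\<dots> \<le> C * t * (2 * K n + 2 * K (Suc n) + D) + t * (C * D + K (Suc n))"
    proof (intro add_mono mult_left_mono)
      show "(C * D + N (Suc n)) / 2 \<le> C * D + K (Suc n)"
        using NK[of "Suc n"] n mult_nonneg_nonneg[OF C D] by (simp add: field_simps)
    qed (use NK n C t in auto)
    also have "\<dots> \<le> A * t * (K n + K (Suc n) + D)" 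
    proof -
      have "K n \<ge> 0" "K (Suc n) \<ge> 0" using NK[of n] NK[of "Suc n"] N[of n] N[of "Suc n"] n by auto
      then have "0 \<le> t * (K n + D)" using t D by simp
      then show ?thesis by (simp add: A_def algebra_simps)
    qed
    finally have "K (Suc n) - K n \<le> A * t * (K n + K (Suc n) + D)" .
    then have "(1 - A * t) * (K (Suc n) + D) \<le> (1 + A * t) * K n + D" by (simp add: algebra_simps)
    also have "\<dots> \<le> (1 + A * t) * (K n + D)"
      using C D t by (simp add: A_def algebra_simps)
    also have "\<dots> \<le> ((1 - A * t) * (1 + 4 * (A * t))) * (K n + D)"
    proof (rule mult_right_mono)
      have "A * t \<le> 1 / 2" "0 \<le> A * t" using t C by (simp_all add: A_def)
      then have "0 \<le> A * t * (2 - 4 * (A * t))" using mult_nonneg_nonneg[of "A * t" "2 - 4 * (A * t)"] by simp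
      then show "1 + A * t \<le> (1 - A * t) * (1 + 4 * (A * t))" by (simp add: algebra_simps)
      show "0 \<le> K n + D" using NK[of n] N[of n] n D by simp
    qed
    finally have "(1 - A * t) * (K (Suc n) + D) \<le> (1 - A * t) * ((1 + 4 * (A * t)) * (K n + D))"
      by (simp only: mult.assoc)
    moreover have "0 < 1 - A * t" using t by (simp add: A_def)
    ultimately show ?thesis by (simp only: mult_le_cancel_left_pos)
  qed
  have "K n + D \<le> (1 + 4 * (A * t)) ^ n * ((C + 1) * D)" if "n \<le> m" for n
    using that
  proof (induction n)
    case 0
    have "s 0 = 0" using s[of 0] N0 by simp
    then show ?case using N0 by (simp add: K_def algebra_simps)
  next
    case (Suc n)
    have "K (Suc n) + D \<le> (1 + 4 * (A * t)) * (K n + D)" using stepK Suc.prems by simp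
    also have "\<dots> \<le> (1 + 4 * (A * t)) * ((1 + 4 * (A * t)) ^ n * ((C + 1) * D))"
      using Suc C t by (intro mult_left_mono) (auto simp: A_def)
    finally show ?case by (simp add: mult.assoc)
  qed
  from this[of m] have "K m + D \<le> (1 + 4 * (A * t)) ^ m * ((C + 1) * D)" by simp
  also have "\<dots> \<le> exp (4 * (A * t)) ^ m * ((C + 1) * D)"
    using C D t by (intro mult_right_mono power_mono) (auto simp: A_def exp_ge_add_one_self)
  also have "exp (4 * (A * t)) ^ m = exp (4 * A * (real m * t))"
    by (simp add: exp_of_nat_mult[symmetric] algebra_simps)
  finally show ?thesis using NK[of m] D by (simp add: A_def mult.assoc)
qed

section \<open>The half-step operator and its square\<close>

text \<open>The operator \<open>X = (t/2) (b - \<kappa>)\<close>. The half steps of the scheme read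
  \<open>(2/t) (1 - X) (w - u) = (a + b) u + f u\<close> and \<open>(2/t) (1 + X) (u' - w) = (a + b) u' + f u'\<close>.\<close>

definition half_step_op :: "real \<Rightarrow> real \<Rightarrow> real \<Rightarrow> nat \<Rightarrow> (nat \<times> nat \<Rightarrow> real) \<Rightarrow> nat \<times> nat \<Rightarrow> real" where
  "half_step_op c \<kappa> t M z = (\<lambda>p. t / 2 * (lap_b c M z p - \<kappa> * z p))"

lemma half_step_op_diff:
  "half_step_op c \<kappa> t M (\<lambda>p. v p - w p) p = half_step_op c \<kappa> t M v p - half_step_op c \<kappa> t M w p"
  by (simp add: half_step_op_def lap_b_diff algebra_simps)

lemma grid_sq_half_step_op:
  "grid_sq M (half_step_op c \<kappa> t M z) \<le> t\<^sup>2 / 2 * (grid_sq M (lap_b c M z) + \<kappa>\<^sup>2 * grid_sq M z)"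
proof -
  have "grid_sq M (half_step_op c \<kappa> t M z) \<le> (t / 2)\<^sup>2 * (2 * (grid_sq M (lap_b c M z) + grid_sq M (\<lambda>p. \<kappa> * z p)))"
    unfolding half_step_op_def grid_sq_scale[of M "t / 2"] by (intro mult_left_mono grid_sq_diff) auto
  also have "\<dots> = t\<^sup>2 / 2 * (grid_sq M (lap_b c M z) + \<kappa>\<^sup>2 * grid_sq M z)"
    unfolding grid_sq_scale by (simp add: power2_eq_square algebra_simps)
  finally show ?thesis .
qed

text \<open>The step size restriction \<open>t \<epsilon>\<^sup>2 \<le> h\<^sup>2\<close> makes \<open>X\<close> bounded, which is used for the time quadrature error.\<close>

lemma grid_sq_half_step_op_le:
  assumes "0 \<le> t" "\<kappa> > 0" "t * \<kappa> \<le> 1" "c > 0" "t * c \<le> 1"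
  shows "grid_sq M (half_step_op c \<kappa> t M z) \<le> 19 * grid_sq M z"
proof -
  have "grid_sq M (half_step_op c \<kappa> t M z) \<le> t\<^sup>2 / 2 * (36 * c\<^sup>2 * grid_sq M z + \<kappa>\<^sup>2 * grid_sq M z)"
    using lap_b_square by (intro order_trans[OF grid_sq_half_step_op] mult_left_mono add_mono) auto
  also have "\<dots> = (18 * (t * c)\<^sup>2 + (t * \<kappa>)\<^sup>2 / 2) * grid_sq M z"
    by (simp add: power_mult_distrib algebra_simps)
  also have "\<dots> \<le> 19 * grid_sq M z"
  proof (rule mult_right_mono)
    have "(t * c)\<^sup>2 \<le> 1" "(t * \<kappa>)\<^sup>2 \<le> 1" using assms by (auto simp: power_le_one)
    then show "18 * (t * c)\<^sup>2 + (t * \<kappa>)\<^sup>2 / 2 \<le> 19" by simp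
  qed simp
  finally show ?thesis .
qed

lemma grid_dot_half_step_op:
  "grid_dot M (half_step_op c \<kappa> t M z) e = grid_dot M z (\<lambda>p. t / 2 * (lap_a c M e p - \<kappa> * e p))"
proof -
  have "grid_dot M (half_step_op c \<kappa> t M z) e = t / 2 * ((\<Sum>p\<in>grid M. e p * lap_b c M z p) - \<kappa> * (\<Sum>p\<in>grid M. z p * e p))"
    by (simp add: grid_dot_def half_step_op_def sum_distrib_left sum_subtractf algebra_simps)
  also have "(\<Sum>p\<in>grid M. e p * lap_b c M z p) = (\<Sum>p\<in>grid M. lap_a c M e p * z p)"
    by (rule lap_adjoint[symmetric])
  finally show ?thesis
    by (simp add: grid_dot_def sum_distrib_left sum_subtractf algebra_simps)
qed

lemma mesh_pos: "M > 0 \<Longrightarrow> mesh M > 0"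
  by (simp add: mesh_def)

lemma mesh_le: "M > 0 \<Longrightarrow> mesh M \<le> 2 * pi"
  using mult_left_mono[of 1 "real M" "2 * pi"] by (simp add: mesh_def field_simps)

lemma inverse_le_mesh: "M > 0 \<Longrightarrow> 1 / real M \<le> mesh M"
  using pi_ge_two by (simp add: mesh_def divide_right_mono)

text \<open>For a smooth argument the boundary rows dominate: the bound is \<open>h\<^sup>-\<^sup>5\<close>, that is, \<open>h\<^sup>-\<^sup>3\<close> after
  multiplication with the area \<open>h\<^sup>2\<close> of a grid cell, whereas a rough argument would give \<open>h\<^sup>-\<^sup>4\<close>.\<close>

lemma grid_sq_half_step_op_smooth:
  fixes \<epsilon> \<kappa> K :: real
  assumes M: "M > 0" and bd: "\<And>p. p \<in> grid M \<Longrightarrow> \<bar>v p\<bar> \<le> K"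
    and lipx: "\<And>i j. \<lbrakk>i + 1 < M; j < M\<rbrakk> \<Longrightarrow> \<bar>v (i + 1, j) - v (i, j)\<bar> \<le> K * mesh M"
    and lipy: "\<And>i j. \<lbrakk>i < M; j + 1 < M\<rbrakk> \<Longrightarrow> \<bar>v (i, j + 1) - v (i, j)\<bar> \<le> K * mesh M"
  shows "grid_sq M (half_step_op (\<epsilon>\<^sup>2 / (mesh M)\<^sup>2) \<kappa> t M v)
    \<le> t\<^sup>2 * K\<^sup>2 / mesh M ^ 5 * (4 * pi * \<epsilon> ^ 4 * (2 * pi * (2 * pi) + 18) + 2 * pi\<^sup>2 * \<kappa>\<^sup>2 * (2 * pi) ^ 3)"
proof -
  define h where "h = mesh M"
  have h: "h > 0" "h \<le> 2 * pi" using mesh_pos[OF M] mesh_le[OF M] by (auto simp: h_def)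
  have Mh: "real M = 2 * pi / h" using M by (simp add: h_def mesh_def)
  let ?c = "\<epsilon>\<^sup>2 / (mesh M)\<^sup>2"
  have "grid_sq M (half_step_op ?c \<kappa> t M v) \<le> t\<^sup>2 / 2 * (4 * ?c\<^sup>2 * real M * (real M * (K * h)\<^sup>2 + 18 * K\<^sup>2)
      + \<kappa>\<^sup>2 * ((real M)\<^sup>2 * K\<^sup>2))"
    unfolding h_def using assms
    by (intro order_trans[OF grid_sq_half_step_op] mult_left_mono add_mono lap_b_square_Lipschitz grid_sq_le_of_bound) auto
  also have "\<dots> = t\<^sup>2 * K\<^sup>2 / h ^ 5 * (4 * pi * \<epsilon> ^ 4 * (2 * pi * h + 18) + 2 * pi\<^sup>2 * \<kappa>\<^sup>2 * h ^ 3)"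
    unfolding Mh h_def[symmetric] using h
    by (simp add: divide_simps) (simp add: eval_nat_numeral algebra_simps)
  also have "\<dots> \<le> t\<^sup>2 * K\<^sup>2 / h ^ 5 * (4 * pi * \<epsilon> ^ 4 * (2 * pi * (2 * pi) + 18) + 2 * pi\<^sup>2 * \<kappa>\<^sup>2 * (2 * pi) ^ 3)"
    using h by (intro mult_left_mono add_mono power_mono order.refl) auto
  finally show ?thesis unfolding h_def .
qed

lemma energy_bounds:
  assumes "c > 0" "\<kappa> > 0"
  shows "grid_grad_sq M e \<le> 2 / c * energy c \<kappa> M e" "grid_sq M e \<le> energy c \<kappa> M e / \<kappa>" "0 \<le> energy c \<kappa> M e"
proof -
  have "0 \<le> \<kappa> * grid_sq M e" "0 \<le> c / 2 * grid_grad_sq M e" using assms by auto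
  then show "grid_grad_sq M e \<le> 2 / c * energy c \<kappa> M e" "grid_sq M e \<le> energy c \<kappa> M e / \<kappa>" "0 \<le> energy c \<kappa> M e"
    using assms by (auto simp: energy_def field_simps)
qed

text \<open>The dual estimate for an argument of which only the energy is known.\<close>

lemma grid_sq_adjoint_half_step_op:
  fixes \<epsilon> \<kappa> :: real
  assumes M: "M > 0" and \<epsilon>: "\<epsilon> > 0" and \<kappa>: "\<kappa> > 0"
  shows "grid_sq M (\<lambda>p. t / 2 * (lap_a (\<epsilon>\<^sup>2 / (mesh M)\<^sup>2) M e p - \<kappa> * e p))
    \<le> t\<^sup>2 / mesh M ^ 3 * energy (\<epsilon>\<^sup>2 / (mesh M)\<^sup>2) \<kappa> M e
        * (6 * \<epsilon>\<^sup>2 * (2 * pi + 1) + 36 * \<epsilon> ^ 4 / \<kappa> + \<kappa> / 2 * (2 * pi) ^ 3)"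
proof -
  define h where "h = mesh M"
  have h: "h > 0" "h \<le> 2 * pi" "1 / real M \<le> h"
    using mesh_pos[OF M] mesh_le[OF M] inverse_le_mesh[OF M] by (auto simp: h_def)
  define c where "c = \<epsilon>\<^sup>2 / h\<^sup>2"
  have c: "c > 0" using \<epsilon> h by (simp add: c_def)
  define N where "N = energy c \<kappa> M e"
  note N = energy_bounds[OF c \<kappa>, of M e, folded N_def]
  have "grid_sq M (\<lambda>p. t / 2 * (lap_a c M e p - \<kappa> * e p))
     \<le> (t / 2)\<^sup>2 * (2 * (grid_sq M (lap_a c M e) + grid_sq M (\<lambda>p. \<kappa> * e p)))"
    unfolding grid_sq_scale[of M "t / 2"] by (intro mult_left_mono grid_sq_diff) auto
  also have "\<dots> = t\<^sup>2 / 2 * (grid_sq M (lap_a c M e) + \<kappa>\<^sup>2 * grid_sq M e)"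
    unfolding grid_sq_scale by (simp add: power2_eq_square algebra_simps)
  also have "\<dots> \<le> t\<^sup>2 / 2 * (2 * c\<^sup>2 * ((3 + 3 / h) * grid_grad_sq M e + 36 * h * grid_sq M e) + \<kappa>\<^sup>2 * grid_sq M e)"
    using lap_a_square[OF M h(1) h(3)] by (intro mult_left_mono add_mono) auto
  also have "\<dots> \<le> t\<^sup>2 / 2 * (2 * c\<^sup>2 * ((3 + 3 / h) * (2 / c * N) + 36 * h * (N / \<kappa>)) + \<kappa>\<^sup>2 * (N / \<kappa>))"
    using N h by (intro mult_left_mono add_mono) auto
  also have "\<dots> = t\<^sup>2 / h ^ 3 * N * (6 * \<epsilon>\<^sup>2 * (h + 1) + 36 * \<epsilon> ^ 4 / \<kappa> + \<kappa> / 2 * h ^ 3)"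
    unfolding c_def using h \<epsilon> \<kappa> by (simp add: divide_simps) (simp add: eval_nat_numeral algebra_simps)
  also have "\<dots> \<le> t\<^sup>2 / h ^ 3 * N * (6 * \<epsilon>\<^sup>2 * (2 * pi + 1) + 36 * \<epsilon> ^ 4 / \<kappa> + \<kappa> / 2 * (2 * pi) ^ 3)"
    using h N \<kappa> by (intro mult_left_mono add_mono power_mono order.refl) auto
  finally show ?thesis unfolding h_def c_def N_def .
qed

text \<open>The product of the constants of the two preceding estimates; the denominator converts \<open>h\<^sup>-\<^sup>2\<close> into
  \<open>(real M)\<^sup>2\<close>.\<close>

definition pairing_const :: "real \<Rightarrow> real \<Rightarrow> real" where
  "pairing_const \<epsilon> \<kappa> = (4 * pi * \<epsilon> ^ 4 * (2 * pi * (2 * pi) + 18) + 2 * pi\<^sup>2 * \<kappa>\<^sup>2 * (2 * pi) ^ 3)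
     * (6 * \<epsilon>\<^sup>2 * (2 * pi + 1) + 36 * \<epsilon> ^ 4 / \<kappa> + \<kappa> / 2 * (2 * pi) ^ 3) / (4 * pi\<^sup>2)"

text \<open>The perturbation \<open>X\<^sup>2 v\<close> is too large in the \<open>\<ell>\<^sup>2\<close> norm because \<open>b\<close> acts on the boundary rows produced by
  the first application of \<open>b\<close>. In a pairing with \<open>e\<close> one factor is moved to \<open>e\<close>, and each factor then loses
  only \<open>h\<^sup>-\<^sup>3\<^sup>/\<^sup>2\<close>. This is the origin of the rate \<open>t\<^sup>2 / h\<^sup>3\<close>. The factor \<open>(real M)\<^sup>2\<close> is the inverse cell area,
  up to a constant.\<close>

lemma half_step_op_squared_pairing:
  fixes \<epsilon> \<kappa> K :: real
  assumes M: "M > 0" and \<epsilon>: "\<epsilon> > 0" and \<kappa>: "\<kappa> > 0"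
    and bd: "\<And>p. p \<in> grid M \<Longrightarrow> \<bar>v p\<bar> \<le> K"
    and lipx: "\<And>i j. \<lbrakk>i + 1 < M; j < M\<rbrakk> \<Longrightarrow> \<bar>v (i + 1, j) - v (i, j)\<bar> \<le> K * mesh M"
    and lipy: "\<And>i j. \<lbrakk>i < M; j + 1 < M\<rbrakk> \<Longrightarrow> \<bar>v (i, j + 1) - v (i, j)\<bar> \<le> K * mesh M"
  defines "c \<equiv> \<epsilon>\<^sup>2 / (mesh M)\<^sup>2"
  shows "(grid_dot M (half_step_op c \<kappa> t M (half_step_op c \<kappa> t M v)) e)\<^sup>2
    \<le> K\<^sup>2 * pairing_const \<epsilon> \<kappa> * ((real M)\<^sup>2 * (t\<^sup>2 / mesh M ^ 3)\<^sup>2) * energy c \<kappa> M e"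
proof -
  let ?A = "4 * pi * \<epsilon> ^ 4 * (2 * pi * (2 * pi) + 18) + 2 * pi\<^sup>2 * \<kappa>\<^sup>2 * (2 * pi) ^ 3"
  let ?B = "6 * \<epsilon>\<^sup>2 * (2 * pi + 1) + 36 * \<epsilon> ^ 4 / \<kappa> + \<kappa> / 2 * (2 * pi) ^ 3"
  have h: "mesh M > 0" using mesh_pos[OF M] .
  have "(grid_dot M (half_step_op c \<kappa> t M (half_step_op c \<kappa> t M v)) e)\<^sup>2
    \<le> grid_sq M (half_step_op c \<kappa> t M v) * grid_sq M (\<lambda>p. t / 2 * (lap_a c M e p - \<kappa> * e p))"
    unfolding grid_dot_half_step_op[of M c \<kappa> t "half_step_op c \<kappa> t M v"] by (rule grid_dot_Cauchy_Schwarz)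
  also have "\<dots> \<le> (t\<^sup>2 * K\<^sup>2 / mesh M ^ 5 * ?A) * (t\<^sup>2 / mesh M ^ 3 * energy c \<kappa> M e * ?B)"
    unfolding c_def using assms h
    by (intro mult_mono grid_sq_half_step_op_smooth grid_sq_adjoint_half_step_op) (auto intro!: divide_nonneg_nonneg mult_nonneg_nonneg add_nonneg_nonneg)
  also have "\<dots> = K\<^sup>2 * (?A * ?B / (4 * pi\<^sup>2)) * ((real M)\<^sup>2 * (t\<^sup>2 / mesh M ^ 3)\<^sup>2) * energy c \<kappa> M e"
  proof -
    have Mh: "real M = 2 * pi / mesh M" using M by (simp add: mesh_def)
    have "(t\<^sup>2 / mesh M ^ 5) * (t\<^sup>2 / mesh M ^ 3) = (real M)\<^sup>2 * (t\<^sup>2 / mesh M ^ 3)\<^sup>2 / (4 * pi\<^sup>2)"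
      unfolding Mh using h by (simp add: field_simps eval_nat_numeral)
    then have "(?A * K\<^sup>2 * ?B * energy c \<kappa> M e) * ((t\<^sup>2 / mesh M ^ 5) * (t\<^sup>2 / mesh M ^ 3))
      = (?A * K\<^sup>2 * ?B * energy c \<kappa> M e) * ((real M)\<^sup>2 * (t\<^sup>2 / mesh M ^ 3)\<^sup>2 / (4 * pi\<^sup>2))" by simp
    then show ?thesis by (simp only: times_divide_eq_left times_divide_eq_right mult.assoc mult.commute mult.left_commute)
  qed
  finally show ?thesis by (simp only: pairing_const_def)
qed

section \<open>Residuals of smooth grid functions and discrete convergence\<close>

text \<open>The summands belong to \<open>X (V' - V)\<close>, to the quadrature error and to the spatial error; powers of \<open>2 pi\<close>
  bound positive powers of \<open>h\<close>.\<close>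

definition residual_const :: "real \<Rightarrow> real \<Rightarrow> real" where
  "residual_const \<epsilon> \<kappa> = 4 * (18 * \<epsilon> ^ 4 * (2 * pi)\<^sup>2 + \<kappa>\<^sup>2 / 2 * (2 * pi) ^ 6 + 160 * (2 * pi) ^ 6) + 2"

text \<open>The parts of the residual of the second half step that are small enough without any cancellation in time.\<close>

lemma second_residual_bound:
  fixes \<epsilon> \<kappa> K t :: real
  assumes M: "M > 0" and t: "0 < t" "t * \<kappa> \<le> 1" "t * (\<epsilon>\<^sup>2 / (mesh M)\<^sup>2) \<le> 1"
    and \<epsilon>: "\<epsilon> > 0" and \<kappa>: "\<kappa> > 0"
    and dV: "\<And>p. p \<in> grid M \<Longrightarrow> \<bar>dV p\<bar> \<le> K * t"
    and Q: "\<And>p. p \<in> grid M \<Longrightarrow> \<bar>Q p\<bar> \<le> K * t ^ 3"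
    and \<rho>: "\<And>p. p \<in> grid M \<Longrightarrow> \<bar>\<rho> p\<bar> \<le> K * (mesh M)\<^sup>2"
  defines "X \<equiv> half_step_op (\<epsilon>\<^sup>2 / (mesh M)\<^sup>2) \<kappa> t M"
  shows "grid_sq M (\<lambda>p. X dV p + 2 / t * (Q p + X Q p) - \<rho> p)
    \<le> K\<^sup>2 * residual_const \<epsilon> \<kappa> * ((real M)\<^sup>2 * (t\<^sup>2 / mesh M ^ 3 + (mesh M)\<^sup>2)\<^sup>2)"
proof -
  define h where "h = mesh M"
  define c where "c = \<epsilon>\<^sup>2 / h\<^sup>2"
  define \<delta> where "\<delta> = t\<^sup>2 / h ^ 3 + h\<^sup>2"
  have h: "h > 0" "h \<le> 2 * pi" using mesh_pos[OF M] mesh_le[OF M] by (auto simp: h_def)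
  have c: "c > 0" using \<epsilon> h by (simp add: c_def)
  have X: "X = half_step_op c \<kappa> t M" by (simp add: X_def c_def h_def)
  let ?S = "(real M)\<^sup>2 * K\<^sup>2"
  have S: "0 \<le> ?S" by simp
  have "(t\<^sup>2 / h ^ 3)\<^sup>2 \<le> \<delta>\<^sup>2" using h by (intro power_mono) (auto simp: \<delta>_def)
  then have \<delta>1: "t ^ 4 / h ^ 6 \<le> \<delta>\<^sup>2" by (simp add: power_divide flip: power_mult)
  have "(h\<^sup>2)\<^sup>2 \<le> \<delta>\<^sup>2" using h by (intro power_mono) (auto simp: \<delta>_def)
  then have \<delta>2: "h ^ 4 \<le> \<delta>\<^sup>2" by (simp flip: power_mult)
  have "grid_sq M (X dV) \<le> t\<^sup>2 / 2 * (36 * c\<^sup>2 * grid_sq M dV + \<kappa>\<^sup>2 * grid_sq M dV)"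
    unfolding X by (intro order_trans[OF grid_sq_half_step_op] mult_left_mono add_mono lap_b_square order.refl) auto
  also have "\<dots> \<le> t\<^sup>2 / 2 * (36 * c\<^sup>2 * ((real M)\<^sup>2 * (K * t)\<^sup>2) + \<kappa>\<^sup>2 * ((real M)\<^sup>2 * (K * t)\<^sup>2))"
    using dV by (intro mult_left_mono add_mono grid_sq_le_of_bound) auto
  also have "\<dots> = ?S * (t ^ 4 / h ^ 6 * (18 * \<epsilon> ^ 4 * h\<^sup>2 + \<kappa>\<^sup>2 / 2 * h ^ 6))"
    unfolding c_def using h by (simp add: divide_simps) (simp add: eval_nat_numeral algebra_simps)
  also have "\<dots> \<le> ?S * (\<delta>\<^sup>2 * (18 * \<epsilon> ^ 4 * (2 * pi)\<^sup>2 + \<kappa>\<^sup>2 / 2 * (2 * pi) ^ 6))"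
    using h \<delta>1 by (intro mult_left_mono mult_mono add_mono power_mono order.refl) auto
  finally have A: "grid_sq M (X dV) \<le> ?S * (\<delta>\<^sup>2 * (18 * \<epsilon> ^ 4 * (2 * pi)\<^sup>2 + \<kappa>\<^sup>2 / 2 * (2 * pi) ^ 6))" .
  have "grid_sq M (\<lambda>p. 2 / t * (Q p + X Q p)) \<le> (2 / t)\<^sup>2 * (2 * (grid_sq M Q + 19 * grid_sq M Q))"
    unfolding grid_sq_scale[of M "2 / t"] X using t \<kappa> c
    by (intro mult_left_mono order_trans[OF grid_sq_add] add_mono grid_sq_half_step_op_le order.refl) (auto simp: c_def h_def)
  also have "\<dots> = 160 / t\<^sup>2 * grid_sq M Q" by (simp add: power_divide)
  also have "\<dots> \<le> 160 / t\<^sup>2 * ((real M)\<^sup>2 * (K * t ^ 3)\<^sup>2)"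
    using Q by (intro mult_left_mono grid_sq_le_of_bound) auto
  also have "\<dots> = ?S * (t ^ 4 / h ^ 6 * (160 * h ^ 6))"
    using t h by (simp add: field_simps eval_nat_numeral)
  also have "\<dots> \<le> ?S * (\<delta>\<^sup>2 * (160 * (2 * pi) ^ 6))"
    using h \<delta>1 by (intro mult_left_mono mult_mono power_mono order.refl) auto
  finally have B: "grid_sq M (\<lambda>p. 2 / t * (Q p + X Q p)) \<le> ?S * (\<delta>\<^sup>2 * (160 * (2 * pi) ^ 6))" .
  have "grid_sq M \<rho> \<le> (real M)\<^sup>2 * (K * h\<^sup>2)\<^sup>2" using \<rho> unfolding h_def by (intro grid_sq_le_of_bound) auto
  also have "\<dots> = ?S * h ^ 4" by (simp add: power_mult_distrib flip: power_mult)
  also have "\<dots> \<le> ?S * \<delta>\<^sup>2" using \<delta>2 by (intro mult_left_mono) auto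
  finally have R: "grid_sq M \<rho> \<le> ?S * \<delta>\<^sup>2" .
  have "grid_sq M (\<lambda>p. X dV p + 2 / t * (Q p + X Q p) - \<rho> p)
     \<le> 2 * (2 * (grid_sq M (X dV) + grid_sq M (\<lambda>p. 2 / t * (Q p + X Q p))) + grid_sq M \<rho>)"
    by (intro order_trans[OF grid_sq_diff] mult_left_mono add_mono grid_sq_add) auto
  also have "\<dots> \<le> 2 * (2 * (?S * (\<delta>\<^sup>2 * (18 * \<epsilon> ^ 4 * (2 * pi)\<^sup>2 + \<kappa>\<^sup>2 / 2 * (2 * pi) ^ 6))
       + ?S * (\<delta>\<^sup>2 * (160 * (2 * pi) ^ 6))) + ?S * \<delta>\<^sup>2)"
    using A B R by simp
  also have "\<dots> = K\<^sup>2 * residual_const \<epsilon> \<kappa> * ((real M)\<^sup>2 * \<delta>\<^sup>2)"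
    by (simp add: residual_const_def algebra_simps)
  finally show ?thesis by (simp add: \<delta>_def h_def)
qed

text \<open>The intermediate comparison function \<open>W\<close> is \<open>U + (t/2) (1 + X) V\<close>, the second order expansion of
  \<open>U + (t/2) (1 - X)\<^sup>-\<^sup>1 V\<close>, where \<open>V\<close> approximates the time derivative. Inserted into the first half step it
  leaves \<open>- X\<^sup>2 V\<close>, apart from the error of the spatial discretization. By the symmetry of the method the second half step leaves the same term, plus the error
  \<open>Q\<close> of the trapezoidal rule and a term containing \<open>V' - V\<close>; those are small enough in the \<open>\<ell>\<^sup>2\<close> norm.\<close>

lemma comparison_residuals:
  fixes U U' V V' fU fU' :: "nat \<times> nat \<Rightarrow> real" and c \<kappa> t :: real and M :: nat
  assumes t: "t > 0"
  defines "X \<equiv> half_step_op c \<kappa> t M"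
  defines "W \<equiv> (\<lambda>p. U p + t / 2 * (V p + X V p))"
  defines "Q \<equiv> (\<lambda>p. U' p - U p - t / 2 * (V p + V' p))"
  shows "2 / t * (W p - U p) = lap_a c M U p + lap_b c M W p + fU p - \<kappa> * (W p - U p)
      - X (X V) p - (lap_a c M U p + lap_b c M U p + fU p - V p)"
    and "2 / t * (U' p - W p) = lap_a c M U' p + lap_b c M W p + fU' p + \<kappa> * (U' p - W p)
      - X (X V) p + (X (\<lambda>p. V' p - V p) p + 2 / t * (Q p + X Q p)
        - (lap_a c M U' p + lap_b c M U' p + fU' p - V' p))"
proof -
  let ?b = "lap_b c M"
  have XV: "X z p = t / 2 * (?b z p - \<kappa> * z p)" for z p by (simp add: X_def half_step_op_def)
  have bW: "?b W p = ?b U p + t / 2 * (?b V p + ?b (X V) p)" for p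
    unfolding W_def lap_b_add lap_b_scale ..
  have bQ: "?b Q p = ?b U' p - ?b U p - t / 2 * (?b V p + ?b V' p)" for p
    unfolding Q_def lap_b_diff lap_b_scale lap_b_add ..
  have bd: "?b (\<lambda>p. V' p - V p) p = ?b V' p - ?b V p" by (rule lap_b_diff)
  have bX: "?b (X V) p = 2 / t * X (X V) p + \<kappa> * X V p" using XV[of "X V" p] t by (simp add: field_simps)
  have bV: "?b V p = 2 / t * X V p + \<kappa> * V p" using XV[of V p] t by (simp add: field_simps)
  show "2 / t * (W p - U p) = lap_a c M U p + lap_b c M W p + fU p - \<kappa> * (W p - U p)
      - X (X V) p - (lap_a c M U p + lap_b c M U p + fU p - V p)"
    unfolding bW bX bV using t by (simp add: W_def field_simps)
  have XQ: "X Q p = t / 2 * (?b U' p - ?b U p - t / 2 * (?b V p + ?b V' p) - \<kappa> * Q p)"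
    unfolding XV[of Q] bQ ..
  have Xd: "X (\<lambda>p. V' p - V p) p = t / 2 * (?b V' p - \<kappa> * V' p) - X V p"
    unfolding XV bd by (simp add: algebra_simps)
  show "2 / t * (U' p - W p) = lap_a c M U' p + lap_b c M W p + fU' p + \<kappa> * (U' p - W p)
      - X (X V) p + (X (\<lambda>p. V' p - V p) p + 2 / t * (Q p + X Q p)
        - (lap_a c M U' p + lap_b c M U' p + fU' p - V' p))"
    unfolding bW bX XQ Xd bV using t by (simp add: W_def Q_def field_simps)
qed

text \<open>A common constant for the three sources of growth: the nonlinearity together with the stabilization, the
  \<open>\<ell>\<^sup>2\<close> residuals and the residual \<open>- X\<^sup>2 V\<close>.\<close>

definition growth_const :: "real \<Rightarrow> real \<Rightarrow> real \<Rightarrow> real" where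
  "growth_const \<epsilon> \<kappa> K = 3 * \<kappa> + K\<^sup>2 * (residual_const \<epsilon> \<kappa> + 1) + K\<^sup>2 * pairing_const \<epsilon> \<kappa>"

lemma pairing_const_nonneg: "\<kappa> > 0 \<Longrightarrow> 0 \<le> pairing_const \<epsilon> \<kappa>"
  unfolding pairing_const_def
  by (intro divide_nonneg_nonneg mult_nonneg_nonneg add_nonneg_nonneg) auto

lemma residual_const_nonneg: "0 \<le> residual_const \<epsilon> \<kappa>"
  unfolding residual_const_def by (intro add_nonneg_nonneg mult_nonneg_nonneg) auto

text \<open>The time derivative \<open>V\<close> must be Lipschitz in space, and so must its increments in time, because the
  Gronwall argument pairs both \<open>X\<^sup>2 V\<close> and its increments with the error.\<close>

lemma discrete_convergence:
  fixes U V u w :: "nat \<Rightarrow> nat \<times> nat \<Rightarrow> real" and \<epsilon> \<kappa> K t :: real and M m :: nat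
  assumes M: "M > 0" and \<epsilon>: "\<epsilon> > 0" and \<kappa>: "\<kappa> > 0"
    and t: "0 < t" "t * \<kappa> \<le> 1" "t * (\<epsilon>\<^sup>2 / (mesh M)\<^sup>2) \<le> 1" "(2 * growth_const \<epsilon> \<kappa> K + 1) * t \<le> 1 / 2"
  defines "c \<equiv> \<epsilon>\<^sup>2 / (mesh M)\<^sup>2"
  assumes scheme1: "\<And>n p. \<lbrakk>n < m; p \<in> grid M\<rbrakk> \<Longrightarrow>
      2 / t * (w n p - u n p) = lap_a c M (u n) p + lap_b c M (w n) p + f (u n p) - \<kappa> * (w n p - u n p)"
    and scheme2: "\<And>n p. \<lbrakk>n < m; p \<in> grid M\<rbrakk> \<Longrightarrow>
      2 / t * (u (Suc n) p - w n p) = lap_a c M (u (Suc n)) p + lap_b c M (w n) p + f (u (Suc n) p) + \<kappa> * (u (Suc n) p - w n p)"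
    and f: "\<And>n p. \<lbrakk>n \<le> m; p \<in> grid M\<rbrakk> \<Longrightarrow> \<bar>f (U n p) - f (u n p)\<bar> \<le> \<kappa> * \<bar>U n p - u n p\<bar>"
    and consistent: "\<And>n p. \<lbrakk>n \<le> m; p \<in> grid M\<rbrakk> \<Longrightarrow>
      \<bar>lap_a c M (U n) p + lap_b c M (U n) p + f (U n p) - V n p\<bar> \<le> K * (mesh M)\<^sup>2"
    and trapezoid: "\<And>n p. \<lbrakk>n < m; p \<in> grid M\<rbrakk> \<Longrightarrow>
      \<bar>U (Suc n) p - U n p - t / 2 * (V n p + V (Suc n) p)\<bar> \<le> K * t ^ 3"
    and V: "\<And>n p. \<lbrakk>n \<le> m; p \<in> grid M\<rbrakk> \<Longrightarrow> \<bar>V n p\<bar> \<le> K"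
    and Vx: "\<And>n i j. \<lbrakk>n \<le> m; i + 1 < M; j < M\<rbrakk> \<Longrightarrow> \<bar>V n (i + 1, j) - V n (i, j)\<bar> \<le> K * mesh M"
    and Vy: "\<And>n i j. \<lbrakk>n \<le> m; i < M; j + 1 < M\<rbrakk> \<Longrightarrow> \<bar>V n (i, j + 1) - V n (i, j)\<bar> \<le> K * mesh M"
    and dV: "\<And>n p. \<lbrakk>n < m; p \<in> grid M\<rbrakk> \<Longrightarrow> \<bar>V (Suc n) p - V n p\<bar> \<le> K * t"
    and dVx: "\<And>n i j. \<lbrakk>n < m; i + 1 < M; j < M\<rbrakk> \<Longrightarrow>
      \<bar>(V (Suc n) (i + 1, j) - V n (i + 1, j)) - (V (Suc n) (i, j) - V n (i, j))\<bar> \<le> K * t * mesh M"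
    and dVy: "\<And>n i j. \<lbrakk>n < m; i < M; j + 1 < M\<rbrakk> \<Longrightarrow>
      \<bar>(V (Suc n) (i, j + 1) - V n (i, j + 1)) - (V (Suc n) (i, j) - V n (i, j))\<bar> \<le> K * t * mesh M"
    and init: "\<And>p. p \<in> grid M \<Longrightarrow> u 0 p = U 0 p"
  defines "C \<equiv> growth_const \<epsilon> \<kappa> K"
  shows "energy c \<kappa> M (\<lambda>p. U m p - u m p)
    \<le> 2 * (exp (4 * (2 * C + 1) * (real m * t)) * (C + 1)
        * ((real M)\<^sup>2 * (t\<^sup>2 / mesh M ^ 3 + (mesh M)\<^sup>2)\<^sup>2))"
proof -
  define h where "h = mesh M"
  have h: "h > 0" using mesh_pos[OF M] by (simp add: h_def)
  have c: "c > 0" using \<epsilon> h by (simp add: c_def h_def)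
  define D where "D = (real M)\<^sup>2 * (t\<^sup>2 / h ^ 3 + h\<^sup>2)\<^sup>2"
  have D0: "D \<ge> 0" by (simp add: D_def)
  define X where "X = half_step_op c \<kappa> t M"
  define e where "e n = (\<lambda>p. U n p - u n p)" for n
  define W where "W n = (\<lambda>p. U n p + t / 2 * (V n p + X (V n) p))" for n
  define g where "g n = (\<lambda>p. W n p - w n p)" for n
  define Q where "Q n = (\<lambda>p. U (Suc n) p - U n p - t / 2 * (V n p + V (Suc n) p))" for n
  define \<rho> where "\<rho> n = (\<lambda>p. lap_a c M (U n) p + lap_b c M (U n) p + f (U n p) - V n p)" for n
  \<comment> \<open>the part of the residuals that both half steps share\<close>
  define P where "P n = (\<lambda>p. - X (X (V n)) p)" for n
  define r where "r n = (\<lambda>p. X (\<lambda>p. V (Suc n) p - V n p) p + 2 / t * (Q n p + X (Q n) p) - \<rho> (Suc n) p)" for n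
  define N where "N n = energy c \<kappa> M (e n)" for n
  note res = comparison_residuals[OF t(1), where c=c and \<kappa>=\<kappa> and M=M, folded X_def]
  have N: "N n \<ge> 0" "\<kappa>\<^sup>2 * grid_sq M (e n) \<le> \<kappa> * N n" for n
    using energy_bounds(2,3)[OF c \<kappa>, of M "e n"] \<kappa>
    by (auto simp: N_def field_simps power2_eq_square)
  have C: "0 \<le> C" "3 * \<kappa> \<le> C" "K\<^sup>2 * (residual_const \<epsilon> \<kappa> + 1) \<le> C" "K\<^sup>2 * pairing_const \<epsilon> \<kappa> \<le> C"
    "3 * \<kappa> + K\<^sup>2 * (residual_const \<epsilon> \<kappa> + 1) \<le> C"
    using pairing_const_nonneg[OF \<kappa>, of \<epsilon>] residual_const_nonneg[of \<epsilon> \<kappa>] \<kappa>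
    by (auto simp: C_def growth_const_def intro!: add_nonneg_nonneg mult_nonneg_nonneg)
  have r1: "grid_sq M (\<lambda>p. - \<rho> n p) \<le> K\<^sup>2 * D" if "n \<le> m" for n
  proof -
    have "grid_sq M (\<lambda>p. - \<rho> n p) = grid_sq M (\<rho> n)" by (simp add: grid_sq_def)
    also have "\<dots> \<le> (real M)\<^sup>2 * (K * h\<^sup>2)\<^sup>2"
      using consistent[OF that] by (intro grid_sq_le_of_bound) (auto simp: \<rho>_def h_def)
    also have "\<dots> = K\<^sup>2 * ((real M)\<^sup>2 * (h\<^sup>2)\<^sup>2)" by (simp add: power_mult_distrib)
    also have "\<dots> \<le> K\<^sup>2 * D" unfolding D_def using h by (intro mult_left_mono power_mono) auto
    finally show ?thesis .
  qed
  have r2: "grid_sq M (r n) \<le> K\<^sup>2 * residual_const \<epsilon> \<kappa> * D" if "n < m" for n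
    unfolding r_def D_def X_def c_def h_def
    using that t \<epsilon> \<kappa> M dV trapezoid consistent
    by (intro second_residual_bound) (auto simp: Q_def \<rho>_def c_def h_def)
  have pair: "(grid_dot M (X (X v)) z)\<^sup>2 \<le> k\<^sup>2 * (K\<^sup>2 * pairing_const \<epsilon> \<kappa> * D * energy c \<kappa> M z)"
    if v: "\<And>p. p \<in> grid M \<Longrightarrow> \<bar>v p\<bar> \<le> K * k"
      "\<And>i j. \<lbrakk>i + 1 < M; j < M\<rbrakk> \<Longrightarrow> \<bar>v (i + 1, j) - v (i, j)\<bar> \<le> K * k * mesh M"
      "\<And>i j. \<lbrakk>i < M; j + 1 < M\<rbrakk> \<Longrightarrow> \<bar>v (i, j + 1) - v (i, j)\<bar> \<le> K * k * mesh M" for v k z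
  proof -
    have "(grid_dot M (X (X v)) z)\<^sup>2 \<le> (K * k)\<^sup>2 * pairing_const \<epsilon> \<kappa>
        * ((real M)\<^sup>2 * (t\<^sup>2 / mesh M ^ 3)\<^sup>2) * energy c \<kappa> M z"
      unfolding X_def c_def using M \<epsilon> \<kappa> v by (intro half_step_op_squared_pairing) auto
    also have "\<dots> \<le> (K * k)\<^sup>2 * pairing_const \<epsilon> \<kappa> * D * energy c \<kappa> M z"
      unfolding D_def h_def[symmetric]
      using h pairing_const_nonneg[OF \<kappa>] energy_bounds(3)[OF c \<kappa>]
      by (intro mult_left_mono mult_right_mono power_mono) auto
    finally show ?thesis by (simp add: power_mult_distrib mult_ac)
  qed
  have "N m \<le> 2 * (exp (4 * (2 * C + 1) * (real m * t)) * (C + 1) * D)"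
  proof (rule discrete_Gronwall_pairing[where s = "\<lambda>n. grid_dot M (P n) (e n)" and x = "\<lambda>n. grid_dot M (P n) (e (Suc n))"])
    show "0 \<le> C" "0 \<le> D" "0 \<le> t" by fact+ (use t in simp)
    show "(2 * C + 1) * t \<le> 1 / 2" using t by (simp add: C_def)
    show "0 \<le> N n" for n by (rule N)
    show "N 0 = 0" using init by (simp add: N_def e_def energy_def grid_grad_sq_def grid_sq_def cyclic_diff_def grid_def)
  next
    fix n assume n: "n < m"
    have "\<kappa> * grid_sq M (e (Suc n)) - grid_dot M (lap_a c M (e (Suc n))) (e (Suc n)) - (\<kappa> * grid_sq M (e n) - grid_dot M (lap_a c M (e n)) (e n))
      \<le> t * (3 * \<kappa>\<^sup>2 * (grid_sq M (e n) + grid_sq M (e (Suc n))) + grid_sq M (\<lambda>p. - \<rho> n p) + grid_sq M (r n))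
        + grid_dot M (P n) (\<lambda>p. e (Suc n) p - e n p)"
    proof (rule energy_step[OF t(1,2) \<kappa>, where g = "g n" and F = "\<lambda>p. f (U n p) - f (u n p)"
          and F' = "\<lambda>p. f (U (Suc n) p) - f (u (Suc n) p)"])
      fix p assume p: "p \<in> grid M"
      have W1: "2 / t * (W n p - U n p) = lap_a c M (U n) p + lap_b c M (W n) p + f (U n p)
          - \<kappa> * (W n p - U n p) - X (X (V n)) p - \<rho> n p"
        unfolding W_def \<rho>_def by (rule res(1)[where fU = "\<lambda>p. f (U n p)"])
      have W2: "2 / t * (U (Suc n) p - W n p) = lap_a c M (U (Suc n)) p + lap_b c M (W n) p + f (U (Suc n) p)
          + \<kappa> * (U (Suc n) p - W n p) - X (X (V n)) p + r n p"
        unfolding W_def \<rho>_def r_def Q_def by (rule res(2)[where fU' = "\<lambda>p. f (U (Suc n) p)"])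
      show "2 / t * (g n p - e n p) = lap_a c M (e n) p + lap_b c M (g n) p + (f (U n p) - f (u n p))
          - \<kappa> * (g n p - e n p) + P n p + - \<rho> n p"
        using W1 scheme1[OF n p]
        by (simp add: e_def g_def P_def lap_a_diff lap_b_diff algebra_simps)
      show "2 / t * (e (Suc n) p - g n p) = lap_a c M (e (Suc n)) p + lap_b c M (g n) p
          + (f (U (Suc n) p) - f (u (Suc n) p)) + \<kappa> * (e (Suc n) p - g n p) + P n p + r n p"
        using W2 scheme2[OF n p]
        by (simp add: e_def g_def P_def lap_a_diff lap_b_diff algebra_simps)
      show "\<bar>f (U n p) - f (u n p)\<bar> \<le> \<kappa> * \<bar>e n p\<bar>"
        "\<bar>f (U (Suc n) p) - f (u (Suc n) p)\<bar> \<le> \<kappa> * \<bar>e (Suc n) p\<bar>"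
        using f[of n p] f[of "Suc n" p] n p by (auto simp: e_def)
    qed
    then have "N (Suc n) - N n \<le> t * (3 * \<kappa>\<^sup>2 * (grid_sq M (e n) + grid_sq M (e (Suc n))) + grid_sq M (\<lambda>p. - \<rho> n p) + grid_sq M (r n))
        + grid_dot M (P n) (e (Suc n)) - grid_dot M (P n) (e n)"
      by (simp add: N_def energy_eq_grid_dot grid_dot_def right_diff_distrib sum_subtractf)
    also have "t * (3 * \<kappa>\<^sup>2 * (grid_sq M (e n) + grid_sq M (e (Suc n))) + grid_sq M (\<lambda>p. - \<rho> n p) + grid_sq M (r n))
      \<le> t * (C * (N n + N (Suc n) + D))"
    proof (rule mult_left_mono)
      have "3 * \<kappa>\<^sup>2 * (grid_sq M (e n) + grid_sq M (e (Suc n))) \<le> 3 * \<kappa> * (N n + N (Suc n))"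
        using N(2)[of n] N(2)[of "Suc n"] by (simp add: algebra_simps)
      also have "\<dots> \<le> C * (N n + N (Suc n))" using C N by (intro mult_right_mono) auto
      finally have 1: "3 * \<kappa>\<^sup>2 * (grid_sq M (e n) + grid_sq M (e (Suc n))) \<le> C * (N n + N (Suc n))" .
      have "grid_sq M (\<lambda>p. - \<rho> n p) + grid_sq M (r n) \<le> K\<^sup>2 * (residual_const \<epsilon> \<kappa> + 1) * D"
        using r1[of n] r2[of n] n by (simp add: algebra_simps)
      also have "\<dots> \<le> C * D" using C D0 by (intro mult_right_mono) auto
      finally show "3 * \<kappa>\<^sup>2 * (grid_sq M (e n) + grid_sq M (e (Suc n))) + grid_sq M (\<lambda>p. - \<rho> n p) + grid_sq M (r n)
        \<le> C * (N n + N (Suc n) + D)"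
        using 1 by (simp add: algebra_simps)
    qed (use t in simp)
    finally show "N (Suc n) - N n \<le> C * t * (N n + N (Suc n) + D) + grid_dot M (P n) (e (Suc n)) - grid_dot M (P n) (e n)"
      by (simp add: mult_ac)
    have "grid_dot M (P (Suc n)) (e (Suc n)) - grid_dot M (P n) (e (Suc n))
       = - grid_dot M (X (X (\<lambda>p. V (Suc n) p - V n p))) (e (Suc n))"
    proof -
      have "X (\<lambda>p. V (Suc n) p - V n p) = (\<lambda>p. X (V (Suc n)) p - X (V n) p)"
        unfolding X_def by (rule ext) (rule half_step_op_diff)
      then show ?thesis
        unfolding grid_dot_def P_def sum_subtractf[symmetric] sum_negf[symmetric]
        by (intro sum.cong) (auto simp: X_def half_step_op_diff algebra_simps)
    qed
    then have "(grid_dot M (P (Suc n)) (e (Suc n)) - grid_dot M (P n) (e (Suc n)))\<^sup>2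
      \<le> t\<^sup>2 * (K\<^sup>2 * pairing_const \<epsilon> \<kappa> * D * N (Suc n))"
      using pair[of "\<lambda>p. V (Suc n) p - V n p" t "e (Suc n)"] dV[OF n] dVx[OF n] dVy[OF n]
      by (simp add: N_def)
    also have "\<dots> \<le> t\<^sup>2 * (C * D * N (Suc n))"
      using C D0 N by (intro mult_left_mono mult_right_mono) auto
    finally show "(grid_dot M (P (Suc n)) (e (Suc n)) - grid_dot M (P n) (e (Suc n)))\<^sup>2 \<le> t\<^sup>2 * (C * D * N (Suc n))" .
  next
    fix n assume n: "n \<le> m"
    have "grid_dot M (P n) (e n) = - grid_dot M (X (X (V n))) (e n)" by (simp add: grid_dot_def P_def sum_negf)
    then have "(grid_dot M (P n) (e n))\<^sup>2 \<le> K\<^sup>2 * pairing_const \<epsilon> \<kappa> * D * N n"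
      using pair[of "V n" 1 "e n"] V[OF n] Vx[OF n] Vy[OF n] by (simp add: N_def)
    also have "\<dots> \<le> C * D * N n" using C D0 N by (intro mult_right_mono) auto
    finally show "(grid_dot M (P n) (e n))\<^sup>2 \<le> C * D * N n" .
  qed
  then show ?thesis by (simp add: N_def e_def D_def h_def)
qed

section \<open>Entries of the matrix scheme\<close>

lemma Delta_a_entry:
  assumes v: "v \<in> carrier_mat M M" and ij: "i < M" "j < M"
  shows "Delta_a M v $$ (i, j) = lap_a (1 / (mesh M)\<^sup>2) M (\<lambda>(i, j). v $$ (i, j)) (i, j)"
proof -
  have row: "(\<Sum>k\<in>{0..<M}. (1 / (mesh M)\<^sup>2) * ((if i = k then - 1 else 0) + (if k = i + 1 then 1 else 0)
     + (if i = 0 \<and> k = M - 1 then 1 else 0)) * w k) = 1 / (mesh M)\<^sup>2 * diff_a M w i" if "i < M" for i and w :: "nat \<Rightarrow> real"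
  proof -
    have "(\<Sum>k\<in>{0..<M}. (1 / (mesh M)\<^sup>2) * ((if i = k then - 1 else 0) + (if k = i + 1 then 1 else 0)
       + (if i = 0 \<and> k = M - 1 then 1 else 0)) * w k)
      = 1 / (mesh M)\<^sup>2 * (\<Sum>k\<in>{0..<M}. (if k = i + 1 then w (i + 1) else 0)
         + (if k = M - 1 then (if i = 0 then w (M - 1) else 0) else 0) - (if k = i then w i else 0))"
      unfolding sum_distrib_left by (intro sum.cong) auto
    also have "\<dots> = 1 / (mesh M)\<^sup>2 * diff_a M w i"
      using that by (simp add: sum.distrib sum_subtractf diff_a_def)
    finally show ?thesis .
  qed
  have "Delta_a M v $$ (i, j) = (\<Sum>k\<in>{0..<M}. D_a M $$ (i, k) * v $$ (k, j)) + (\<Sum>k\<in>{0..<M}. v $$ (i, k) * D_a M $$ (j, k))"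
    using v ij by (simp add: Delta_a_def scalar_prod_def D_a_def)
  also have "(\<Sum>k\<in>{0..<M}. D_a M $$ (i, k) * v $$ (k, j)) = 1 / (mesh M)\<^sup>2 * diff_a M (\<lambda>k. v $$ (k, j)) i"
    unfolding row[OF ij(1), symmetric] using ij by (intro sum.cong) (auto simp: D_a_def)
  also have "(\<Sum>k\<in>{0..<M}. v $$ (i, k) * D_a M $$ (j, k)) = 1 / (mesh M)\<^sup>2 * diff_a M (\<lambda>k. v $$ (i, k)) j"
    unfolding row[OF ij(2), symmetric] using ij by (intro sum.cong) (auto simp: D_a_def)
  finally show ?thesis by (simp add: lap_a_def algebra_simps)
qed

lemma Delta_b_entry:
  assumes v: "v \<in> carrier_mat M M" and ij: "i < M" "j < M"
  shows "Delta_b M v $$ (i, j) = lap_b (1 / (mesh M)\<^sup>2) M (\<lambda>(i, j). v $$ (i, j)) (i, j)"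
proof -
  have col: "(\<Sum>k\<in>{0..<M}. (1 / (mesh M)\<^sup>2) * ((if k = i then - 1 else 0) + (if i = k + 1 then 1 else 0)
     + (if k = 0 \<and> i = M - 1 then 1 else 0)) * w k) = 1 / (mesh M)\<^sup>2 * diff_b M w i" if "i < M" for i and w :: "nat \<Rightarrow> real"
  proof -
    have "(\<Sum>k\<in>{0..<M}. (1 / (mesh M)\<^sup>2) * ((if k = i then - 1 else 0) + (if i = k + 1 then 1 else 0)
       + (if k = 0 \<and> i = M - 1 then 1 else 0)) * w k)
      = 1 / (mesh M)\<^sup>2 * (\<Sum>k\<in>{0..<M}. (if k = i - 1 then (if i = 0 then 0 else w (i - 1)) else 0)
         + (if k = 0 then (if i = M - 1 then w 0 else 0) else 0) - (if k = i then w i else 0))"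
      unfolding sum_distrib_left by (intro sum.cong) auto
    also have "\<dots> = 1 / (mesh M)\<^sup>2 * diff_b M w i"
      using that by (simp add: sum.distrib sum_subtractf diff_b_def)
    finally show ?thesis .
  qed
  have "Delta_b M v $$ (i, j) = (\<Sum>k\<in>{0..<M}. D_a M $$ (k, i) * v $$ (k, j)) + (\<Sum>k\<in>{0..<M}. v $$ (i, k) * D_a M $$ (k, j))"
    using v ij by (simp add: Delta_b_def D_b_def scalar_prod_def D_a_def)
  also have "(\<Sum>k\<in>{0..<M}. D_a M $$ (k, i) * v $$ (k, j)) = 1 / (mesh M)\<^sup>2 * diff_b M (\<lambda>k. v $$ (k, j)) i"
    unfolding col[OF ij(1), symmetric] using ij by (intro sum.cong) (auto simp: D_a_def)
  also have "(\<Sum>k\<in>{0..<M}. v $$ (i, k) * D_a M $$ (k, j)) = 1 / (mesh M)\<^sup>2 * diff_b M (\<lambda>k. v $$ (i, k)) j"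
    unfolding col[OF ij(2), symmetric] using ij by (intro sum.cong) (auto simp: D_a_def)
  finally show ?thesis by (simp add: lap_b_def algebra_simps)
qed

text \<open>In two dimensions the area weight cancels the \<open>1 / h\<^sup>2\<close> of the squared difference quotients, so the gradient part
  carries \<open>\<epsilon>\<^sup>2\<close> without a power of \<open>h\<close>, and \<open>\<epsilon>\<^sup>2 / h\<^sup>2\<close> once the area is factored out.\<close>

lemma kappa_norm_energy:
  assumes v: "v \<in> carrier_mat M M" and M: "M > 0"
  shows "kappa_norm M \<epsilon> \<kappa> v
    = mesh M * sqrt (energy (\<epsilon>\<^sup>2 / (mesh M)\<^sup>2) \<kappa> M (\<lambda>(i, j). v $$ (i, j)))"
proof -
  have h: "mesh M > 0" using mesh_pos[OF M] .
  let ?v = "\<lambda>(i, j). v $$ (i, j)"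
  have gn: "(grid_norm M w)\<^sup>2 = (mesh M)\<^sup>2 * (\<Sum>i<M. \<Sum>j<M. (w $$ (i, j))\<^sup>2)" for w
  proof -
    have "grid_inner M w w = (mesh M)\<^sup>2 * (\<Sum>i<M. \<Sum>j<M. (w $$ (i, j))\<^sup>2)"
      by (simp add: grid_inner_def power2_eq_square)
    then show ?thesis by (simp add: grid_norm_def sum_nonneg)
  qed
  have "(grid_norm M (grad_x M v))\<^sup>2 = (mesh M)\<^sup>2 * (\<Sum>i<M. \<Sum>j<M. (cyclic_diff M (\<lambda>k. v $$ (k, j)) i)\<^sup>2 / (mesh M)\<^sup>2)"
    unfolding gn by (simp add: grad_x_def cyclic_diff_def power_divide)
  also have "\<dots> = (\<Sum>j<M. \<Sum>i<M. (cyclic_diff M (\<lambda>k. v $$ (k, j)) i)\<^sup>2)"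
    using h by (subst sum.swap) (simp add: sum_divide_distrib[symmetric])
  finally have x: "(grid_norm M (grad_x M v))\<^sup>2 = (\<Sum>j<M. \<Sum>i<M. (cyclic_diff M (\<lambda>k. v $$ (k, j)) i)\<^sup>2)" .
  have "(grid_norm M (grad_y M v))\<^sup>2 = (mesh M)\<^sup>2 * (\<Sum>i<M. \<Sum>j<M. (cyclic_diff M (\<lambda>k. v $$ (i, k)) j)\<^sup>2 / (mesh M)\<^sup>2)"
    unfolding gn by (simp add: grad_y_def cyclic_diff_def power_divide)
  also have "\<dots> = (\<Sum>i<M. \<Sum>j<M. (cyclic_diff M (\<lambda>k. v $$ (i, k)) j)\<^sup>2)"
    using h by (simp add: sum_divide_distrib[symmetric])
  finally have y: "(grid_norm M (grad_y M v))\<^sup>2 = (\<Sum>i<M. \<Sum>j<M. (cyclic_diff M (\<lambda>k. v $$ (i, k)) j)\<^sup>2)" .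
  have G: "(grid_norm M (grad_x M v))\<^sup>2 + (grid_norm M (grad_y M v))\<^sup>2 = grid_grad_sq M ?v"
    unfolding x y by (simp add: grid_grad_sq_def)
  have "(grid_norm M v)\<^sup>2 = (mesh M)\<^sup>2 * grid_sq M ?v" unfolding gn by (simp add: grid_sq_def sum_grid)
  then have "kappa_norm M \<epsilon> \<kappa> v = sqrt ((mesh M)\<^sup>2 * energy (\<epsilon>\<^sup>2 / (mesh M)\<^sup>2) \<kappa> M ?v)"
    unfolding kappa_norm_def G using h by (simp add: energy_def field_simps)
  then show ?thesis using h by (simp add: real_sqrt_mult)
qed

lemma SS2_step_entries:
  assumes step: "SS2_step M \<epsilon> \<kappa> \<beta> f t u w u'" and u: "u \<in> carrier_mat M M" and p: "p \<in> grid M"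
  defines "c \<equiv> \<epsilon>\<^sup>2 / (mesh M)\<^sup>2" and "E \<equiv> (\<lambda>v (i, j). v $$ (i, j) :: real)"
  shows "2 / t * (E w p - E u p) = lap_a c M (E u) p + lap_b c M (E w) p + f (E u p) - \<kappa> * (E w p - E u p)"
    and "2 / t * (E u' p - E w p) = lap_a c M (E u') p + lap_b c M (E w) p + f (E u' p) + \<kappa> * (E u' p - E w p)"
proof -
  obtain i j where ij: "p = (i, j)" "i < M" "j < M" using p by (auto simp: grid_def)
  have w: "w \<in> carrier_mat M M" and u': "u' \<in> carrier_mat M M" using step by (auto simp: SS2_step_def)
  have cA: "\<epsilon>\<^sup>2 * lap_a (1 / (mesh M)\<^sup>2) M v q = lap_a c M v q" for v q
    by (cases q) (simp add: lap_a_def c_def)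
  have cB: "\<epsilon>\<^sup>2 * lap_b (1 / (mesh M)\<^sup>2) M v q = lap_b c M v q" for v q
    by (cases q) (simp add: lap_b_def c_def)
  have car: "Delta_a M v \<in> carrier_mat M M" "Delta_b M v \<in> carrier_mat M M" if "v \<in> carrier_mat M M" for v
    using that by (auto simp: Delta_a_def Delta_b_def D_a_def D_b_def)
  note cars = w u u' car[OF w] car[OF u] car[OF u']
  have dims: "dim_row w = M" "dim_col w = M" "dim_row u = M" "dim_col u = M" "dim_row u' = M" "dim_col u' = M"
    "dim_row (Delta_a M u) = M" "dim_col (Delta_a M u) = M" "dim_row (Delta_a M u') = M" "dim_col (Delta_a M u') = M"
    "dim_row (Delta_b M w) = M" "dim_col (Delta_b M w) = M"
    using cars by auto
  note ent = Delta_a_entry[OF u ij(2,3)] Delta_a_entry[OF u' ij(2,3)] Delta_b_entry[OF w ij(2,3)]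
  have "((1 / (t / 2)) \<cdot>\<^sub>m (w - u)) $$ (i, j)
       = (\<epsilon>\<^sup>2 \<cdot>\<^sub>m (Delta_a M u + Delta_b M w) + map_mat f u - \<kappa> \<cdot>\<^sub>m (w - u)) $$ (i, j)"
    using step by (simp add: SS2_step_def)
  then show "2 / t * (E w p - E u p) = lap_a c M (E u) p + lap_b c M (E w) p + f (E u p) - \<kappa> * (E w p - E u p)"
    using ij by (simp add: dims ent distrib_left cA cB E_def)
  have "((1 / (t / 2)) \<cdot>\<^sub>m (u' - w)) $$ (i, j)
       = (\<epsilon>\<^sup>2 \<cdot>\<^sub>m (Delta_a M u' + Delta_b M w) + map_mat f u' + \<kappa> \<cdot>\<^sub>m (u' - w)) $$ (i, j)"
    using step by (simp add: SS2_step_def)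
  then show "2 / t * (E u' p - E w p) = lap_a c M (E u') p + lap_b c M (E w) p + f (E u' p) + \<kappa> * (E u' p - E w p)"
    using ij by (simp add: dims ent distrib_left cA cB E_def)
qed

section \<open>Smooth periodic functions and their time dependence\<close>

abbreviation square :: "(real \<times> real) set" where
  "square \<equiv> {0..2 * pi} \<times> {0..2 * pi}"

abbreviation mixed :: "nat \<Rightarrow> nat \<Rightarrow> (real \<times> real \<Rightarrow> real) \<Rightarrow> real \<times> real \<Rightarrow> real" where
  "mixed a b g \<equiv> (dx ^^ a) ((dy ^^ b) g)"

lemma periodic2_int:
  assumes "periodic2 g"
  shows "g (x + of_int m * (2 * pi), y + of_int n * (2 * pi)) = g (x, y)"
proof -
  interpret X: periodic_fun_simple "\<lambda>x. g (x, y + of_int n * (2 * pi))" "2 * pi"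
    using assms by unfold_locales (simp add: periodic2_def)
  interpret Y: periodic_fun_simple "\<lambda>y. g (x, y)" "2 * pi"
    using assms by unfold_locales (simp add: periodic2_def)
  show ?thesis using X.plus_of_int[of x m] Y.plus_of_int[of y n] by simp
qed

text \<open>The representative of a point in the fundamental square. All periodic functions agree at a point and at
  its representative.\<close>

definition wrap :: "real \<times> real \<Rightarrow> real \<times> real" where
  "wrap = (\<lambda>(x, y). (x + of_int (- \<lfloor>x / (2 * pi)\<rfloor>) * (2 * pi), y + of_int (- \<lfloor>y / (2 * pi)\<rfloor>) * (2 * pi)))"

lemma wrap_mem: "wrap p \<in> square"
proof -
  have "0 \<le> x - of_int \<lfloor>x / (2 * pi)\<rfloor> * (2 * pi) \<and> x - of_int \<lfloor>x / (2 * pi)\<rfloor> * (2 * pi) \<le> 2 * pi" for x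
  proof -
    have "of_int \<lfloor>x / (2 * pi)\<rfloor> * (2 * pi) \<le> x"
      by (subst pos_le_divide_eq[symmetric]) auto
    moreover have "x \<le> (of_int \<lfloor>x / (2 * pi)\<rfloor> + 1) * (2 * pi)"
      by (subst pos_divide_le_eq[symmetric]) (auto intro: less_imp_le)
    ultimately show ?thesis by (simp add: distrib_right)
  qed
  then show ?thesis by (auto simp: wrap_def split: prod.split)
qed

lemma periodic2_wrap: "periodic2 g \<Longrightarrow> g (wrap p) = g p"
  by (cases p) (simp only: wrap_def prod.case periodic2_int)

lemma C_diff_continuous: "C_diff k g \<Longrightarrow> continuous_on UNIV g"
  by (cases k) auto

lemma dx_derivative:
  "C_diff (Suc k) g \<Longrightarrow> ((\<lambda>s. g (s, y)) has_real_derivative dx g (x, y)) (at x)"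
  using DERIV_deriv_iff_real_differentiable by (auto simp: dx_def)

lemma dy_derivative:
  "C_diff (Suc k) g \<Longrightarrow> ((\<lambda>s. g (x, s)) has_real_derivative dy g (x, y)) (at y)"
  using DERIV_deriv_iff_real_differentiable by (auto simp: dy_def)

lemma deriv_periodic:
  fixes h :: "real \<Rightarrow> real"
  assumes "\<And>x. h (x + c) = h x"
  shows "deriv h (x + c) = deriv h x"
  unfolding deriv_def DERIV_shift assms ..

lemma periodic2_dx: "periodic2 g \<Longrightarrow> periodic2 (dx g)"
  unfolding periodic2_def dx_def by (auto intro!: deriv_periodic)

lemma periodic2_dy: "periodic2 g \<Longrightarrow> periodic2 (dy g)"
  unfolding periodic2_def dy_def by (auto intro!: deriv_periodic)

lemma periodic2_mixed: "periodic2 g \<Longrightarrow> periodic2 (mixed a b g)"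
proof (induction a)
  case 0
  then show ?case by (induction b) (auto intro: periodic2_dy)
qed (auto intro: periodic2_dx)

lemma dx_lin:
  assumes "C_diff (Suc k) f" "C_diff (Suc k) g"
  shows "dx (\<lambda>p. \<alpha> * f p + \<gamma> * g p) = (\<lambda>p. \<alpha> * dx f p + \<gamma> * dx g p)"
  unfolding dx_def
  by (rule ext, clarsimp, rule DERIV_imp_deriv)
    (auto intro!: derivative_eq_intros dx_derivative[unfolded dx_def prod.case] assms)

lemma dy_lin:
  assumes "C_diff (Suc k) f" "C_diff (Suc k) g"
  shows "dy (\<lambda>p. \<alpha> * f p + \<gamma> * g p) = (\<lambda>p. \<alpha> * dy f p + \<gamma> * dy g p)"
  unfolding dy_def
  by (rule ext, clarsimp, rule DERIV_imp_deriv)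
    (auto intro!: derivative_eq_intros dy_derivative[unfolded dy_def prod.case] assms)

lemma C_diff_lin: "C_diff k f \<Longrightarrow> C_diff k g \<Longrightarrow> C_diff k (\<lambda>p. \<alpha> * f p + \<gamma> * g p)"
proof (induction k arbitrary: f g)
  case 0
  then show ?case by (auto intro!: continuous_intros)
next
  case (Suc k)
  have "(\<lambda>s. \<alpha> * f (s, y) + \<gamma> * g (s, y)) differentiable at x"
    "(\<lambda>s. \<alpha> * f (x, s) + \<gamma> * g (x, s)) differentiable at y" for x y
    using Suc.prems by (auto intro!: derivative_intros)
  then show ?case
    using Suc by (auto simp: dx_lin[OF Suc.prems] dy_lin[OF Suc.prems] intro!: continuous_intros)
qed

lemma C_diff_dy_pow: "C_diff k g \<Longrightarrow> b \<le> k \<Longrightarrow> C_diff (k - b) ((dy ^^ b) g)"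
proof (induction b)
  case (Suc b)
  then have "C_diff (Suc (k - Suc b)) ((dy ^^ b) g)" by (simp add: Suc_diff_Suc del: C_diff.simps)
  then show ?case by simp
qed simp

lemma C_diff_mixed: "C_diff k g \<Longrightarrow> a + b \<le> k \<Longrightarrow> C_diff (k - (a + b)) (mixed a b g)"
proof (induction a)
  case 0
  then show ?case by (simp add: C_diff_dy_pow)
next
  case (Suc a)
  then have "C_diff (Suc (k - (Suc a + b))) (mixed a b g)" by (simp add: Suc_diff_Suc del: C_diff.simps)
  then show ?case by simp
qed

lemma dy_pow_lin:
  assumes "C_diff k f" "C_diff k g" "b \<le> k"
  shows "(dy ^^ b) (\<lambda>p. \<alpha> * f p + \<gamma> * g p) = (\<lambda>p. \<alpha> * (dy ^^ b) f p + \<gamma> * (dy ^^ b) g p)"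
  using assms(3)
proof (induction b)
  case (Suc b)
  have "C_diff (Suc (k - Suc b)) ((dy ^^ b) f)" "C_diff (Suc (k - Suc b)) ((dy ^^ b) g)"
    using C_diff_dy_pow[OF assms(1), of b] C_diff_dy_pow[OF assms(2), of b] Suc.prems
    by (simp_all add: Suc_diff_Suc del: C_diff.simps)
  then show ?case using Suc dy_lin by simp
qed simp

lemma mixed_lin:
  assumes "C_diff k f" "C_diff k g" "a + b \<le> k"
  shows "mixed a b (\<lambda>p. \<alpha> * f p + \<gamma> * g p) = (\<lambda>p. \<alpha> * mixed a b f p + \<gamma> * mixed a b g p)"
  using assms(3)
proof (induction a)
  case 0
  then show ?case using dy_pow_lin[OF assms(1,2)] by simp
next
  case (Suc a)
  have "C_diff (Suc (k - (Suc a + b))) (mixed a b f)" "C_diff (Suc (k - (Suc a + b))) (mixed a b g)"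
    using C_diff_mixed[OF assms(1), of a b] C_diff_mixed[OF assms(2), of a b] Suc.prems
    by (simp_all add: Suc_diff_Suc del: C_diff.simps)
  then show ?case using Suc dx_lin by simp
qed

lemma abs_le_sup_norm:
  assumes "continuous_on UNIV g" "p \<in> square"
  shows "\<bar>g p\<bar> \<le> sup_norm g"
proof -
  have "compact ((\<lambda>p. \<bar>g p\<bar>) ` square)"
    by (intro compact_continuous_image compact_Times continuous_intros continuous_on_subset[OF assms(1)]) auto
  then show ?thesis
    unfolding sup_norm_def using assms(2) by (intro cSUP_upper bounded_imp_bdd_above compact_imp_bounded)
qed

lemma sup_norm_le_C_norm: "a + b \<le> k \<Longrightarrow> sup_norm (mixed a b g) \<le> C_norm k g"
proof -
  assume ab: "a + b \<le> k"
  have "finite {(a, b). a + b \<le> k}" by (rule finite_subset[of _ "{..k} \<times> {..k}"]) auto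
  then show ?thesis unfolding C_norm_def using ab by (intro Max_ge) (auto intro!: imageI)
qed

lemma mixed_le_C_norm:
  assumes "C_diff k g" "a + b \<le> k" "p \<in> square"
  shows "\<bar>mixed a b g p\<bar> \<le> C_norm k g"
  using abs_le_sup_norm[OF C_diff_continuous[OF C_diff_mixed[OF assms(1,2)]] assms(3)]
    sup_norm_le_C_norm[OF assms(2), of g] by linarith

text \<open>The change in time is controlled uniformly in space by \<open>c\<close>; periodicity carries this from the square to the
  plane.\<close>

lemma joint_continuity:
  fixes w :: "real \<Rightarrow> real \<times> real \<Rightarrow> real"
  assumes cont: "\<And>t. t \<in> {0..T} \<Longrightarrow> continuous_on UNIV (w t)"
    and per: "\<And>t. t \<in> {0..T} \<Longrightarrow> periodic2 (w t)"
    and unif: "\<And>t. t \<in> {0..T} \<Longrightarrow> (c t \<longlongrightarrow> 0) (at t within {0..T})"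
    and c: "\<And>s t p. \<lbrakk>t \<in> {0..T}; s \<in> {0..T}; p \<in> square\<rbrakk> \<Longrightarrow> \<bar>w s p - w t p\<bar> \<le> c t s"
  shows "continuous_on ({0..T} \<times> UNIV) (\<lambda>(t, p). w t p)"
  unfolding continuous_on_iff
proof (intro ballI allI impI)
  fix z e :: "_" assume z: "z \<in> {0..T} \<times> (UNIV :: (real \<times> real) set)" and e: "0 < (e::real)"
  obtain t p where zt: "z = (t, p)" "t \<in> {0..T}" using z by auto
  obtain d1 where d1: "d1 > 0" "\<And>s. \<lbrakk>s \<in> {0..T}; s \<noteq> t; dist s t < d1\<rbrakk> \<Longrightarrow> dist (c t s) 0 < e / 2"
    using unif[OF zt(2)] e unfolding tendsto_iff eventually_at by (metis half_gt_zero)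
  obtain d2 where d2: "d2 > 0" "\<And>q. dist q p < d2 \<Longrightarrow> dist (w t q) (w t p) < e / 2"
    using cont[OF zt(2)] e unfolding continuous_on_iff by (metis UNIV_I half_gt_zero)
  show "\<exists>d>0. \<forall>z'\<in>{0..T} \<times> UNIV. dist z' z < d \<longrightarrow> dist (case z' of (t, p) \<Rightarrow> w t p) (case z of (t, p) \<Rightarrow> w t p) < e"
  proof (intro exI[of _ "min d1 d2"] conjI ballI impI)
    fix z' assume z': "z' \<in> {0..T} \<times> (UNIV :: (real \<times> real) set)" "dist z' z < min d1 d2"
    obtain s q where z'_eq: "z' = (s, q)" "s \<in> {0..T}" using z' by auto
    have ds: "dist s t < d1" "dist q p < d2"
      using z'(2) dist_fst_le[of z' z] dist_snd_le[of z' z] by (auto simp: z'_eq zt)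
    have "dist (w s q) (w t q) < e / 2"
    proof (cases "s = t")
      case False
      have "\<bar>w s (wrap q) - w t (wrap q)\<bar> \<le> c t s" by (rule c[OF zt(2) z'_eq(2) wrap_mem])
      then show ?thesis using d1(2)[OF z'_eq(2) False ds(1)] per[OF zt(2)] per[OF z'_eq(2)]
        by (auto simp: dist_real_def periodic2_wrap)
    qed (use e in simp)
    then have "dist (w s q) (w t p) < e" using d2(2)[OF ds(2)] dist_triangle[of "w s q" "w t p" "w t q"] by linarith
    then show "dist (case z' of (t, p) \<Rightarrow> w t p) (case z of (t, p) \<Rightarrow> w t p) < e" by (simp add: z'_eq zt)
  qed (use d1 d2 in simp)
qed

text \<open>Convergence of difference quotients in the \<open>C\<^sup>k\<close> norm makes every mixed derivative jointly continuous; by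
  compactness and periodicity it is then bounded uniformly in time and space. The highest time derivative is
  covered by the continuity clause of the definition, the lower ones by their difference quotients.\<close>

lemma C_time_space_regularity:
  assumes "C_time_space m k T u"
  obtains v K where
    "\<And>t. t \<in> {0..T} \<Longrightarrow> v 0 t = u t"
    "\<And>j t. j \<le> m \<Longrightarrow> t \<in> {0..T} \<Longrightarrow> C_diff k (v j t)"
    "\<And>j t. j \<le> m \<Longrightarrow> t \<in> {0..T} \<Longrightarrow> periodic2 (v j t)"
    "\<And>j t p. j < m \<Longrightarrow> t \<in> {0..T} \<Longrightarrow> ((\<lambda>s. v j s p) has_real_derivative v (Suc j) t p) (at t within {0..T})"
    "\<And>j a b. j \<le> m \<Longrightarrow> a + b \<le> k \<Longrightarrow> continuous_on ({0..T} \<times> UNIV) (\<lambda>(t, p). mixed a b (v j t) p)"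
    "\<And>j a b t p. \<lbrakk>j \<le> m; a + b \<le> k; t \<in> {0..T}\<rbrakk> \<Longrightarrow> \<bar>mixed a b (v j t) p\<bar> \<le> K"
proof -
  from assms[unfolded C_time_space_def] obtain v where
    all: "(\<forall>t\<in>{0..T}. v 0 t = u t) \<and> (\<forall>j\<le>m. \<forall>t\<in>{0..T}. C_diff k (v j t) \<and> periodic2 (v j t)) \<and>
     (\<forall>j<m. \<forall>t\<in>{0..T}.
        ((\<lambda>s. C_norm k (\<lambda>p. (v j s p - v j t p) / (s - t) - v (Suc j) t p)) \<longlongrightarrow> 0) (at t within {0..T})) \<and>
     (\<forall>t\<in>{0..T}. ((\<lambda>s. C_norm k (\<lambda>p. v m s p - v m t p)) \<longlongrightarrow> 0) (at t within {0..T}))" ..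
  have v0: "\<And>t. t \<in> {0..T} \<Longrightarrow> v 0 t = u t" using all by simp
  have C: "\<And>j t. j \<le> m \<Longrightarrow> t \<in> {0..T} \<Longrightarrow> C_diff k (v j t)" using all by simp
  have per: "\<And>j t. j \<le> m \<Longrightarrow> t \<in> {0..T} \<Longrightarrow> periodic2 (v j t)" using all by simp
  have quot: "\<And>j t. j < m \<Longrightarrow> t \<in> {0..T} \<Longrightarrow>
      ((\<lambda>s. C_norm k (\<lambda>p. (v j s p - v j t p) / (s - t) - v (Suc j) t p)) \<longlongrightarrow> 0) (at t within {0..T})"
    using all by simp
  have last: "\<And>t. t \<in> {0..T} \<Longrightarrow> ((\<lambda>s. C_norm k (\<lambda>p. v m s p - v m t p)) \<longlongrightarrow> 0) (at t within {0..T})"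
    using all by simp
  define q where "q j t s = (\<lambda>p. 1 * (1 / (s - t) * v j s p + (- (1 / (s - t))) * v j t p) + (- 1) * v (Suc j) t p)" for j t s
  have q_eq: "(\<lambda>p. (v j s p - v j t p) / (s - t) - v (Suc j) t p) = q j t s" for j s t
    by (rule ext) (simp add: q_def diff_divide_distrib)
  have q_C: "C_diff k (q j t s)" if "j < m" "t \<in> {0..T}" "s \<in> {0..T}" for j s t
    unfolding q_def using that by (intro C_diff_lin C) auto
  have q_mixed: "mixed a b (q j t s) p = (mixed a b (v j s) p - mixed a b (v j t) p) / (s - t) - mixed a b (v (Suc j) t) p"
    if "j < m" "t \<in> {0..T}" "s \<in> {0..T}" "a + b \<le> k" for j s t a b p
  proof -
    have vs: "C_diff k (v j s)" "C_diff k (v j t)" "C_diff k (v (Suc j) t)" using that by (auto intro: C)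
    show ?thesis
      unfolding q_def mixed_lin[OF C_diff_lin[OF vs(1,2)] vs(3) that(4)] mixed_lin[OF vs(1,2) that(4)]
      by (simp add: diff_divide_distrib)
  qed
  have small: "\<bar>(mixed a b (v j s) p - mixed a b (v j t) p) / (s - t) - mixed a b (v (Suc j) t) p\<bar> \<le> C_norm k (q j t s)"
    if "j < m" "t \<in> {0..T}" "a + b \<le> k" "s \<in> {0..T}" "p \<in> square" for j s t a b p
    using mixed_le_C_norm[OF q_C[OF that(1,2,4)] that(3,5)] unfolding q_mixed[OF that(1,2,4,3)] .
  have der: "((\<lambda>s. v j s p) has_real_derivative v (Suc j) t p) (at t within {0..T})"
    if j: "j < m" "t \<in> {0..T}" for j t p
  proof -
    have "((\<lambda>s. (v j s p - v j t p) / (s - t) - v (Suc j) t p) \<longlongrightarrow> 0) (at t within {0..T})"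
    proof (rule Lim_null_comparison[OF _ quot[OF j, unfolded q_eq]])
      show "\<forall>\<^sub>F s in at t within {0..T}. norm ((v j s p - v j t p) / (s - t) - v (Suc j) t p) \<le> C_norm k (q j t s)"
        unfolding eventually_at_filter
      proof (rule always_eventually, intro allI impI)
        fix s assume s: "s \<in> {0..T}"
        have "v j s (wrap p) = v j s p" "v j t (wrap p) = v j t p" "v (Suc j) t (wrap p) = v (Suc j) t p"
          using j s per by (auto intro!: periodic2_wrap)
        then show "norm ((v j s p - v j t p) / (s - t) - v (Suc j) t p) \<le> C_norm k (q j t s)"
          using small[OF j, of 0 0 s "wrap p", OF _ s wrap_mem] by simp
      qed
    qed
    then show ?thesis unfolding has_field_derivative_iff by (rule LIM_zero_cancel)
  qed
  have joint: "continuous_on ({0..T} \<times> UNIV) (\<lambda>(t, p). mixed a b (v j t) p)" if j: "j \<le> m" and ab: "a + b \<le> k" for j a b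
  proof -
    have cont: "continuous_on UNIV (mixed a b (v i t))" if "i \<le> m" "t \<in> {0..T}" for i t
      using that by (intro C_diff_continuous[OF C_diff_mixed[OF C ab]])
    have pm: "periodic2 (mixed a b (v j t))" if "t \<in> {0..T}" for t
      using j that by (intro periodic2_mixed per)
    show ?thesis
    proof (cases "j = m")
      case True
      have eq: "(\<lambda>p. v m s p - v m t p) = (\<lambda>p. 1 * v m s p + (-1) * v m t p)" for s t by simp
      have "\<bar>mixed a b (v j s) p - mixed a b (v j t) p\<bar> \<le> C_norm k (\<lambda>p. v m s p - v m t p)"
        if "t \<in> {0..T}" "s \<in> {0..T}" "p \<in> square" for s t p
      proof -
        have vs: "C_diff k (v m s)" "C_diff k (v m t)" using that by (auto intro: C)
        have "mixed a b (\<lambda>p. v m s p - v m t p) p = mixed a b (v j s) p - mixed a b (v j t) p"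
          unfolding eq mixed_lin[OF vs ab] by (simp add: True)
        moreover have "C_diff k (\<lambda>p. v m s p - v m t p)"
          unfolding eq by (rule C_diff_lin[OF vs])
        ultimately show ?thesis using mixed_le_C_norm[OF _ ab that(3)] by metis
      qed
      then show ?thesis
        using j last by (intro joint_continuity[where w = "\<lambda>t. mixed a b (v j t)"
            and c = "\<lambda>t s. C_norm k (\<lambda>p. v m s p - v m t p)"] cont pm)
    next
      case False
      then have jm: "j < m" using j by simp
      define c where "c t s = \<bar>s - t\<bar> * (C_norm k (q j t s) + C_norm k (v (Suc j) t))" for t s
      have "(c t \<longlongrightarrow> \<bar>t - t\<bar> * (0 + C_norm k (v (Suc j) t))) (at t within {0..T})" if "t \<in> {0..T}" for t
        unfolding c_def using quot[OF jm that, unfolded q_eq] by (intro tendsto_intros)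
      moreover have "\<bar>mixed a b (v j s) p - mixed a b (v j t) p\<bar> \<le> c t s"
        if "t \<in> {0..T}" "s \<in> {0..T}" "p \<in> square" for s t p
      proof (cases "s = t")
        case False
        have "mixed a b (v j s) p - mixed a b (v j t) p = (s - t) * ((mixed a b (v j s) p - mixed a b (v j t) p) / (s - t)
            - mixed a b (v (Suc j) t) p + mixed a b (v (Suc j) t) p)"
          using False by simp
        also have "\<bar>\<dots>\<bar> \<le> c t s"
          unfolding c_def abs_mult
          using small[OF jm that(1) ab that(2) that(3)] mixed_le_C_norm[of k "v (Suc j) t" a b p] C[of "Suc j" t] jm ab that
          by (intro mult_left_mono order_trans[OF abs_triangle_ineq] add_mono) auto
        finally show ?thesis .
      qed (simp add: c_def)
      ultimately show ?thesis using j by (intro joint_continuity[where w = "\<lambda>t. mixed a b (v j t)" and c = c] cont pm) auto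
    qed
  qed
  have bound1: "\<exists>K. \<forall>t\<in>{0..T}. \<forall>p. \<bar>mixed a b (v j t) p\<bar> \<le> K" if j: "j \<le> m" and ab: "a + b \<le> k" for j a b
  proof -
    have "compact ((\<lambda>(t, p). mixed a b (v j t) p) ` ({0..T} \<times> square))"
      by (intro compact_continuous_image compact_Times continuous_on_subset[OF joint[OF j ab]]) auto
    then obtain K where K: "\<forall>x\<in>(\<lambda>(t, p). mixed a b (v j t) p) ` ({0..T} \<times> square). norm x \<le> K"
      using compact_imp_bounded bounded_iff by metis
    have "\<bar>mixed a b (v j t) p\<bar> \<le> K" if "t \<in> {0..T}" for t p
    proof -
      have "mixed a b (v j t) (wrap p) \<in> (\<lambda>(t, p). mixed a b (v j t) p) ` ({0..T} \<times> square)"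
        using that wrap_mem by (intro image_eqI[of _ _ "(t, wrap p)"]) auto
      then show ?thesis
        using K periodic2_wrap[OF periodic2_mixed[OF per[OF j that]], of a b p] by auto
    qed
    then show ?thesis by blast
  qed
  define A where "A = {(j, a, b). j \<le> m \<and> a + b \<le> k}"
  have "A \<subseteq> {..m} \<times> {..k} \<times> {..k}" by (auto simp: A_def)
  then have finA: "finite A" by (rule finite_subset) auto
  have "\<forall>x\<in>A. \<exists>K. case x of (j, a, b) \<Rightarrow> \<forall>t\<in>{0..T}. \<forall>p. \<bar>mixed a b (v j t) p\<bar> \<le> K"
    using bound1 by (auto simp: A_def)
  then obtain B where B: "\<forall>x\<in>A. case x of (j, a, b) \<Rightarrow> \<forall>t\<in>{0..T}. \<forall>p. \<bar>mixed a b (v j t) p\<bar> \<le> B x"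
    by (rule bchoice[THEN exE])
  have bound: "\<bar>mixed a b (v j t) p\<bar> \<le> Max (B ` A)" if "j \<le> m" "a + b \<le> k" "t \<in> {0..T}" for j a b t p
  proof -
    have mem: "(j, a, b) \<in> A" using that by (simp add: A_def)
    then have "\<bar>mixed a b (v j t) p\<bar> \<le> B (j, a, b)" using B that by fastforce
    also have "\<dots> \<le> Max (B ` A)" using mem finA by (intro Max_ge) auto
    finally show ?thesis .
  qed
  show ?thesis by (rule that[OF v0 C per der joint bound])
qed

section \<open>The maximum bound and the equation on the closed domain\<close>

lemma second_derivative_nonpos_at_max:
  fixes g g' :: "real \<Rightarrow> real"
  assumes g: "\<And>x. (g has_real_derivative g' x) (at x)" and g': "(g' has_real_derivative l) (at x0)"
    and max: "\<And>x. g x \<le> g x0"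
  shows "l \<le> 0"
proof (rule ccontr)
  assume "\<not> l \<le> 0"
  then have l: "l > 0" by simp
  have g0: "g' x0 = 0" using DERIV_local_max[OF g, of 1 x0] max by simp
  obtain d where d: "d > 0" "\<And>h. \<lbrakk>h > 0; h < d\<rbrakk> \<Longrightarrow> g' x0 < g' (x0 + h)"
    using DERIV_pos_inc_right[OF g' l] by blast
  obtain z where z: "x0 < z" "z < x0 + d / 2" "g (x0 + d / 2) - g x0 = (x0 + d / 2 - x0) * g' z"
    using MVT2[of x0 "x0 + d / 2" g g'] g d(1) by auto
  have "g' z > 0" using d(2)[of "z - x0"] z d(1) g0 by simp
  then have "(x0 + d / 2 - x0) * g' z > 0" using d(1) by simp
  then have "g (x0 + d / 2) - g x0 > 0" using z(3) by linarith
  then show False using max[of "x0 + d / 2"] by simp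
qed

lemma closure_open_square: "closure ({0<..<2 * pi} \<times> {0<..<2 * pi}) = square"
  by (simp add: closure_Times)

lemma joint_slice:
  fixes w :: "real \<Rightarrow> real \<times> real \<Rightarrow> real"
  assumes "continuous_on ({0..T} \<times> UNIV) (\<lambda>(t, p). w t p)" "t \<in> {0..T}"
  shows "continuous_on UNIV (w t)"
proof -
  have "continuous_on UNIV (\<lambda>p. (t, p) :: real \<times> real \<times> real)" by (intro continuous_intros)
  then have "continuous_on UNIV (\<lambda>p. (\<lambda>(t, p). w t p) (t, p))"
    by (rule continuous_on_compose2[OF assms(1)]) (use assms(2) in auto)
  then show ?thesis by simp
qed

text \<open>A maximum principle that uses the differential inequality only for values slightly above \<open>\<beta>\<close>, since
  nothing is known about the nonlinearity farther away. The barrier \<open>\<beta> + \<eta> exp (2 K t)\<close> stays in that range for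
  small \<open>\<eta>\<close>. At the first contact with it the contact point is a spatial maximum, so the right-hand side is at
  most \<open>K \<eta> exp (2 K t)\<close>, while the solution grows at least as fast as the barrier, with twice that rate.\<close>

lemma parabolic_upper_bound:
  fixes u ut ux uxx uy uyy :: "real \<Rightarrow> real \<times> real \<Rightarrow> real"
  assumes cont: "continuous_on ({0..T} \<times> UNIV) (\<lambda>(t, p). u t p)"
    and contF: "\<And>t. t \<in> {0..T} \<Longrightarrow> continuous_on UNIV (\<lambda>p. ut t p - \<epsilon>\<^sup>2 * (uxx t p + uyy t p))"
    and per: "\<And>t. t \<in> {0..T} \<Longrightarrow> periodic2 (u t)"
    and dt: "\<And>t p. t \<in> {0..T} \<Longrightarrow> ((\<lambda>s. u s p) has_real_derivative ut t p) (at t within {0..T})"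
    and dx1: "\<And>t x y. t \<in> {0..T} \<Longrightarrow> ((\<lambda>s. u t (s, y)) has_real_derivative ux t (x, y)) (at x)"
    and dx2: "\<And>t x y. t \<in> {0..T} \<Longrightarrow> ((\<lambda>s. ux t (s, y)) has_real_derivative uxx t (x, y)) (at x)"
    and dy1: "\<And>t x y. t \<in> {0..T} \<Longrightarrow> ((\<lambda>s. u t (x, s)) has_real_derivative uy t (x, y)) (at y)"
    and dy2: "\<And>t x y. t \<in> {0..T} \<Longrightarrow> ((\<lambda>s. uy t (x, s)) has_real_derivative uyy t (x, y)) (at y)"
    and ineq: "\<And>t p. \<lbrakk>t \<in> {0<..T}; p \<in> {0<..<2 * pi} \<times> {0<..<2 * pi}; \<beta> < u t p; u t p < \<beta> + \<delta>\<rbrakk>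
      \<Longrightarrow> ut t p \<le> \<epsilon>\<^sup>2 * (uxx t p + uyy t p) + K * (u t p - \<beta>)"
    and \<delta>: "\<delta> > 0" and K: "K > 0"
    and init: "\<And>p. p \<in> square \<Longrightarrow> u 0 p \<le> \<beta>"
    and t: "t \<in> {0..T}"
  shows "u t p \<le> \<beta>"
proof -
  let ?E = "\<lambda>s. exp (2 * K * s)"
  have key: "u s q < \<beta> + \<eta> * ?E s"
    if \<eta>: "\<eta> > 0" "\<eta> * ?E T < \<delta>" and s: "s \<in> {0..T}" and q: "q \<in> square" for \<eta> s q
  proof (rule ccontr)
    assume neg: "\<not> u s q < \<beta> + \<eta> * ?E s"
    define \<phi> where "\<phi> = (\<lambda>z. (case z of (t, p) \<Rightarrow> u t p) - \<beta> - \<eta> * ?E (fst z))"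
    define Z where "Z = ({0..T} \<times> square) \<inter> \<phi> -` {0..}"
    have cS: "compact ({0..T} \<times> square)" by (intro compact_Times) auto
    have contphi: "continuous_on ({0..T} \<times> UNIV) \<phi>"
      unfolding \<phi>_def by (intro continuous_intros cont)
    have "closed Z" unfolding Z_def
      by (intro continuous_closed_preimage compact_imp_closed[OF cS] continuous_on_subset[OF contphi]) auto
    moreover have "bounded Z" using compact_imp_bounded[OF cS] by (rule bounded_subset) (auto simp: Z_def)
    ultimately have cZ: "compact Z" by (simp add: compact_eq_bounded_closed)
    have "(s, q) \<in> Z" using neg s q by (simp add: Z_def \<phi>_def)
    then have "Z \<noteq> {}" by blast
    then obtain z where z: "z \<in> Z" "\<And>y. y \<in> Z \<Longrightarrow> fst z \<le> fst y"
      using continuous_attains_inf[OF cZ _ continuous_on_fst[OF continuous_on_id]] by auto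
    \<comment> \<open>the first time at which the barrier is touched\<close>
    obtain t0 p0 where zt: "z = (t0, p0)" by (cases z)
    have t0: "t0 \<in> {0..T}" and p0: "p0 \<in> square" and phi0: "\<phi> (t0, p0) \<ge> 0"
      using z(1) by (auto simp: Z_def zt)
    have before: "\<phi> (r, p) < 0" if "r \<in> {0..T}" "r < t0" "p \<in> square" for r p
      using z(2)[of "(r, p)"] that by (force simp: zt Z_def)
    have t0_pos: "t0 > 0"
    proof (rule ccontr)
      assume "\<not> t0 > 0"
      then have "t0 = 0" using t0 by simp
      then show False using phi0 init[OF p0] \<eta> by (simp add: \<phi>_def)
    qed
    have le0: "\<phi> (t0, p) \<le> 0" if p: "p \<in> square" for p
    proof -
      have "continuous_on {0..t0} (\<lambda>r. \<phi> (r, p))"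
        using t0 by (intro continuous_on_compose2[OF contphi] continuous_intros) auto
      then show ?thesis
        using continuous_le_on_closure[of "{0..<t0}" "\<lambda>r. \<phi> (r, p)" t0 0] before[OF _ _ p] t0 t0_pos
        by (auto simp: closure_atLeastLessThan intro: less_imp_le)
    qed
    have u0: "u t0 p0 = \<beta> + \<eta> * ?E t0" using le0[OF p0] phi0 by (simp add: \<phi>_def)
    have mx: "u t0 p \<le> u t0 p0" for p
      using le0[OF wrap_mem[of p]] u0 periodic2_wrap[OF per[OF t0]] by (simp add: \<phi>_def)
    obtain x0 y0 where xy: "p0 = (x0, y0)" by (cases p0)
    have xx: "uxx t0 p0 \<le> 0" unfolding xy
      by (rule second_derivative_nonpos_at_max[OF dx1[OF t0] dx2[OF t0]]) (use mx xy in simp)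
    have yy: "uyy t0 p0 \<le> 0" unfolding xy
      by (rule second_derivative_nonpos_at_max[OF dy1[OF t0] dy2[OF t0]]) (use mx xy in simp)
    have ut: "2 * K * (\<eta> * ?E t0) \<le> ut t0 p0"
    proof (rule ccontr)
      assume "\<not> 2 * K * (\<eta> * ?E t0) \<le> ut t0 p0"
      then have neg: "ut t0 p0 - \<eta> * (?E t0 * (2 * K)) < 0" by (simp add: mult_ac)
      have "((\<lambda>r. u r p0 - \<eta> * ?E r) has_real_derivative ut t0 p0 - \<eta> * (?E t0 * (2 * K))) (at t0 within {0..T})"
        by (auto intro!: derivative_eq_intros dt t0)
      from has_real_derivative_neg_dec_left[OF this neg] obtain d where d: "d > 0"
        "\<And>h. \<lbrakk>h > 0; t0 - h \<in> {0..T}; h < d\<rbrakk> \<Longrightarrow> u t0 p0 - \<eta> * ?E t0 < u (t0 - h) p0 - \<eta> * ?E (t0 - h)"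
        by blast
      define h where "h = min (d / 2) t0"
      have h: "h > 0" "t0 - h \<in> {0..T}" "h < d" using d(1) t0 t0_pos by (auto simp: h_def)
      show False using d(2)[OF h] before[of "t0 - h" p0] h p0 u0 by (simp add: \<phi>_def)
    qed
    \<comment> \<open>\<open>p0\<close> may lie on the boundary of the square, where the inequality holds only as a limit from inside\<close>
    define B where "B = {0<..<2 * pi} \<times> {0<..<2 * pi}"
    define V where "V = {p. \<beta> < u t0 p \<and> u t0 p < \<beta> + \<delta>}"
    have cu: "continuous_on UNIV (u t0)"
      by (rule joint_slice[OF cont t0])
    have "open V" unfolding V_def
      by (intro open_Collect_conj open_Collect_less continuous_intros cu)
    have "?E t0 \<le> ?E T" using t0 K by simp
    then have "\<eta> * ?E t0 \<le> \<eta> * ?E T" using \<eta> by (intro mult_left_mono) auto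
    then have "\<eta> * ?E t0 < \<delta>" by (rule le_less_trans[OF _ \<eta>(2)])
    moreover have "0 < \<eta> * ?E t0" using \<eta> by simp
    ultimately have "p0 \<in> V" using u0 by (simp add: V_def)
    moreover have "p0 \<in> closure B" using p0 unfolding B_def closure_open_square .
    ultimately have p0cl: "p0 \<in> closure (V \<inter> B)" using open_Int_closure_subset[OF \<open>open V\<close>] by blast
    have "ut t0 p0 - \<epsilon>\<^sup>2 * (uxx t0 p0 + uyy t0 p0) - K * (u t0 p0 - \<beta>) \<le> 0"
    proof (rule continuous_le_on_closure[OF _ p0cl])
      show "continuous_on (closure (V \<inter> B)) (\<lambda>p. ut t0 p - \<epsilon>\<^sup>2 * (uxx t0 p + uyy t0 p) - K * (u t0 p - \<beta>))"
        by (rule continuous_on_subset[OF _ subset_UNIV])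
          (intro continuous_on_diff contF[OF t0] continuous_on_mult continuous_on_const cu)
      show "ut t0 x - \<epsilon>\<^sup>2 * (uxx t0 x + uyy t0 x) - K * (u t0 x - \<beta>) \<le> 0" if "x \<in> V \<inter> B" for x
        using ineq[of t0 x] that t0 t0_pos by (simp add: V_def B_def)
    qed
    moreover have "\<epsilon>\<^sup>2 * (uxx t0 p0 + uyy t0 p0) \<le> 0" using xx yy by (intro mult_nonneg_nonpos) auto
    ultimately have "K * (\<eta> * ?E t0) \<le> 0" using ut u0 by simp
    moreover have "K * (\<eta> * ?E t0) > 0" using K \<eta> by simp
    ultimately show False by simp
  qed
  show ?thesis
  proof (rule ccontr)
    assume "\<not> u t p \<le> \<beta>"
    then have gt: "u t (wrap p) - \<beta> > 0" using periodic2_wrap[OF per[OF t]] by simp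
    define \<eta> where "\<eta> = min (u t (wrap p) - \<beta>) (\<delta> / 2) / ?E T"
    have "\<eta> > 0" using gt \<delta> by (simp add: \<eta>_def)
    moreover have "\<eta> * ?E T < \<delta>" using \<delta> by (simp add: \<eta>_def)
    ultimately have "u t (wrap p) < \<beta> + \<eta> * ?E t" using t wrap_mem by (intro key)
    moreover have "\<eta> * ?E t \<le> \<eta> * ?E T" using t K \<open>\<eta> > 0\<close> by (intro mult_left_mono) auto
    moreover have "\<eta> * ?E T \<le> u t (wrap p) - \<beta>" by (simp add: \<eta>_def)
    ultimately show False by simp
  qed
qed

text \<open>Differentiability at a zero bounds the function linearly near it, even where it is not differentiable.\<close>

lemma Lipschitz_at_zero:
  fixes f :: "real \<Rightarrow> real"
  assumes "(f has_real_derivative l) (at x within I)" "f x = 0"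
  obtains \<delta> where "\<delta> > 0" "\<And>y. \<lbrakk>y \<in> I; \<bar>y - x\<bar> < \<delta>\<rbrakk> \<Longrightarrow> \<bar>f y\<bar> \<le> (\<bar>l\<bar> + 1) * \<bar>y - x\<bar>"
proof -
  have "((\<lambda>y. (f y - f x) / (y - x)) \<longlongrightarrow> l) (at x within I)"
    using assms(1) by (simp add: has_field_derivative_iff)
  then have "\<forall>\<^sub>F y in at x within I. dist ((f y - f x) / (y - x)) l < 1"
    by (rule tendstoD) simp
  then obtain \<delta> where \<delta>: "\<delta> > 0"
    "\<And>y. \<lbrakk>y \<in> I; y \<noteq> x; dist y x < \<delta>\<rbrakk> \<Longrightarrow> dist ((f y - f x) / (y - x)) l < 1"
    unfolding eventually_at by auto
  have "\<bar>f y\<bar> \<le> (\<bar>l\<bar> + 1) * \<bar>y - x\<bar>" if "y \<in> I" "\<bar>y - x\<bar> < \<delta>" for y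
  proof (cases "y = x")
    case False
    define q where "q = f y / (y - x)"
    have "\<bar>q - l\<bar> < 1"
      using \<delta>(2)[of y] that False assms(2) by (simp add: dist_real_def q_def)
    then have "\<bar>q\<bar> * \<bar>y - x\<bar> \<le> (\<bar>l\<bar> + 1) * \<bar>y - x\<bar>" by (intro mult_right_mono) auto
    moreover have "\<bar>q\<bar> * \<bar>y - x\<bar> = \<bar>f y\<bar>" using False by (simp add: q_def)
    ultimately show ?thesis by simp
  qed (simp add: assms)
  then show ?thesis using \<delta>(1) that by blast
qed

lemma laplacian_mixed: "laplacian g p = mixed 2 0 g p + mixed 0 2 g p"
  by (simp add: laplacian_def numeral_2_eq_2)

text \<open>By oddness of the nonlinearity \<open>-u\<close> solves the same equation, so the maximum principle is applied to both
  signs. Near \<open>\<beta>\<close> the nonlinearity is bounded by a multiple of \<open>\<xi> - \<beta>\<close> because \<open>f \<beta> = 0\<close>.\<close>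

lemma allen_cahn_upper_bound:
  fixes v :: "nat \<Rightarrow> real \<Rightarrow> real \<times> real \<Rightarrow> real" and f :: "real \<Rightarrow> real"
  assumes C: "\<And>t. t \<in> {0..T} \<Longrightarrow> C_diff 4 (v 0 t)"
    and per: "\<And>t. t \<in> {0..T} \<Longrightarrow> periodic2 (v 0 t)"
    and dt: "\<And>t p. t \<in> {0..T} \<Longrightarrow> ((\<lambda>s. v 0 s p) has_real_derivative v 1 t p) (at t within {0..T})"
    and joint: "\<And>j a b. \<lbrakk>j \<le> 1; a + b \<le> 4\<rbrakk> \<Longrightarrow> continuous_on ({0..T} \<times> UNIV) (\<lambda>(t, p). mixed a b (v j t) p)"
    and pde: "\<And>t p. \<lbrakk>t \<in> {0<..T}; p \<in> {0<..<2 * pi} \<times> {0<..<2 * pi}\<rbrakk> \<Longrightarrow>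
      v 0 t p \<in> I \<and> v 1 t p = \<epsilon>\<^sup>2 * (mixed 2 0 (v 0 t) p + mixed 0 2 (v 0 t) p) + f (v 0 t p)"
    and f: "(f has_real_derivative l) (at \<beta> within I)" "f \<beta> = 0"
    and odd: "\<And>\<xi>. \<xi> \<in> I \<Longrightarrow> -\<xi> \<in> I \<and> f (-\<xi>) = - f \<xi>"
    and init: "\<And>p. p \<in> square \<Longrightarrow> \<bar>v 0 0 p\<bar> \<le> \<beta>"
    and t: "t \<in> {0..T}"
  shows "\<bar>v 0 t p\<bar> \<le> \<beta>"
proof -
  obtain \<delta> where \<delta>: "\<delta> > 0" "\<And>y. \<lbrakk>y \<in> I; \<bar>y - \<beta>\<bar> < \<delta>\<rbrakk> \<Longrightarrow> \<bar>f y\<bar> \<le> (\<bar>l\<bar> + 1) * \<bar>y - \<beta>\<bar>"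
    using Lipschitz_at_zero[OF f] by metis
  have "4 = Suc 3" "3 = Suc 2" by auto
  then have C3: "C_diff (Suc 3) (v 0 s)" if "s \<in> {0..T}" for s using C[OF that] by metis
  have Cx: "C_diff (Suc 2) (dx (v 0 s))" "C_diff (Suc 2) (dy (v 0 s))" if "s \<in> {0..T}" for s
    using C3[OF that] \<open>3 = Suc 2\<close> by (metis C_diff.simps(2))+
  have c0: "continuous_on ({0..T} \<times> UNIV) (\<lambda>(t, p). v 0 t p)" using joint[of 0 0 0] by simp
  have cs: "continuous_on UNIV (\<lambda>p. v 1 s p)" "continuous_on UNIV (\<lambda>p. mixed 2 0 (v 0 s) p)"
    "continuous_on UNIV (\<lambda>p. mixed 0 2 (v 0 s) p)" if "s \<in> {0..T}" for s
    using joint_slice[OF joint[of 1 0 0] that] joint_slice[OF joint[of 0 2 0] that] joint_slice[OF joint[of 0 0 2] that]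
    by auto
  have up: "\<sigma> * v 0 t p \<le> \<beta>" if \<sigma>: "\<sigma> = 1 \<or> \<sigma> = -1" for \<sigma>
  proof (rule parabolic_upper_bound[where u = "\<lambda>t p. \<sigma> * v 0 t p" and ut = "\<lambda>t p. \<sigma> * v 1 t p"
        and ux = "\<lambda>t p. \<sigma> * dx (v 0 t) p" and uxx = "\<lambda>t p. \<sigma> * mixed 2 0 (v 0 t) p"
        and uy = "\<lambda>t p. \<sigma> * dy (v 0 t) p" and uyy = "\<lambda>t p. \<sigma> * mixed 0 2 (v 0 t) p"
        and \<epsilon> = \<epsilon> and K = "\<bar>l\<bar> + 1" and T = T])
    have "continuous_on ({0..T} \<times> UNIV) (\<lambda>z. \<sigma> * (case z of (t, p) \<Rightarrow> v 0 t p))"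
      by (intro continuous_intros c0)
    then show "continuous_on ({0..T} \<times> UNIV) (\<lambda>(t, p). \<sigma> * v 0 t p)" by (simp add: case_prod_unfold)
    show "continuous_on UNIV (\<lambda>p. \<sigma> * v 1 s p - \<epsilon>\<^sup>2 * (\<sigma> * mixed 2 0 (v 0 s) p + \<sigma> * mixed 0 2 (v 0 s) p))"
      if "s \<in> {0..T}" for s
      by (intro continuous_on_diff continuous_on_mult continuous_on_add continuous_on_const cs[OF that])
    show "periodic2 (\<lambda>p. \<sigma> * v 0 s p)" if "s \<in> {0..T}" for s
      using per[OF that] by (simp add: periodic2_def)
    show "((\<lambda>s. \<sigma> * v 0 s p) has_real_derivative \<sigma> * v 1 s p) (at s within {0..T})" if "s \<in> {0..T}" for s p
      by (intro DERIV_cmult dt that)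
    show "((\<lambda>s. \<sigma> * v 0 r (s, y)) has_real_derivative \<sigma> * dx (v 0 r) (x, y)) (at x)" if "r \<in> {0..T}" for r x y
      by (intro DERIV_cmult dx_derivative[OF C3[OF that]])
    show "((\<lambda>s. \<sigma> * dx (v 0 r) (s, y)) has_real_derivative \<sigma> * mixed 2 0 (v 0 r) (x, y)) (at x)" if "r \<in> {0..T}" for r x y
      using dx_derivative[OF Cx(1)[OF that], of y x] by (intro DERIV_cmult) (simp add: numeral_2_eq_2)
    show "((\<lambda>s. \<sigma> * v 0 r (x, s)) has_real_derivative \<sigma> * dy (v 0 r) (x, y)) (at y)" if "r \<in> {0..T}" for r x y
      by (intro DERIV_cmult dy_derivative[OF C3[OF that]])
    show "((\<lambda>s. \<sigma> * dy (v 0 r) (x, s)) has_real_derivative \<sigma> * mixed 0 2 (v 0 r) (x, y)) (at y)" if "r \<in> {0..T}" for r x y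
      using dy_derivative[OF Cx(2)[OF that], of x y] by (intro DERIV_cmult) (simp add: numeral_2_eq_2)
    show "\<sigma> * v 1 s q \<le> \<epsilon>\<^sup>2 * (\<sigma> * mixed 2 0 (v 0 s) q + \<sigma> * mixed 0 2 (v 0 s) q) + (\<bar>l\<bar> + 1) * (\<sigma> * v 0 s q - \<beta>)"
      if s: "s \<in> {0<..T}" and q: "q \<in> {0<..<2 * pi} \<times> {0<..<2 * pi}" and b: "\<beta> < \<sigma> * v 0 s q" "\<sigma> * v 0 s q < \<beta> + \<delta>" for s q
    proof -
      note P = pde[OF s q]
      have "\<sigma> * v 0 s q \<in> I" "\<sigma> * f (v 0 s q) = f (\<sigma> * v 0 s q)"
        using P odd[of "v 0 s q"] \<sigma> by auto
      moreover have "\<bar>f (\<sigma> * v 0 s q)\<bar> \<le> (\<bar>l\<bar> + 1) * \<bar>\<sigma> * v 0 s q - \<beta>\<bar>"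
        using b by (intro \<delta>(2) calculation) auto
      ultimately have "\<sigma> * f (v 0 s q) \<le> (\<bar>l\<bar> + 1) * (\<sigma> * v 0 s q - \<beta>)" using b by simp
      moreover have "\<sigma> * v 1 s q = \<epsilon>\<^sup>2 * (\<sigma> * mixed 2 0 (v 0 s) q + \<sigma> * mixed 0 2 (v 0 s) q) + \<sigma> * f (v 0 s q)"
        using P by (simp add: algebra_simps)
      ultimately show ?thesis by linarith
    qed
    show "\<sigma> * v 0 0 q \<le> \<beta>" if "q \<in> square" for q using init[OF that] \<sigma> by auto
  qed (use \<delta> t in auto)
  show ?thesis using up[of 1] up[of "-1"] by simp
qed

text \<open>Once the values are known to lie in \<open>[-\<beta>, \<beta>]\<close>, where \<open>f\<close> is continuous, the equation extends by continuity to
  the boundary of the square and to \<open>t = 0\<close>, where the scheme has grid points.\<close>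

lemma allen_cahn_closed_domain:
  fixes v :: "nat \<Rightarrow> real \<Rightarrow> real \<times> real \<Rightarrow> real" and f :: "real \<Rightarrow> real"
  assumes T: "T > 0"
    and joint: "\<And>j a b. \<lbrakk>j \<le> 1; a + b \<le> 4\<rbrakk> \<Longrightarrow> continuous_on ({0..T} \<times> UNIV) (\<lambda>(t, p). mixed a b (v j t) p)"
    and pde: "\<And>t p. \<lbrakk>t \<in> {0<..T}; p \<in> {0<..<2 * pi} \<times> {0<..<2 * pi}\<rbrakk> \<Longrightarrow>
      v 1 t p = \<epsilon>\<^sup>2 * (mixed 2 0 (v 0 t) p + mixed 0 2 (v 0 t) p) + f (v 0 t p)"
    and f: "continuous_on {-\<beta>..\<beta>} f"
    and bound: "\<And>t p. t \<in> {0..T} \<Longrightarrow> \<bar>v 0 t p\<bar> \<le> \<beta>"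
    and t: "t \<in> {0..T}" and p: "p \<in> square"
  shows "v 1 t p = \<epsilon>\<^sup>2 * (mixed 2 0 (v 0 t) p + mixed 0 2 (v 0 t) p) + f (v 0 t p)"
proof -
  define E where "E = (\<lambda>z. (case z of (t, p) \<Rightarrow> v 1 t p) - \<epsilon>\<^sup>2 * ((case z of (t, p) \<Rightarrow> mixed 2 0 (v 0 t) p)
    + (case z of (t, p) \<Rightarrow> mixed 0 2 (v 0 t) p)) - f (case z of (t, p) \<Rightarrow> v 0 t p))"
  have c: "continuous_on ({0..T} \<times> UNIV) (\<lambda>(t, p). v 1 t p)" "continuous_on ({0..T} \<times> UNIV) (\<lambda>(t, p). v 0 t p)"
    using joint[of 1 0 0] joint[of 0 0 0] by auto
  have c2: "continuous_on ({0..T} \<times> UNIV) (\<lambda>(t, p). mixed 2 0 (v 0 t) p)"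
    "continuous_on ({0..T} \<times> UNIV) (\<lambda>(t, p). mixed 0 2 (v 0 t) p)"
    by (rule joint; simp)+
  have "(\<lambda>(t, p). v 0 t p) ` ({0..T} \<times> UNIV) \<subseteq> {-\<beta>..\<beta>}"
  proof (clarify, simp only: atLeastAtMost_iff)
    fix s q assume "0 \<le> s \<and> s \<le> T"
    then show "- \<beta> \<le> v 0 s q \<and> v 0 s q \<le> \<beta>" using bound[of s q] by auto
  qed
  then have cf: "continuous_on ({0..T} \<times> UNIV) (\<lambda>z. f (case z of (t, p) \<Rightarrow> v 0 t p))"
    by (rule continuous_on_compose2[OF f c(2)])
  have "continuous_on ({0..T} \<times> UNIV) E" unfolding E_def
    by (intro continuous_on_diff continuous_on_mult continuous_on_add continuous_on_const c(1) c2 cf)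
  then have cE: "continuous_on (closure ({0<..T} \<times> {0<..<2 * pi} \<times> {0<..<2 * pi})) E"
    unfolding closure_Times[of "{0<..T}"] closure_open_square using T by (auto elim: continuous_on_subset)
  have "E (t, p) = 0"
  proof (rule continuous_constant_on_closure[OF cE])
    show "E z = 0" if "z \<in> {0<..T} \<times> {0<..<2 * pi} \<times> {0<..<2 * pi}" for z
      using that pde by (auto simp: E_def)
    show "(t, p) \<in> closure ({0<..T} \<times> {0<..<2 * pi} \<times> {0<..<2 * pi})"
      unfolding closure_Times[of "{0<..T}"] closure_open_square using T t p by auto
  qed
  then show ?thesis by (simp add: E_def)
qed

section \<open>Taylor estimates in time and space\<close>

lemma mean_value_bound:
  fixes g g' :: "real \<Rightarrow> real"
  assumes der: "\<And>r. r \<in> {a..b} \<Longrightarrow> (g has_real_derivative g' r) (at r within S)"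
    and S: "{a..b} \<subseteq> S" and B: "\<And>r. r \<in> {a..b} \<Longrightarrow> \<bar>g' r\<bar> \<le> B"
    and xy: "x \<in> {a..b}" "y \<in> {a..b}"
  shows "\<bar>g x - g y\<bar> \<le> B * \<bar>x - y\<bar>"
proof -
  have "(g has_real_derivative g' r) (at r within {a..b})" if "r \<in> {a..b}" for r
    using der[OF that] S by (rule DERIV_subset)
  then have "norm (g x - g y) \<le> B * norm (x - y)"
    using B xy by (intro field_differentiable_bound[where S = "{a..b}" and f' = g']) auto
  then show ?thesis by simp
qed

text \<open>The derivative of the error with respect to the end
  point is \<open>(g1 r - g1 s - (r - s) g2 r) / 2\<close>, a first order Taylor remainder.\<close>

lemma trapezoid_error:
  fixes g g1 g2 g3 :: "real \<Rightarrow> real"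
  assumes s: "0 \<le> s" "0 \<le> t" "s + t \<le> T"
    and g: "\<And>r. r \<in> {0..T} \<Longrightarrow> (g has_real_derivative g1 r) (at r within {0..T})"
    and g1: "\<And>r. r \<in> {0..T} \<Longrightarrow> (g1 has_real_derivative g2 r) (at r within {0..T})"
    and g2: "\<And>r. r \<in> {0..T} \<Longrightarrow> (g2 has_real_derivative g3 r) (at r within {0..T})"
    and K: "\<And>r. r \<in> {0..T} \<Longrightarrow> \<bar>g3 r\<bar> \<le> K"
  shows "\<bar>g (s + t) - g s - t / 2 * (g1 s + g1 (s + t))\<bar> \<le> K * t ^ 3"
proof -
  have K0: "K \<ge> 0" using K[of 0] s by fastforce
  define \<phi> where "\<phi> r = g r - (r - s) / 2 * (g1 s + g1 r)" for r
  define \<phi>' where "\<phi>' r = (g1 r - g1 s - (r - s) * g2 r) / 2" for r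
  have sub: "{s..s + t} \<subseteq> {0..T}" using s by auto
  have d: "(\<phi> has_real_derivative \<phi>' r) (at r within {0..T})" if "r \<in> {s..s + t}" for r
    unfolding \<phi>_def \<phi>'_def using that sub
    by (auto intro!: derivative_eq_intros g g1 simp: field_simps)
  have b: "\<bar>\<phi>' r\<bar> \<le> K * t\<^sup>2" if r: "r \<in> {s..s + t}" for r
  proof -
    have "\<bar>(g1 r - r * g2 r) - (g1 s - s * g2 r)\<bar> \<le> (K * t) * \<bar>r - s\<bar>"
    proof (rule mean_value_bound[where a = s and b = r and S = "{0..T}" and g' = "\<lambda>z. g2 z - g2 r" and g = "\<lambda>z. g1 z - z * g2 r"])
      show "((\<lambda>z. g1 z - z * g2 r) has_real_derivative g2 z - g2 r) (at z within {0..T})" if "z \<in> {s..r}" for z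
        using that r s by (auto intro!: derivative_eq_intros g1)
      show "\<bar>g2 z - g2 r\<bar> \<le> K * t" if z: "z \<in> {s..r}" for z
      proof -
        have "\<bar>g2 z - g2 r\<bar> \<le> K * \<bar>z - r\<bar>"
          by (rule mean_value_bound[where a = s and b = r and S = "{0..T}" and g' = g3]) (use z r s g2 K in auto)
        also have "\<dots> \<le> K * t" using z r K0 by (intro mult_left_mono) auto
        finally show ?thesis .
      qed
    qed (use r s in auto)
    also have "\<dots> \<le> (K * t) * t" using r s K0 by (intro mult_left_mono) auto
    finally have "\<bar>2 * \<phi>' r\<bar> \<le> K * t\<^sup>2"
      by (simp add: \<phi>'_def power2_eq_square algebra_simps)
    moreover have "0 \<le> K * t\<^sup>2" using K0 by simp
    ultimately show ?thesis by (simp add: abs_mult)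
  qed
  have "\<bar>\<phi> (s + t) - \<phi> s\<bar> \<le> (K * t\<^sup>2) * \<bar>s + t - s\<bar>"
    by (rule mean_value_bound[OF d sub b]) (use s in auto)
  also have "\<dots> = K * t ^ 3" using s by (simp add: power2_eq_square power3_eq_cube)
  also have "\<phi> (s + t) - \<phi> s = g (s + t) - g s - t / 2 * (g1 s + g1 (s + t))"
    by (simp add: \<phi>_def)
  finally show ?thesis .
qed

text \<open>The odd terms of the Taylor expansions at \<open>x + h\<close> and \<open>x - h\<close> cancel.\<close>

lemma second_difference_error:
  fixes D :: "nat \<Rightarrow> real \<Rightarrow> real"
  assumes der: "\<And>m x. m < 4 \<Longrightarrow> (D m has_real_derivative D (Suc m) x) (at x)"
    and K: "\<And>x. \<bar>D 4 x\<bar> \<le> K"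
  shows "\<bar>D 0 (x + h) + D 0 (x - h) - 2 * D 0 x - h\<^sup>2 * D 2 x\<bar> \<le> K * h ^ 4 / 12"
proof -
  have Taylor: "\<exists>t. D 0 (x + k) = (\<Sum>m<4. D m x / fact m * k ^ m) + D 4 t / fact 4 * k ^ 4" for k
  proof -
    have "((\<lambda>s. D m (x + s)) has_real_derivative D (Suc m) (x + t)) (at t)" if "m < 4" for m t
      using der[OF that, of "t + x"] by (simp add: DERIV_shift add.commute)
    then have "\<exists>t. \<bar>t\<bar> \<le> \<bar>k\<bar> \<and> D 0 (x + k) = (\<Sum>m<4. D m (x + 0) / fact m * k ^ m) + D 4 (x + t) / fact 4 * k ^ 4"
      by (intro Maclaurin_bi_le[where diff = "\<lambda>m s. D m (x + s)" and f = "\<lambda>s. D 0 (x + s)"]) simp_all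
    then show ?thesis by auto
  qed
  obtain t1 where t1: "D 0 (x + h) = (\<Sum>m<4. D m x / fact m * h ^ m) + D 4 t1 / fact 4 * h ^ 4"
    using Taylor[of h] by (elim exE)
  obtain t2 where t2: "D 0 (x + - h) = (\<Sum>m<4. D m x / fact m * (- h) ^ m) + D 4 t2 / fact 4 * (- h) ^ 4"
    using Taylor[of "- h"] by (elim exE)
  have "D 0 (x + h) + D 0 (x - h) - 2 * D 0 x - h\<^sup>2 * D 2 x = (D 4 t1 + D 4 t2) / 24 * h ^ 4"
  proof -
    have S: "(\<Sum>m<4. D m x / fact m * k ^ m) = D 0 x + D 1 x * k + D 2 x / 2 * k\<^sup>2 + D 3 x / 6 * k ^ 3" for k
      by (simp add: eval_nat_numeral)
    have "fact 4 = (24 :: real)" by (simp add: fact_numeral)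
    then show ?thesis using t1 t2 unfolding S by (simp add: algebra_simps)
  qed
  also have "\<bar>\<dots>\<bar> = \<bar>D 4 t1 + D 4 t2\<bar> * (h ^ 4 / 24)" by (simp add: abs_mult)
  also have "\<dots> \<le> (K + K) * (h ^ 4 / 24)"
    using K[of t1] K[of t2] by (intro mult_right_mono) auto
  finally show ?thesis by simp
qed

lemma second_difference_x:
  assumes C: "C_diff 4 g" and K: "\<And>p. \<bar>mixed 4 0 g p\<bar> \<le> K"
  shows "\<bar>g (x + h, y) + g (x - h, y) - 2 * g (x, y) - h\<^sup>2 * mixed 2 0 g (x, y)\<bar> \<le> K * h ^ 4 / 12"
proof -
  have "((\<lambda>s. mixed m 0 g (s, y)) has_real_derivative mixed (Suc m) 0 g (x, y)) (at x)" if "m < 4" for m x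
  proof -
    have "C_diff (Suc (3 - m)) (mixed m 0 g)"
      using C_diff_mixed[OF C, of m 0] that by (simp add: Suc_diff_le[symmetric] del: C_diff.simps)
    from dx_derivative[OF this] show ?thesis by simp
  qed
  from second_difference_error[where D = "\<lambda>m s. mixed m 0 g (s, y)", OF this K] show ?thesis by simp
qed

lemma second_difference_y:
  assumes C: "C_diff 4 g" and K: "\<And>p. \<bar>mixed 0 4 g p\<bar> \<le> K"
  shows "\<bar>g (x, y + h) + g (x, y - h) - 2 * g (x, y) - h\<^sup>2 * mixed 0 2 g (x, y)\<bar> \<le> K * h ^ 4 / 12"
proof -
  have "((\<lambda>s. mixed 0 m g (x, s)) has_real_derivative mixed 0 (Suc m) g (x, y)) (at y)" if "m < 4" for m y
  proof -
    have "C_diff (Suc (3 - m)) (mixed 0 m g)"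
      using C_diff_mixed[OF C, of 0 m] that by (simp add: Suc_diff_le[symmetric] del: C_diff.simps)
    from dy_derivative[OF this] show ?thesis by simp
  qed
  from second_difference_error[where D = "\<lambda>m s. mixed 0 m g (x, s)", OF this K] show ?thesis by simp
qed

definition restrict_grid :: "nat \<Rightarrow> (real \<times> real \<Rightarrow> real) \<Rightarrow> nat \<times> nat \<Rightarrow> real" where
  "restrict_grid M g = (\<lambda>(i, j). g (real i * mesh M, real j * mesh M))"

lemma mesh_period: "M > 0 \<Longrightarrow> real M * mesh M = 2 * pi"
  by (simp add: mesh_def)

text \<open>By periodicity, the cyclic neighbours of a grid point are its geometric neighbours, also at the ends.\<close>

lemma grid_neighbours:
  fixes G :: "real \<Rightarrow> real"
  assumes per: "\<And>x. G (x + 2 * pi) = G x" and i: "i < M"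
  shows "G (real ((i + 1) mod M) * mesh M) = G (real i * mesh M + mesh M)"
    and "(if i = 0 then G (real (M - 1) * mesh M) else G (real (i - 1) * mesh M)) = G (real i * mesh M - mesh M)"
proof -
  have M: "M > 0" using i by simp
  show "G (real ((i + 1) mod M) * mesh M) = G (real i * mesh M + mesh M)"
  proof (cases "i + 1 < M")
    case False
    then have eq: "i + 1 = M" using i by simp
    have "real i * mesh M + mesh M = 0 + 2 * pi"
      using mesh_period[OF M] eq[symmetric] by (simp add: distrib_right)
    then show ?thesis using per[of 0] eq by simp
  qed (simp add: distrib_right add.commute)
  show "(if i = 0 then G (real (M - 1) * mesh M) else G (real (i - 1) * mesh M)) = G (real i * mesh M - mesh M)"
  proof (cases "i = 0")
    case True
    have "real (M - 1) * mesh M = - mesh M + 2 * pi"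
      using mesh_period[OF M] M by (simp add: of_nat_diff left_diff_distrib)
    then show ?thesis using per[of "- mesh M"] True by simp
  next
    case False
    then show ?thesis by (simp add: of_nat_diff left_diff_distrib)
  qed
qed

text \<open>Only the sum of both operators is consistent.\<close>

lemma spatial_consistency:
  fixes \<epsilon> K :: real and g :: "real \<times> real \<Rightarrow> real" and M i j :: nat
  assumes C: "C_diff 4 g" and per: "periodic2 g"
    and K: "\<And>p. \<bar>mixed 4 0 g p\<bar> \<le> K" "\<And>p. \<bar>mixed 0 4 g p\<bar> \<le> K"
    and p: "(i, j) \<in> grid M"
  defines "c \<equiv> \<epsilon>\<^sup>2 / (mesh M)\<^sup>2" and "U \<equiv> restrict_grid M g"
  shows "\<bar>lap_a c M U (i, j) + lap_b c M U (i, j)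
      - \<epsilon>\<^sup>2 * (restrict_grid M (mixed 2 0 g) (i, j) + restrict_grid M (mixed 0 2 g) (i, j))\<bar>
    \<le> K * \<epsilon>\<^sup>2 * (mesh M)\<^sup>2"
proof -
  define h where "h = mesh M"
  define x y where "x = real i * h" and "y = real j * h"
  have ij: "i < M" "j < M" using p by (auto simp: grid_def)
  then have h: "h > 0" unfolding h_def by (intro mesh_pos) simp
  have px: "g (s + 2 * pi, r) = g (s, r)" "g (s, r + 2 * pi) = g (s, r)" for s r using per by (auto simp: periodic2_def)
  have K0: "K \<ge> 0" using K(1)[of undefined] by linarith
  define A where "A = g (x + h, y) + g (x - h, y) - 2 * g (x, y)"
  define B where "B = g (x, y + h) + g (x, y - h) - 2 * g (x, y)"
  have "diff_a M (\<lambda>k. U (k, j)) i + diff_b M (\<lambda>k. U (k, j)) i = A"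
    unfolding diff_a_add_diff_b[OF ij(1)]
    using grid_neighbours[of "\<lambda>s. g (s, y)", OF px(1) ij(1)]
    by (auto simp: U_def restrict_grid_def A_def x_def y_def h_def)
  moreover have "diff_a M (\<lambda>k. U (i, k)) j + diff_b M (\<lambda>k. U (i, k)) j = B"
    unfolding diff_a_add_diff_b[OF ij(2)]
    using grid_neighbours[of "\<lambda>s. g (x, s)", OF px(2) ij(2)]
    by (auto simp: U_def restrict_grid_def B_def x_def y_def h_def)
  ultimately have AB: "lap_a c M U (i, j) + lap_b c M U (i, j) = c * (A + B)"
    by (simp add: lap_a_def lap_b_def distrib_left[symmetric])
  have "lap_a c M U (i, j) + lap_b c M U (i, j)
      - \<epsilon>\<^sup>2 * (restrict_grid M (mixed 2 0 g) (i, j) + restrict_grid M (mixed 0 2 g) (i, j))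
    = \<epsilon>\<^sup>2 / h\<^sup>2 * ((A - h\<^sup>2 * mixed 2 0 g (x, y)) + (B - h\<^sup>2 * mixed 0 2 g (x, y)))"
  proof -
    have "restrict_grid M r (i, j) = r (x, y)" for r
      by (simp add: restrict_grid_def x_def y_def h_def)
    then show ?thesis
      unfolding AB unfolding c_def h_def[symmetric] using h by (simp add: field_simps)
  qed
  also have "\<bar>\<dots>\<bar> \<le> \<epsilon>\<^sup>2 / h\<^sup>2 * (K * h ^ 4 / 12 + K * h ^ 4 / 12)"
    unfolding abs_mult A_def B_def using second_difference_x[OF C K(1)] second_difference_y[OF C K(2)]
    by (intro mult_mono order_trans[OF abs_triangle_ineq] add_mono) auto
  also have "\<dots> = \<epsilon>\<^sup>2 * h\<^sup>2 * K / 6" using h by (simp add: field_simps eval_nat_numeral)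
  also have "\<dots> \<le> K * \<epsilon>\<^sup>2 * h\<^sup>2" using K0 by (simp add: mult_ac)
  finally show ?thesis by (simp add: h_def)
qed

section \<open>The error estimate\<close>

text \<open>The parabolic part of the step size restriction, in the form in which it bounds \<open>X\<close>.\<close>

lemma mesh_ratio_bound:
  assumes "M > 0" "\<epsilon> > 0" "\<kappa> > 0" "t \<le> step_bound \<epsilon> \<kappa> L M"
  shows "t * (\<epsilon>\<^sup>2 / (mesh M)\<^sup>2) \<le> 1"
proof -
  have h: "mesh M > 0" using assms mesh_pos by simp
  have "t \<le> 2 * (mesh M)\<^sup>2 / (\<kappa> * (mesh M)\<^sup>2 + 2 * \<epsilon>\<^sup>2)"
    using assms(4) by (simp add: step_bound_def)
  also have "\<dots> \<le> 2 * (mesh M)\<^sup>2 / (2 * \<epsilon>\<^sup>2)"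
    using assms h by (intro divide_left_mono mult_pos_pos add_nonneg_pos) auto
  finally have "t \<le> (mesh M)\<^sup>2 / \<epsilon>\<^sup>2" by simp
  then show ?thesis using assms h by (simp add: field_simps)
qed

text \<open>A bound for grid functions of which only the supremum is known; it settles coarse time steps.\<close>

lemma kappa_norm_crude_bound:
  assumes M: "M > 0" and v: "v \<in> carrier_mat M M" and \<epsilon>: "\<epsilon> > 0" and \<kappa>: "\<kappa> > 0"
    and b: "\<And>i j. \<lbrakk>i < M; j < M\<rbrakk> \<Longrightarrow> \<bar>v $$ (i, j)\<bar> \<le> B"
  shows "kappa_norm M \<epsilon> \<kappa> v \<le> 2 * pi * sqrt (4 * B\<^sup>2 * (\<epsilon>\<^sup>2 / (mesh M)\<^sup>2) + \<kappa> * B\<^sup>2)"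
proof -
  let ?v = "\<lambda>(i, j). v $$ (i, j)" and ?c = "\<epsilon>\<^sup>2 / (mesh M)\<^sup>2"
  have h: "mesh M > 0" using mesh_pos[OF M] .
  have d: "(cyclic_diff M w i)\<^sup>2 \<le> 4 * B\<^sup>2" if "i < M" "\<And>k. k < M \<Longrightarrow> \<bar>w k\<bar> \<le> B" for w i
  proof -
    have "\<bar>cyclic_diff M w i\<bar> \<le> 2 * B" using that(2)[OF that(1)] that(2)[of "(i + 1) mod M"] M by (simp add: cyclic_diff_def)
    then have "\<bar>cyclic_diff M w i\<bar>\<^sup>2 \<le> (2 * B)\<^sup>2" by (intro power_mono) auto
    then show ?thesis by (simp add: power_mult_distrib)
  qed
  have "grid_grad_sq M ?v \<le> (\<Sum>j<M. \<Sum>i<M. 4 * B\<^sup>2) + (\<Sum>i<M. \<Sum>j<M. 4 * B\<^sup>2)"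
    unfolding grid_grad_sq_def using b by (intro add_mono sum_mono d) auto
  then have G: "grid_grad_sq M ?v \<le> 8 * (real M)\<^sup>2 * B\<^sup>2" by (simp add: power2_eq_square mult_ac)
  have S: "grid_sq M ?v \<le> (real M)\<^sup>2 * B\<^sup>2" using b by (intro grid_sq_le_of_bound) (auto simp: grid_def)
  have "energy ?c \<kappa> M ?v \<le> ?c / 2 * (8 * (real M)\<^sup>2 * B\<^sup>2) + \<kappa> * ((real M)\<^sup>2 * B\<^sup>2)"
    unfolding energy_def using G S \<kappa> by (intro add_mono mult_left_mono) auto
  also have "\<dots> = (real M)\<^sup>2 * (4 * B\<^sup>2 * ?c + \<kappa> * B\<^sup>2)" by (simp add: algebra_simps)
  finally have "kappa_norm M \<epsilon> \<kappa> v \<le> mesh M * sqrt ((real M)\<^sup>2 * (4 * B\<^sup>2 * ?c + \<kappa> * B\<^sup>2))"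
    unfolding kappa_norm_energy[OF v M] using h by (intro mult_left_mono real_sqrt_le_mono) auto
  also have "\<dots> = (real M * mesh M) * sqrt (4 * B\<^sup>2 * ?c + \<kappa> * B\<^sup>2)"
    by (simp add: real_sqrt_mult)
  finally show ?thesis using mesh_period[OF M] by simp
qed

text \<open>For small \<open>\<tau>\<close> the discrete convergence result applies with the restrictions of the exact solution and of
  its time derivative. For \<open>\<tau>\<close> larger than a constant \<open>t0\<close> the parabolic restriction bounds \<open>h\<close> from below; the
  error is then bounded, and so is the right-hand side from below.\<close>

lemma SS2_convergence:
  fixes \<epsilon> \<kappa> \<beta> T L :: real and I :: "real set" and f f' :: "real \<Rightarrow> real"
    and u\<^sub>e :: "real \<Rightarrow> real \<times> real \<Rightarrow> real"
  assumes \<epsilon>: "\<epsilon> > 0" and T: "T > 0" and \<beta>: "\<beta> > 0"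
    and I: "{-\<beta>..\<beta>} \<subseteq> I"
    and f': "\<forall>\<xi>\<in>{-\<beta>..\<beta>}. (f has_real_derivative f' \<xi>) (at \<xi> within I)"
    and cf': "continuous_on {-\<beta>..\<beta>} f'"
    and odd: "\<forall>\<xi>\<in>I. -\<xi> \<in> I \<and> f (-\<xi>) = - f \<xi>" and f\<beta>: "f \<beta> = 0"
    and L: "L = (SUP \<xi>\<in>{-\<beta>..\<beta>}. \<bar>f' \<xi>\<bar>)"
    and \<kappa>: "\<kappa> > 0" "\<kappa> \<ge> L"
    and sol: "allen_cahn_solution \<epsilon> I f T u\<^sub>e"
    and reg: "C_time_space 3 4 T u\<^sub>e"
    and init: "sup_norm (u\<^sub>e 0) \<le> \<beta>"
  shows "\<exists>C>0. \<forall>M \<tau> u. M > 0 \<longrightarrow> 0 < \<tau> \<longrightarrow> \<tau> \<le> step_bound \<epsilon> \<kappa> L M \<longrightarrow>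
        SS2_solution M \<epsilon> \<kappa> \<beta> f \<tau> (grid_fun M (u\<^sub>e 0)) u \<longrightarrow>
        (\<forall>n. int n \<le> \<lfloor>T / \<tau>\<rfloor> \<longrightarrow>
          kappa_norm M \<epsilon> \<kappa> (grid_fun M (u\<^sub>e (real n * \<tau>)) - u n)
            \<le> C * (\<epsilon> ^ 4 * \<tau>\<^sup>2 / mesh M ^ 3 + \<epsilon>\<^sup>2 * \<tau>\<^sup>2 / mesh M
                   + \<tau>\<^sup>2 + \<epsilon>\<^sup>2 * (mesh M)\<^sup>2))"
proof -
  obtain v K where v0: "\<And>t. t \<in> {0..T} \<Longrightarrow> v 0 t = u\<^sub>e t"
    and C: "\<And>j t. j \<le> 3 \<Longrightarrow> t \<in> {0..T} \<Longrightarrow> C_diff 4 (v j t)"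
    and per: "\<And>j t. j \<le> 3 \<Longrightarrow> t \<in> {0..T} \<Longrightarrow> periodic2 (v j t)"
    and der: "\<And>j t p. j < 3 \<Longrightarrow> t \<in> {0..T} \<Longrightarrow> ((\<lambda>s. v j s p) has_real_derivative v (Suc j) t p) (at t within {0..T})"
    and joint: "\<And>j a b. j \<le> 3 \<Longrightarrow> a + b \<le> 4 \<Longrightarrow> continuous_on ({0..T} \<times> UNIV) (\<lambda>(t, p). mixed a b (v j t) p)"
    and K: "\<And>j a b t p. \<lbrakk>j \<le> 3; a + b \<le> 4; t \<in> {0..T}\<rbrakk> \<Longrightarrow> \<bar>mixed a b (v j t) p\<bar> \<le> K"
    by (rule C_time_space_regularity[OF reg]) blast
  have der1: "((\<lambda>s. v 0 s p) has_real_derivative v 1 t p) (at t within {0..T})"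
    "((\<lambda>s. v 1 s p) has_real_derivative v 2 t p) (at t within {0..T})"
    "((\<lambda>s. v 2 s p) has_real_derivative v 3 t p) (at t within {0..T})" if "t \<in> {0..T}" for t p
    using der[OF _ that, of 0 p] der[OF _ that, of 1 p] der[OF _ that, of 2 p] by (simp_all add: eval_nat_numeral)
  have pde: "v 0 t p \<in> I \<and> v 1 t p = \<epsilon>\<^sup>2 * (mixed 2 0 (v 0 t) p + mixed 0 2 (v 0 t) p) + f (v 0 t p)"
    if t: "t \<in> {0<..T}" and p: "p \<in> {0<..<2 * pi} \<times> {0<..<2 * pi}" for t p
  proof -
    have t': "t \<in> {0..T}" using t by simp
    have s: "u\<^sub>e t p \<in> I" "((\<lambda>s. u\<^sub>e s p) has_real_derivative \<epsilon>\<^sup>2 * laplacian (u\<^sub>e t) p + f (u\<^sub>e t p)) (at t within {0..T})"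
      using sol t p unfolding allen_cahn_solution_def by blast+
    have "((\<lambda>s. u\<^sub>e s p) has_real_derivative v 1 t p) (at t within {0..T})"
      using der1(1)[OF t'] unfolding has_field_derivative_def
      by (rule has_derivative_transform[OF t', rotated]) (simp add: v0)
    then have "((\<lambda>s. u\<^sub>e s p) has_vector_derivative v 1 t p) (at t within cbox 0 T)"
      unfolding has_real_derivative_iff_has_vector_derivative cbox_interval .
    moreover have "((\<lambda>s. u\<^sub>e s p) has_vector_derivative \<epsilon>\<^sup>2 * laplacian (u\<^sub>e t) p + f (u\<^sub>e t p)) (at t within cbox 0 T)"
      using s(2) unfolding has_real_derivative_iff_has_vector_derivative cbox_interval .
    ultimately have "v 1 t p = \<epsilon>\<^sup>2 * laplacian (u\<^sub>e t) p + f (u\<^sub>e t p)"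
      using t' by (intro vector_derivative_unique_within_closed_interval[OF T]) (simp_all only: cbox_interval)
    then show ?thesis using s(1) by (simp add: v0[OF t'] laplacian_mixed)
  qed
  have zT: "0 \<in> {0..T}" using T by simp
  have "\<bar>v 0 0 p\<bar> \<le> \<beta>" if "p \<in> square" for p
    using abs_le_sup_norm[OF C_diff_continuous[OF C[of 0 0]] that] init zT by (simp add: v0)
  then have bound: "\<bar>v 0 t p\<bar> \<le> \<beta>" if "t \<in> {0..T}" for t p
    using allen_cahn_upper_bound[where v = v and f = f and I = I and l = "f' \<beta>" and \<epsilon> = \<epsilon> and T = T and \<beta> = \<beta>]
      C per der1(1) joint pde f' f\<beta> odd \<beta> that by simp
  have flip: "\<bar>f a - f b\<bar> \<le> \<kappa> * \<bar>a - b\<bar>" if ab: "a \<in> {-\<beta>..\<beta>}" "b \<in> {-\<beta>..\<beta>}" for a b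
  proof (rule mean_value_bound[where a = "-\<beta>" and b = \<beta> and S = I and g' = f'])
    have "compact ((\<lambda>\<xi>. \<bar>f' \<xi>\<bar>) ` {-\<beta>..\<beta>})"
      by (intro compact_continuous_image continuous_intros cf') auto
    then have "\<bar>f' r\<bar> \<le> L" if "r \<in> {-\<beta>..\<beta>}" for r
      unfolding L using that by (intro cSUP_upper bounded_imp_bdd_above compact_imp_bounded)
    then show "\<bar>f' r\<bar> \<le> \<kappa>" if "r \<in> {-\<beta>..\<beta>}" for r using that \<kappa> by fastforce
  qed (use f' I ab in auto)
  have cf: "continuous_on {-\<beta>..\<beta>} f"
    using f' I by (intro DERIV_continuous_on[where D = f']) (auto intro: DERIV_subset)
  have pde': "v 1 t p = \<epsilon>\<^sup>2 * (mixed 2 0 (v 0 t) p + mixed 0 2 (v 0 t) p) + f (v 0 t p)"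
    if "t \<in> {0..T}" "p \<in> square" for t p
  proof (rule allen_cahn_closed_domain[where v = v and f = f and \<beta> = \<beta> and T = T])
    show "continuous_on ({0..T} \<times> UNIV) (\<lambda>(t, p). mixed a b (v j t) p)" if "j \<le> 1" "a + b \<le> 4" for j a b
      using that by (intro joint) auto
    show "v 1 t p = \<epsilon>\<^sup>2 * (mixed 2 0 (v 0 t) p + mixed 0 2 (v 0 t) p) + f (v 0 t p)"
      if "t \<in> {0<..T}" "p \<in> {0<..<2 * pi} \<times> {0<..<2 * pi}" for t p
      using pde[OF that] by (rule conjunct2)
  qed (use T cf bound that in auto)
  \<comment> \<open>one constant for the derivatives and for the consistency error, which carries \<open>\<epsilon>\<^sup>2\<close>\<close>
  define K1 where "K1 = K * (1 + \<epsilon>\<^sup>2)"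
  have K0: "K \<ge> 0" using K[of 0 0 0 0 undefined] zT by simp
  have K1: "K \<le> K1" "K * \<epsilon>\<^sup>2 \<le> K1" using K0 by (simp_all add: K1_def algebra_simps)
  define G where "G = growth_const \<epsilon> \<kappa> K1"
  define A where "A = 2 * exp (4 * (2 * G + 1) * T) * (G + 1)"
  \<comment> \<open>below \<open>t0\<close> the energy and Gronwall arguments are applicable\<close>
  define t0 where "t0 = min (1 / \<kappa>) (1 / (2 * (2 * G + 1)))"
  have G0: "G \<ge> 0" unfolding G_def growth_const_def
    using \<kappa>(1) residual_const_nonneg[of \<epsilon> \<kappa>] pairing_const_nonneg[OF \<kappa>(1), of \<epsilon>]
    by (intro add_nonneg_nonneg mult_nonneg_nonneg) auto
  then have A0: "A \<ge> 0" by (simp add: A_def)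
  have t0: "t0 > 0" using G0 \<kappa>(1) by (simp add: t0_def)
  define C1 where "C1 = 2 * pi * sqrt A * (1 / \<epsilon> ^ 4 + 1 / \<epsilon>\<^sup>2)"
  define C2 where "C2 = 2 * pi * sqrt (4 * (2 * \<beta>)\<^sup>2 * (1 / t0) + \<kappa> * (2 * \<beta>)\<^sup>2) / (\<epsilon> ^ 4 * t0)"
  have C12: "C1 \<ge> 0" "C2 \<ge> 0" using A0 t0 \<kappa>(1) by (auto simp: C1_def C2_def)
  have main: "kappa_norm M \<epsilon> \<kappa> (grid_fun M (u\<^sub>e (real n * \<tau>)) - u n)
      \<le> (C1 + C2 + 1) * (\<epsilon> ^ 4 * \<tau>\<^sup>2 / mesh M ^ 3 + \<epsilon>\<^sup>2 * \<tau>\<^sup>2 / mesh M + \<tau>\<^sup>2 + \<epsilon>\<^sup>2 * (mesh M)\<^sup>2)"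
    if M: "M > 0" and \<tau>: "0 < \<tau>" "\<tau> \<le> step_bound \<epsilon> \<kappa> L M"
      and ss: "SS2_solution M \<epsilon> \<kappa> \<beta> f \<tau> (grid_fun M (u\<^sub>e 0)) u" and n: "int n \<le> \<lfloor>T / \<tau>\<rfloor>" for M \<tau> u n
  proof -
    define h where "h = mesh M"
    have h: "h > 0" using mesh_pos[OF M] by (simp add: h_def)
    define R where "R = \<epsilon> ^ 4 * \<tau>\<^sup>2 / h ^ 3 + \<epsilon>\<^sup>2 * \<tau>\<^sup>2 / h + \<tau>\<^sup>2 + \<epsilon>\<^sup>2 * h\<^sup>2"
    have R0: "R \<ge> 0" using h by (simp add: R_def)
    have "real n \<le> T / \<tau>" using n by (simp add: le_floor_iff)
    then have nT: "real n * \<tau> \<le> T" using \<tau> by (simp add: field_simps)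
    have time: "real k * \<tau> \<in> {0..T}" if "k \<le> n" for k
    proof -
      have "real k * \<tau> \<le> real n * \<tau>" using that \<tau> by (intro mult_right_mono) auto
      then have "real k * \<tau> \<le> T" using nT by (rule order_trans)
      then show ?thesis using \<tau> by simp
    qed
    have ratio: "\<tau> * (\<epsilon>\<^sup>2 / h\<^sup>2) \<le> 1" unfolding h_def by (rule mesh_ratio_bound[OF M \<epsilon> \<kappa>(1) \<tau>(2)])
    obtain w where u0: "u 0 = grid_fun M (u\<^sub>e 0)"
      and step: "\<And>k. SS2_step M \<epsilon> \<kappa> \<beta> f \<tau> (u k) (w k) (u (Suc k))"
      using ss unfolding SS2_solution_def by metis
    have ucar: "u k \<in> carrier_mat M M" for k
      using step[of "k - 1"] u0 by (cases k) (auto simp: SS2_step_def grid_fun_def)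
    have pts: "(real i * h, real j * h) \<in> square" if "i < M" "j < M" for i j
    proof -
      have "real k * h \<le> 2 * pi" if "k < M" for k
        using mult_right_mono[of "real k" "real M" h] that mesh_period[OF M] h by (simp add: h_def)
      then show ?thesis using that h by auto
    qed
    have ub: "u k $$ (i, j) \<in> {-\<beta>..\<beta>}" if "i < M" "j < M" for k i j
    proof (cases k)
      case 0
      then show ?thesis using bound[OF zT, of "(real i * h, real j * h)"] that
        by (simp add: u0 grid_fun_def v0[OF zT] h_def abs_le_iff)
    next
      case (Suc m)
      then show ?thesis using step[of m] that by (auto simp: SS2_step_def)
    qed
    define U where "U k = restrict_grid M (v 0 (real k * \<tau>))" for k
    define V where "V k = restrict_grid M (v 1 (real k * \<tau>))" for k
    define E where "E = (\<lambda>(a :: real mat) (i, j). a $$ (i, j))"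
    have U_range: "U k p \<in> {-\<beta>..\<beta>}" if "k \<le> n" for k p
      using bound[OF time[OF that]] by (cases p) (auto simp: U_def restrict_grid_def abs_le_iff minus_le_iff)
    have E_range: "E (u k) p \<in> {-\<beta>..\<beta>}" if "p \<in> grid M" for k p
      using ub that by (auto simp: E_def grid_def simp del: atLeastAtMost_iff)
    have err: "(grid_fun M (u\<^sub>e (real n * \<tau>)) - u n) $$ (i, j) = U n (i, j) - E (u n) (i, j)" if "i < M" "j < M" for i j
      using that ucar[of n] by (simp add: grid_fun_def U_def E_def restrict_grid_def v0[OF time[OF order.refl]])
    have ecar: "grid_fun M (u\<^sub>e (real n * \<tau>)) - u n \<in> carrier_mat M M"
      by (rule minus_carrier_mat[OF ucar])
    show ?thesis
    proof (cases "\<tau> \<le> t0")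
      case True
      have lipV: "\<bar>v j t (x + k, y) - v j t (x, y)\<bar> \<le> K * k" "\<bar>v j t (x, y + k) - v j t (x, y)\<bar> \<le> K * k"
        if j: "j \<le> 3" and t: "t \<in> {0..T}" and k: "k \<ge> 0" for j t x y k
      proof -
        have Cj: "C_diff (Suc 3) (v j t)" using C[OF j t] by (simp add: eval_nat_numeral)
        have "\<bar>v j t (x + k, y) - v j t (x, y)\<bar> \<le> K * \<bar>x + k - x\<bar>"
          by (rule mean_value_bound[where a = x and b = "x + k" and S = UNIV and g' = "\<lambda>s. dx (v j t) (s, y)"])
            (use dx_derivative[OF Cj] K[OF j _ t, of 1 0] k in auto)
        then show "\<bar>v j t (x + k, y) - v j t (x, y)\<bar> \<le> K * k" using k by simp
        have "\<bar>v j t (x, y + k) - v j t (x, y)\<bar> \<le> K * \<bar>y + k - y\<bar>"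
          by (rule mean_value_bound[where a = y and b = "y + k" and S = UNIV and g' = "\<lambda>s. dy (v j t) (x, s)"])
            (use dy_derivative[OF Cj] K[OF j _ t, of 0 1] k in auto)
        then show "\<bar>v j t (x, y + k) - v j t (x, y)\<bar> \<le> K * k" using k by simp
      qed
      have time_inc: "\<bar>g (real (Suc k) * \<tau>) - g (real k * \<tau>)\<bar> \<le> B * \<tau>"
        if k: "k < n" and g: "\<And>t. t \<in> {0..T} \<Longrightarrow> (g has_real_derivative g' t) (at t within {0..T})"
          and B: "\<And>t. t \<in> {0..T} \<Longrightarrow> \<bar>g' t\<bar> \<le> B" for k B and g g' :: "real \<Rightarrow> real"
      proof -
        have "\<bar>g (real (Suc k) * \<tau>) - g (real k * \<tau>)\<bar> \<le> B * \<bar>real (Suc k) * \<tau> - real k * \<tau>\<bar>"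
          by (rule mean_value_bound[OF g _ B]) (use time[of k] time[of "Suc k"] k in simp_all)
        then show ?thesis using \<tau> by (simp add: distrib_right)
      qed
      have base: "restrict_grid M g (i, j) = g (real i * h, real j * h)" for g i j
        by (simp add: restrict_grid_def h_def)
      have shift: "restrict_grid M g (i + 1, j) = g (real i * h + h, real j * h)"
        "restrict_grid M g (i, j + 1) = g (real i * h, real j * h + h)" for g i j
        by (simp_all add: restrict_grid_def h_def distrib_right add.commute)
      have K1h: "K * h \<le> K1 * h" using K1(1) h by (intro mult_right_mono) auto
      let ?c = "\<epsilon>\<^sup>2 / (mesh M)\<^sup>2"
      have "energy ?c \<kappa> M (\<lambda>p. U n p - E (u n) p)
        \<le> 2 * (exp (4 * (2 * growth_const \<epsilon> \<kappa> K1 + 1) * (real n * \<tau>)) * (growth_const \<epsilon> \<kappa> K1 + 1)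
          * ((real M)\<^sup>2 * (\<tau>\<^sup>2 / mesh M ^ 3 + (mesh M)\<^sup>2)\<^sup>2))"
      proof (rule discrete_convergence[where V = V and w = "\<lambda>k. E (w k)" and f = f])
        show "\<tau> * \<kappa> \<le> 1" using True \<kappa>(1) by (simp add: t0_def field_simps)
        show "\<tau> * (\<epsilon>\<^sup>2 / (mesh M)\<^sup>2) \<le> 1" using ratio by (simp add: h_def)
        have "\<tau> \<le> 1 / (2 * (2 * G + 1))" using True by (simp add: t0_def)
        then show "(2 * growth_const \<epsilon> \<kappa> K1 + 1) * \<tau> \<le> 1 / 2"
          using G0 unfolding G_def[symmetric] by (simp add: field_simps)
        show "E (u 0) p = U 0 p" if "p \<in> grid M" for p
          using that by (auto simp: E_def U_def u0 grid_fun_def grid_def restrict_grid_def v0[OF zT])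
        show "2 / \<tau> * (E (w k) p - E (u k) p) = lap_a ?c M (E (u k)) p + lap_b ?c M (E (w k)) p + f (E (u k) p) - \<kappa> * (E (w k) p - E (u k) p)"
          "2 / \<tau> * (E (u (Suc k)) p - E (w k) p) = lap_a ?c M (E (u (Suc k))) p + lap_b ?c M (E (w k)) p + f (E (u (Suc k)) p)
            + \<kappa> * (E (u (Suc k)) p - E (w k) p)" if "p \<in> grid M" for k p
          unfolding E_def by (rule SS2_step_entries[OF step ucar that])+
        show "\<bar>f (U k p) - f (E (u k) p)\<bar> \<le> \<kappa> * \<bar>U k p - E (u k) p\<bar>" if "k \<le> n" "p \<in> grid M" for k p
          by (rule flip[OF U_range[OF that(1)] E_range[OF that(2)]])
        show "\<bar>lap_a ?c M (U k) p + lap_b ?c M (U k) p + f (U k p) - V k p\<bar> \<le> K1 * (mesh M)\<^sup>2" if k: "k \<le> n" and p: "p \<in> grid M" for k p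
        proof -
          obtain i j where ij: "p = (i, j)" "i < M" "j < M" using p by (auto simp: grid_def)
          let ?t = "real k * \<tau>"
          have "\<bar>lap_a ?c M (U k) (i, j) + lap_b ?c M (U k) (i, j)
              - \<epsilon>\<^sup>2 * (restrict_grid M (mixed 2 0 (v 0 ?t)) (i, j) + restrict_grid M (mixed 0 2 (v 0 ?t)) (i, j))\<bar>
            \<le> K * \<epsilon>\<^sup>2 * (mesh M)\<^sup>2"
            unfolding U_def using p ij C[OF _ time[OF k]] per[OF _ time[OF k]] K[OF _ _ time[OF k], of 0 4 0]
              K[OF _ _ time[OF k], of 0 0 4]
            by (intro spatial_consistency) simp_all
          moreover have "V k (i, j) = \<epsilon>\<^sup>2 * (restrict_grid M (mixed 2 0 (v 0 ?t)) (i, j) + restrict_grid M (mixed 0 2 (v 0 ?t)) (i, j))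
              + f (U k (i, j))"
            using pde'[OF time[OF k] pts[OF ij(2,3)]] by (simp add: V_def U_def restrict_grid_def h_def)
          moreover have "K * \<epsilon>\<^sup>2 * (mesh M)\<^sup>2 \<le> K1 * (mesh M)\<^sup>2" using K1 by (intro mult_right_mono) auto
          ultimately show ?thesis using ij by simp
        qed
        show "\<bar>U (Suc k) p - U k p - \<tau> / 2 * (V k p + V (Suc k) p)\<bar> \<le> K1 * \<tau> ^ 3" if k: "k < n" for k p
        proof -
          obtain i j where ij: "p = (i, j)" by (cases p)
          let ?q = "(real i * mesh M, real j * mesh M)"
          have "\<bar>v 0 (real k * \<tau> + \<tau>) ?q - v 0 (real k * \<tau>) ?q - \<tau> / 2 * (v 1 (real k * \<tau>) ?q + v 1 (real k * \<tau> + \<tau>) ?q)\<bar> \<le> K * \<tau> ^ 3"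
            using \<tau> time[of "Suc k"] k K[of 3 0 0]
            by (intro trapezoid_error[where T = T and ?g2.0 = "\<lambda>t. v 2 t ?q" and ?g3.0 = "\<lambda>t. v 3 t ?q"] der1)
              (auto simp: distrib_right add.commute)
          also have "\<dots> \<le> K1 * \<tau> ^ 3" using K1 \<tau> by (intro mult_right_mono) auto
          finally show ?thesis by (simp add: ij U_def V_def restrict_grid_def distrib_right add.commute)
        qed
        show "\<bar>V k p\<bar> \<le> K1" if "k \<le> n" for k p
          using K[OF _ _ time[OF that], of 1 0 0] K1 by (cases p) (auto simp: V_def restrict_grid_def intro: order_trans)
        show "\<bar>V k (i + 1, j) - V k (i, j)\<bar> \<le> K1 * mesh M" if "k \<le> n" for k i j
          unfolding V_def shift unfolding base h_def[symmetric]
          by (rule order_trans[OF lipV(1)[OF _ time[OF that]] K1h]) (use h in simp_all)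
        show "\<bar>V k (i, j + 1) - V k (i, j)\<bar> \<le> K1 * mesh M" if "k \<le> n" for k i j
          unfolding V_def shift unfolding base h_def[symmetric]
          by (rule order_trans[OF lipV(2)[OF _ time[OF that]] K1h]) (use h in simp_all)
        show "\<bar>V (Suc k) p - V k p\<bar> \<le> K1 * \<tau>" if "k < n" for k p
        proof -
          obtain i j where p: "p = (i, j)" by (cases p)
          have v2: "\<bar>v 2 t q\<bar> \<le> K" if "t \<in> {0..T}" for t q using K[of 2 0 0 t q] that by simp
          have "\<bar>V (Suc k) p - V k p\<bar> \<le> K * \<tau>"
            unfolding V_def p base by (rule time_inc[OF that der1(2) v2])
          also have "\<dots> \<le> K1 * \<tau>" using K1(1) \<tau>(1) by (intro mult_right_mono) auto
          finally show ?thesis .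
        qed
        \<comment> \<open>a difference in space commutes with a difference in time, so it inherits the Lipschitz bound of \<open>v 2\<close>\<close>
        have mixed_inc: "\<bar>(V (Suc k) p - V k p) - (V (Suc k) q - V k q)\<bar> \<le> K1 * \<tau> * mesh M"
          if k: "k < n" and pq: "\<And>t. t \<in> {0..T} \<Longrightarrow> \<bar>restrict_grid M (v 2 t) p - restrict_grid M (v 2 t) q\<bar> \<le> K * h" for k p q
        proof -
          let ?r = "\<lambda>t. restrict_grid M (v 1 t) p - restrict_grid M (v 1 t) q"
          have d: "(?r has_real_derivative restrict_grid M (v 2 t) p - restrict_grid M (v 2 t) q) (at t within {0..T})"
            if "t \<in> {0..T}" for t
            using der1(2)[OF that] by (cases p; cases q) (auto simp: restrict_grid_def intro!: DERIV_diff)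
          have "\<bar>?r (real (Suc k) * \<tau>) - ?r (real k * \<tau>)\<bar> \<le> K * h * \<tau>"
            by (rule time_inc[OF k d pq])
          also have "K * h * \<tau> \<le> K1 * \<tau> * mesh M"
            using mult_right_mono[OF K1(1), of "\<tau> * h"] \<tau> h by (simp add: mult_ac h_def)
          finally show ?thesis by (simp add: V_def algebra_simps)
        qed
        show "\<bar>(V (Suc k) (i + 1, j) - V k (i + 1, j)) - (V (Suc k) (i, j) - V k (i, j))\<bar> \<le> K1 * \<tau> * mesh M"
          "\<bar>(V (Suc k) (i, j + 1) - V k (i, j + 1)) - (V (Suc k) (i, j) - V k (i, j))\<bar> \<le> K1 * \<tau> * mesh M" if "k < n" for k i j
          by (rule mixed_inc[OF that]; unfold shift; unfold base; rule lipV; use h in simp)+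
      qed (use M \<epsilon> \<kappa> \<tau> in auto)
      also have "\<dots> \<le> A * ((real M)\<^sup>2 * (\<tau>\<^sup>2 / h ^ 3 + h\<^sup>2)\<^sup>2)"
      proof -
        have "exp (4 * (2 * G + 1) * (real n * \<tau>)) \<le> exp (4 * (2 * G + 1) * T)"
          using nT G0 by simp
        then have "2 * (exp (4 * (2 * G + 1) * (real n * \<tau>)) * (G + 1)) \<le> A"
          unfolding A_def using G0 by (simp add: mult_right_mono)
        from mult_right_mono[OF this, of "(real M)\<^sup>2 * (\<tau>\<^sup>2 / h ^ 3 + h\<^sup>2)\<^sup>2"]
        show ?thesis by (simp add: G_def h_def mult_ac)
      qed
      finally have en: "energy ?c \<kappa> M (\<lambda>p. U n p - E (u n) p) \<le> A * ((real M)\<^sup>2 * (\<tau>\<^sup>2 / h ^ 3 + h\<^sup>2)\<^sup>2)" .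
      have "kappa_norm M \<epsilon> \<kappa> (grid_fun M (u\<^sub>e (real n * \<tau>)) - u n)
         = h * sqrt (energy ?c \<kappa> M (\<lambda>p. U n p - E (u n) p))"
        unfolding kappa_norm_energy[OF ecar M] h_def
        using err M by (auto simp: energy_def grid_grad_sq_def grid_sq_def cyclic_diff_def grid_def intro!: arg_cong[of _ _ sqrt] arg_cong2[of _ _ _ _ "(+)"] sum.cong)
      also have "\<dots> \<le> h * sqrt (A * ((real M)\<^sup>2 * (\<tau>\<^sup>2 / h ^ 3 + h\<^sup>2)\<^sup>2))"
        using h en by (intro mult_left_mono real_sqrt_le_mono) auto
      also have "\<dots> = (real M * h) * sqrt A * (\<tau>\<^sup>2 / h ^ 3 + h\<^sup>2)"
        using h by (simp add: real_sqrt_mult)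
      also have "\<dots> = 2 * pi * sqrt A * (\<tau>\<^sup>2 / h ^ 3 + h\<^sup>2)" using mesh_period[OF M] by (simp add: h_def)
      also have "\<dots> \<le> 2 * pi * sqrt A * ((1 / \<epsilon> ^ 4 + 1 / \<epsilon>\<^sup>2) * R)"
      proof (rule mult_left_mono)
        have "\<tau>\<^sup>2 / h ^ 3 = 1 / \<epsilon> ^ 4 * (\<epsilon> ^ 4 * \<tau>\<^sup>2 / h ^ 3)" using \<epsilon> by simp
        also have "\<dots> \<le> 1 / \<epsilon> ^ 4 * R" using h unfolding R_def by (intro mult_left_mono) auto
        finally have 1: "\<tau>\<^sup>2 / h ^ 3 \<le> 1 / \<epsilon> ^ 4 * R" .
        have "h\<^sup>2 = 1 / \<epsilon>\<^sup>2 * (\<epsilon>\<^sup>2 * h\<^sup>2)" using \<epsilon> by simp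
        also have "\<dots> \<le> 1 / \<epsilon>\<^sup>2 * R" using h unfolding R_def by (intro mult_left_mono) auto
        finally show "\<tau>\<^sup>2 / h ^ 3 + h\<^sup>2 \<le> (1 / \<epsilon> ^ 4 + 1 / \<epsilon>\<^sup>2) * R" using 1 by (simp add: distrib_right)
      qed (use A0 in simp)
      also have "\<dots> = C1 * R" by (simp add: C1_def)
      also have "\<dots> \<le> (C1 + C2 + 1) * R" using C12 R0 by (intro mult_right_mono) auto
      finally show ?thesis by (simp add: R_def h_def)
    next
      case False
      \<comment> \<open>a coarse time step forces a coarse mesh\<close>
      have c: "\<epsilon>\<^sup>2 / h\<^sup>2 \<le> 1 / t0"
      proof -
        have "t0 * (\<epsilon>\<^sup>2 / h\<^sup>2) \<le> \<tau> * (\<epsilon>\<^sup>2 / h\<^sup>2)" using False by (intro mult_right_mono) auto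
        then show ?thesis using ratio t0 by (simp add: field_simps)
      qed
      then have h2: "\<epsilon>\<^sup>2 * t0 \<le> h\<^sup>2" using t0 h by (simp add: field_simps)
      have "\<bar>(grid_fun M (u\<^sub>e (real n * \<tau>)) - u n) $$ (i, j)\<bar> \<le> 2 * \<beta>" if "i < M" "j < M" for i j
        unfolding err[OF that] using U_range[of n "(i, j)"] E_range[of "(i, j)" n] that by (simp add: grid_def abs_le_iff)
      from kappa_norm_crude_bound[OF M ecar \<epsilon> \<kappa>(1) this]
      have "kappa_norm M \<epsilon> \<kappa> (grid_fun M (u\<^sub>e (real n * \<tau>)) - u n)
        \<le> 2 * pi * sqrt (4 * (2 * \<beta>)\<^sup>2 * (\<epsilon>\<^sup>2 / h\<^sup>2) + \<kappa> * (2 * \<beta>)\<^sup>2)" by (simp add: h_def)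
      also have "\<dots> \<le> 2 * pi * sqrt (4 * (2 * \<beta>)\<^sup>2 * (1 / t0) + \<kappa> * (2 * \<beta>)\<^sup>2)"
        using c \<kappa>(1) by (intro mult_left_mono real_sqrt_le_mono add_mono) auto
      also have "\<dots> = C2 * (\<epsilon> ^ 4 * t0)" using \<epsilon> t0 by (simp add: C2_def)
      also have "\<dots> \<le> C2 * R"
      proof (rule mult_left_mono)
        have "\<epsilon> ^ 4 * t0 = \<epsilon>\<^sup>2 * (\<epsilon>\<^sup>2 * t0)" by (simp add: eval_nat_numeral)
        also have "\<dots> \<le> \<epsilon>\<^sup>2 * h\<^sup>2" using h2 by (intro mult_left_mono) auto
        also have "\<dots> \<le> R" using h by (simp add: R_def)
        finally show "\<epsilon> ^ 4 * t0 \<le> R" .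
      qed (rule C12)
      also have "\<dots> \<le> (C1 + C2 + 1) * R" using C12 R0 by (intro mult_right_mono) auto
      finally show ?thesis by (simp add: R_def h_def)
    qed
  qed
  show ?thesis
    by (rule exI[of _ "C1 + C2 + 1"]) (use main C12 in auto)
qed

theorem theorem4p2:
  fixes \<epsilon> \<kappa> \<beta> T L :: real and I :: "real set" and f f' :: "real \<Rightarrow> real"
    and u\<^sub>e :: "real \<Rightarrow> real \<times> real \<Rightarrow> real"
  assumes "\<epsilon> > 0" and "T > 0" and "\<beta> > 0"
    and "is_interval I" and "{-\<beta>..\<beta>} \<subseteq> I"
    and "\<forall>\<xi>\<in>{-\<beta>..\<beta>}. (f has_real_derivative f' \<xi>) (at \<xi> within I)"
    and "continuous_on {-\<beta>..\<beta>} f'"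
    and "\<forall>\<xi>\<in>I. -\<xi> \<in> I \<and> f (-\<xi>) = - f \<xi>" and "f \<beta> = 0"
    and "L = (SUP \<xi>\<in>{-\<beta>..\<beta>}. \<bar>f' \<xi>\<bar>)"
    and "\<kappa> > 0" and "\<kappa> \<ge> L"
    and "allen_cahn_solution \<epsilon> I f T u\<^sub>e"
    and "C_time_space 3 4 T u\<^sub>e"
    and "sup_norm (u\<^sub>e 0) \<le> \<beta>"
  shows
    "(\<exists>C>0. \<forall>M \<tau> u. M > 0 \<longrightarrow> 0 < \<tau> \<longrightarrow> \<tau> \<le> step_bound \<epsilon> \<kappa> L M \<longrightarrow>
        SS2_solution M \<epsilon> \<kappa> \<beta> f \<tau> (grid_fun M (u\<^sub>e 0)) u \<longrightarrow>
        (\<forall>n. int n \<le> \<lfloor>T / \<tau>\<rfloor> \<longrightarrow>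
          kappa_norm M \<epsilon> \<kappa> (grid_fun M (u\<^sub>e (real n * \<tau>)) - u n)
            \<le> C * (\<epsilon> ^ 4 * \<tau>\<^sup>2 / mesh M ^ 3 + \<epsilon>\<^sup>2 * \<tau>\<^sup>2 / mesh M
                   + \<tau>\<^sup>2 + \<epsilon>\<^sup>2 * (mesh M)\<^sup>2)))
     \<and> (\<forall>c>0. \<exists>C>0. \<forall>M \<tau> u. M > 0 \<longrightarrow> 0 < \<tau> \<longrightarrow> \<tau> \<le> step_bound \<epsilon> \<kappa> L M \<longrightarrow>
        mesh M \<ge> c * \<epsilon> powr (4 / 3) \<longrightarrow>
        SS2_solution M \<epsilon> \<kappa> \<beta> f \<tau> (grid_fun M (u\<^sub>e 0)) u \<longrightarrow>
        (\<forall>n. int n \<le> \<lfloor>T / \<tau>\<rfloor> \<longrightarrow>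
          kappa_norm M \<epsilon> \<kappa> (grid_fun M (u\<^sub>e (real n * \<tau>)) - u n)
            \<le> C * (\<tau>\<^sup>2 + \<epsilon>\<^sup>2 * (mesh M)\<^sup>2)))"
proof -
  note first = SS2_convergence[OF assms(1-3,5-15)]
  then obtain C where C: "C > 0"
    "\<And>M \<tau> u n. \<lbrakk>M > 0; 0 < \<tau>; \<tau> \<le> step_bound \<epsilon> \<kappa> L M; SS2_solution M \<epsilon> \<kappa> \<beta> f \<tau> (grid_fun M (u\<^sub>e 0)) u; int n \<le> \<lfloor>T / \<tau>\<rfloor>\<rbrakk> \<Longrightarrow>
      kappa_norm M \<epsilon> \<kappa> (grid_fun M (u\<^sub>e (real n * \<tau>)) - u n)
        \<le> C * (\<epsilon> ^ 4 * \<tau>\<^sup>2 / mesh M ^ 3 + \<epsilon>\<^sup>2 * \<tau>\<^sup>2 / mesh M + \<tau>\<^sup>2 + \<epsilon>\<^sup>2 * (mesh M)\<^sup>2)"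
    by auto
  have second: "\<exists>C'>0. \<forall>M \<tau> u. M > 0 \<longrightarrow> 0 < \<tau> \<longrightarrow> \<tau> \<le> step_bound \<epsilon> \<kappa> L M \<longrightarrow>
        mesh M \<ge> c * \<epsilon> powr (4 / 3) \<longrightarrow>
        SS2_solution M \<epsilon> \<kappa> \<beta> f \<tau> (grid_fun M (u\<^sub>e 0)) u \<longrightarrow>
        (\<forall>n. int n \<le> \<lfloor>T / \<tau>\<rfloor> \<longrightarrow>
          kappa_norm M \<epsilon> \<kappa> (grid_fun M (u\<^sub>e (real n * \<tau>)) - u n)
            \<le> C' * (\<tau>\<^sup>2 + \<epsilon>\<^sup>2 * (mesh M)\<^sup>2))" if c: "c > 0" for c
  proof -
    \<comment> \<open>\<open>\<epsilon>\<close> is fixed, so this is a positive lower bound of the mesh width\<close>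
    define H where "H = c * \<epsilon> powr (4 / 3)"
    have H: "H > 0" using c assms(1) by (simp add: H_def)
    define B where "B = \<epsilon> ^ 4 / H ^ 3 + \<epsilon>\<^sup>2 / H + 1"
    have B: "B > 0" using H assms(1) unfolding B_def by (intro add_nonneg_pos) auto
    have "kappa_norm M \<epsilon> \<kappa> (grid_fun M (u\<^sub>e (real n * \<tau>)) - u n) \<le> C * B * (\<tau>\<^sup>2 + \<epsilon>\<^sup>2 * (mesh M)\<^sup>2)"
      if a: "M > 0" "0 < \<tau>" "\<tau> \<le> step_bound \<epsilon> \<kappa> L M" "SS2_solution M \<epsilon> \<kappa> \<beta> f \<tau> (grid_fun M (u\<^sub>e 0)) u"
        "int n \<le> \<lfloor>T / \<tau>\<rfloor>" and h: "H \<le> mesh M" for M \<tau> u n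
    proof -
      have "\<epsilon> ^ 4 * \<tau>\<^sup>2 / mesh M ^ 3 \<le> \<epsilon> ^ 4 * \<tau>\<^sup>2 / H ^ 3"
        using h H by (intro divide_left_mono power_mono mult_pos_pos) auto
      moreover have "\<epsilon>\<^sup>2 * \<tau>\<^sup>2 / mesh M \<le> \<epsilon>\<^sup>2 * \<tau>\<^sup>2 / H"
        using h H by (intro divide_left_mono mult_pos_pos) auto
      moreover have "\<epsilon>\<^sup>2 * (mesh M)\<^sup>2 \<le> B * (\<epsilon>\<^sup>2 * (mesh M)\<^sup>2)"
      proof -
        have "1 \<le> B" using H by (simp add: B_def)
        from mult_right_mono[OF this, of "\<epsilon>\<^sup>2 * (mesh M)\<^sup>2"] show ?thesis by simp
      qed
      ultimately have "\<epsilon> ^ 4 * \<tau>\<^sup>2 / mesh M ^ 3 + \<epsilon>\<^sup>2 * \<tau>\<^sup>2 / mesh M + \<tau>\<^sup>2 + \<epsilon>\<^sup>2 * (mesh M)\<^sup>2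
        \<le> B * (\<tau>\<^sup>2 + \<epsilon>\<^sup>2 * (mesh M)\<^sup>2)"
        by (simp add: B_def distrib_left distrib_right)
      then have "C * (\<epsilon> ^ 4 * \<tau>\<^sup>2 / mesh M ^ 3 + \<epsilon>\<^sup>2 * \<tau>\<^sup>2 / mesh M + \<tau>\<^sup>2 + \<epsilon>\<^sup>2 * (mesh M)\<^sup>2)
        \<le> C * (B * (\<tau>\<^sup>2 + \<epsilon>\<^sup>2 * (mesh M)\<^sup>2))"
        using C(1) by (intro mult_left_mono) auto
      then show ?thesis using C(2)[OF a] by (simp add: mult.assoc)
    qed
    then show ?thesis using C(1) B by (intro exI[of _ "C * B"]) (auto simp: H_def)
  qed
  show ?thesis using first second by blast
qed

end
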